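(* Let $K,K'$ be two finite Galois extensions of $\mathbf{Q}$ (inside a fixed algebraic closure $\overline{\mathbf{Q}}$). Then \[\mathcal{O}_K\subseteq\mathcal{O}_{K'}\iff \mathrm{Int}_{\mathbf{Q}}(\mathcal{O}_{K'})\subseteq\mathrm{Int}_{\mathbf{Q}}(\mathcal{O}_{K}).\]
   Context: For a number field $K$, $\mathcal{O}_K$ denotes its ring of algebraic integers, and $\mathrm{Int}_{\mathbf{Q}}(\mathcal{O}_K):=\{f\in\mathbf{Q}[X] \mid f(\mathcal{O}_K)\subseteq\mathcal{O}_K\}$. *)

theory Defs
  imports "HOL-Computational_Algebra.Computational_Algebra"
begin

definition is_subfield :: "'a::field set \<Rightarrow> bool" where
  "is_subfield K \<longleftrightarrow>
     0 \<in> K \<and> 1 \<in> K \<and>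
     (\<forall>x\<in>K. \<forall>y\<in>K. x + y \<in> K \<and> x * y \<in> K) \<and>
     (\<forall>x\<in>K. - x \<in> K \<and> inverse x \<in> K)"

abbreviation rat_scale :: "rat \<Rightarrow> 'a::field_char_0 \<Rightarrow> 'a" where
  "rat_scale q x \<equiv> of_rat q * x"

lemma vector_space_rat_scale: "vector_space (rat_scale :: rat \<Rightarrow> 'a::field_char_0 \<Rightarrow> 'a)"
  by unfold_locales (auto simp: algebra_simps of_rat_add of_rat_mult)

definition finite_over_rat :: "'a::field_char_0 set \<Rightarrow> bool" where
  "finite_over_rat K \<longleftrightarrow> (\<exists>B. finite B \<and> B \<subseteq> K \<and> module.span rat_scale B = K)"

definition number_field :: "'a::field_char_0 set \<Rightarrow> bool" where
  "number_field K \<longleftrightarrow> is_subfield K \<and> finite_over_rat K"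

abbreviation of_rat_poly :: "rat poly \<Rightarrow> 'a::field_char_0 poly" where
  "of_rat_poly \<equiv> map_poly of_rat"

definition splits_over :: "'a::field_char_0 set \<Rightarrow> rat poly \<Rightarrow> bool" where
  "splits_over K p \<longleftrightarrow>
     (\<exists>A. set_mset A \<subseteq> K \<and>
          of_rat_poly p = smult (of_rat (lead_coeff p)) (\<Prod>x\<in>#A. [:- x, 1:]))"

definition normal_over_rat :: "'a::field_char_0 set \<Rightarrow> bool" where
  "normal_over_rat K \<longleftrightarrow>
     (\<forall>p. irreducible p \<and> (\<exists>x\<in>K. poly (of_rat_poly p) x = 0) \<longrightarrow> splits_over K p)"

text \<open>
  The condition \<^const>\<open>rsquarefree\<close> only sees multiple roots in the ambient type,
  which is therefore required to be algebraically closed.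
\<close>
definition separable_over_rat :: "'a::{field_char_0, alg_closed_field} set \<Rightarrow> bool" where
  "separable_over_rat K \<longleftrightarrow>
     (\<forall>p. irreducible p \<and> (\<exists>x\<in>K. poly (of_rat_poly p) x = 0) \<longrightarrow>
          rsquarefree (of_rat_poly p :: 'a poly))"

definition finite_galois_over_rat :: "'a::{field_char_0, alg_closed_field} set \<Rightarrow> bool" where
  "finite_galois_over_rat K \<longleftrightarrow>
     number_field K \<and> normal_over_rat K \<and> separable_over_rat K"

definition ring_of_integers :: "'a::field_char_0 set \<Rightarrow> 'a set" (\<open>\<O>\<close>) where
  "\<O> K = {x \<in> K. algebraic_int x}"

definition Int_rat :: "'a::field_char_0 set \<Rightarrow> rat poly set" where
  "Int_rat S = {f. poly (of_rat_poly f) ` S \<subseteq> S}"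

end

(* If O_K is not contained in O_K', then L = K K' has degree m >= 2n over Q, where n = [K' : Q].  The polynomial
   (X^p - X)/p lies in Int_Q(O_K') iff p splits completely in K' (up to finitely many p), so almost every prime that
   splits completely in K' also splits completely in L.  This contradicts the density of such primes (Bauer's
   theorem), for which an elementary counting argument suffices; no zeta functions, units or class groups are used.
   For a Galois field of degree d and a set S of primes, count the finite sets T of pairs (p, r) with p in S and r a
   conjugate of the primitive element, i.e. the squarefree products of primes above S, by their norm.
   Upper bound O(x), if all p in S split: by the pigeonhole principle each T divides an element of a box of side
   about N(T)^(1/d), with bounded cofactor.  Lower bound c x, if S contains almost all split primes: in a box of
   side B, most elements congruent to 1 modulo Y! have squarefree norm, and then only split primes divide it; the
   elements of the box with the same T are few, because their differences have large norm.
   Finally the lower bound for d = n makes the sum of 1/N(T) diverge, and pairs (T1, T2) then give more than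
   O(x) sets for d = 2n. *)

theory Submission
  imports Defs "Jordan_Normal_Form.Char_Poly" "HOL-Computational_Algebra.Field_as_Ring"
begin

section \<open>The ring of algebraic integers\<close>

text \<open>Heuristically the contradiction is one of pole orders: the sets T with n labels per
  prime give a Dirichlet series with a simple pole at 1, and 2n labels contain two disjoint copies
  of n labels, so the same primes would give a double pole, which linear growth forbids. Only the
  number of labels matters in this comparison, not the fields. The obstacle is to handle primes of a
  number field without ideal factorisation. For each p one prime \<open>\<PP> p\<close> of the ring
  of all algebraic integers is fixed; the primes of a Galois field M above p are its pullbacks under
  the automorphisms \<open>cj r\<close>. So a pair (p, r) names a prime, and membership of a
  conjugate in \<open>\<PP> p\<close> replaces divisibility by it. Divisors p of a denominator E are
  left out: for the other p, the intersection of the primes above p is generated by p, and this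
  yields the powers of p in norms that the counting needs. Norm estimates need an absolute value,
  which the ambient type does not carry; sizes are measured through an embedding of the compositum
  into the complex numbers.\<close>

definition int_span :: "'a::field_char_0 set \<Rightarrow> 'a set" where
  "int_span B = range (\<lambda>f :: 'a \<Rightarrow> int. \<Sum>b\<in>B. of_int (f b) * b)"

lemma int_spanI: "x = (\<Sum>b\<in>B. of_int (f b) * b) \<Longrightarrow> x \<in> int_span B"
  by (auto simp: int_span_def)

lemma int_span_base:
  assumes "finite B" "b \<in> B"
  shows "b \<in> int_span B"
proof (rule int_spanI)
  have "(\<Sum>x\<in>B. of_int (if x = b then 1 else 0) * x) = (\<Sum>x\<in>B. if x = b then b else 0)"
    by (intro sum.cong) auto
  then show "b = (\<Sum>x\<in>B. of_int (if x = b then 1 else 0) * x)"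
    using assms by simp
qed

lemma int_span_add:
  assumes "x \<in> int_span B" "y \<in> int_span B"
  shows "x + y \<in> int_span B"
proof -
  obtain f g :: "_ \<Rightarrow> int" where "x = (\<Sum>b\<in>B. of_int (f b) * b)" "y = (\<Sum>b\<in>B. of_int (g b) * b)"
    using assms by (auto simp: int_span_def)
  then show ?thesis
    by (intro int_spanI[where f = "\<lambda>b. f b + g b"]) (simp add: algebra_simps sum.distrib)
qed

lemma int_span_scale:
  assumes "x \<in> int_span B"
  shows "of_int k * x \<in> int_span B"
proof -
  obtain f :: "_ \<Rightarrow> int" where "x = (\<Sum>b\<in>B. of_int (f b) * b)"
    using assms by (auto simp: int_span_def)
  then show ?thesis
    by (intro int_spanI[where f = "\<lambda>b. k * f b"]) (simp add: sum_distrib_left mult.assoc)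
qed

lemma int_span_0: "0 \<in> int_span B"
  by (rule int_spanI[where f = "\<lambda>_. 0"]) simp

lemma int_span_sum: "(\<And>i. i \<in> I \<Longrightarrow> f i \<in> int_span B) \<Longrightarrow> sum f I \<in> int_span B"
  by (induction I rule: infinite_finite_induct) (auto intro: int_span_0 int_span_add)

text \<open>The determinant trick: multiplication by x acts on B through an integer matrix, and the
  vector listing B is an eigenvector for x, so x is a root of a monic integer characteristic
  polynomial. The element \<open>b\<^sub>0\<close> keeps this vector nonzero.\<close>

lemma algebraic_int_if_stable:
  fixes x :: "'a :: field_char_0"
  assumes "finite B" "b\<^sub>0 \<in> B" "b\<^sub>0 \<noteq> 0" and stable: "\<And>b. b \<in> B \<Longrightarrow> x * b \<in> int_span B"
  shows "algebraic_int x"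
proof -
  obtain bs where bs: "distinct bs" "set bs = B"
    using \<open>finite B\<close> finite_distinct_list by blast
  define n where "n = length bs"
  have "\<exists>f :: 'a \<Rightarrow> int. x * b = (\<Sum>c\<in>B. of_int (f c) * c)" if "b \<in> B" for b
    using stable[OF that] by (auto simp: int_span_def)
  then obtain F :: "'a \<Rightarrow> 'a \<Rightarrow> int" where F: "\<And>b. b \<in> B \<Longrightarrow> x * b = (\<Sum>c\<in>B. of_int (F b c) * c)"
    by metis
  define A where "A = mat n n (\<lambda>(i, j). F (bs ! i) (bs ! j))"
  define A' :: "'a mat" where "A' = map_mat of_int A"
  define v where "v = vec n (\<lambda>i. bs ! i)"
  have A: "A \<in> carrier_mat n n" and A': "A' \<in> carrier_mat n n"
    by (auto simp: A_def A'_def)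
  have sum_bs: "(\<Sum>c\<in>B. g c) = (\<Sum>j<n. g (bs ! j))" for g :: "'a \<Rightarrow> 'a"
    using sum.reindex_bij_betw[OF bij_betw_nth[OF bs(1) refl refl], of g] by (simp add: bs n_def)
  have "A' *\<^sub>v v = x \<cdot>\<^sub>v v"
  proof (rule eq_vecI)
    fix i assume "i < dim_vec (x \<cdot>\<^sub>v v)"
    then have i: "i < n" by (simp add: v_def)
    then have "bs ! i \<in> B" using bs n_def by auto
    then have "x * bs ! i = (\<Sum>j<n. of_int (F (bs ! i) (bs ! j)) * bs ! j)"
      by (simp add: F sum_bs)
    then show "(A' *\<^sub>v v) $ i = (x \<cdot>\<^sub>v v) $ i"
      using i by (simp add: A'_def A_def v_def scalar_prod_def lessThan_atLeast0)
  qed (simp add: A'_def A_def v_def)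
  moreover have "v \<noteq> 0\<^sub>v n"
  proof
    assume "v = 0\<^sub>v n"
    moreover obtain i where "i < n" "bs ! i = b\<^sub>0"
      using assms(2) bs n_def by (metis in_set_conv_nth)
    ultimately show False
      using \<open>b\<^sub>0 \<noteq> 0\<close> by (metis index_vec index_zero_vec(1) v_def)
  qed
  ultimately have "eigenvalue A' x"
    using A' unfolding eigenvalue_def eigenvector_def by (intro exI[of _ v]) (auto simp: v_def)
  then have "poly (char_poly A') x = 0"
    using eigenvalue_root_char_poly[OF A'] by simp
  moreover have "char_poly A' = of_int_poly (char_poly A)"
    unfolding A'_def by (rule of_int_hom.char_poly_hom[OF A])
  ultimately show ?thesis
    using degree_monic_char_poly[OF A] by (subst algebraic_int_altdef_ipoly) auto
qed

lemma algebraic_int_power_reduce: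
  fixes x :: "'a :: field_char_0"
  assumes "algebraic_int x"
  obtains d and c :: "nat \<Rightarrow> int" where "d > 0" "x ^ d = (\<Sum>i<d. of_int (c i) * x ^ i)"
proof -
  obtain p where p: "poly (of_int_poly p) x = 0" "lead_coeff p = 1"
    using assms algebraic_int_altdef_ipoly by blast
  define d where "d = degree p"
  have "(\<Sum>i\<le>d. of_int (coeff p i) * x ^ i) = 0"
    using p(1) by (simp add: poly_altdef d_def coeff_map_poly)
  then have eq: "(\<Sum>i<d. of_int (coeff p i) * x ^ i) + x ^ d = 0"
    using p(2) by (simp add: d_def lessThan_Suc_atMost[symmetric])
  moreover from eq have "d > 0" by (cases d) auto
  ultimately show ?thesis
    by (intro that[of d "\<lambda>i. - coeff p i"]) (auto simp: sum_negf eq_neg_iff_add_eq_0 add.commute)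
qed

text \<open>The monomials x^i y^j, with i and j below the degrees of monic equations for x and y,
  span a lattice stable under both. It is then stable under x + y and x y too, which makes sums and
  products integral.\<close>

lemma algebraic_int_common_lattice:
  fixes x y :: "'a :: field_char_0"
  assumes "algebraic_int x" "algebraic_int y"
  obtains B where "finite B" "1 \<in> B"
    "\<And>b. b \<in> int_span B \<Longrightarrow> x * b \<in> int_span B" "\<And>b. b \<in> int_span B \<Longrightarrow> y * b \<in> int_span B"
proof -
  obtain d and c :: "nat \<Rightarrow> int" where d: "d > 0" "x ^ d = (\<Sum>i<d. of_int (c i) * x ^ i)"
    using algebraic_int_power_reduce[OF assms(1)] by blast
  obtain e and c' :: "nat \<Rightarrow> int" where e: "e > 0" "y ^ e = (\<Sum>i<e. of_int (c' i) * y ^ i)"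
    using algebraic_int_power_reduce[OF assms(2)] by blast
  define B where "B = (\<lambda>(i, j). x ^ i * y ^ j) ` ({..<d} \<times> {..<e})"
  have fin: "finite B" by (simp add: B_def)
  have base: "x ^ i * y ^ j \<in> int_span B" if "i < d" "j < e" for i j
    using that by (intro int_span_base[OF fin]) (auto simp: B_def)
  have one: "1 \<in> B" unfolding B_def using d e by (intro image_eqI[of _ _ "(0, 0)"]) auto
  have x: "x * b \<in> int_span B" if "b \<in> B" for b
  proof -
    obtain i j where ij: "i < d" "j < e" "b = x ^ i * y ^ j" using \<open>b \<in> B\<close> by (auto simp: B_def)
    show ?thesis
    proof (cases "Suc i = d")
      case True
      have "x * b = x ^ Suc i * y ^ j" by (simp add: ij)
      also have "\<dots> = (\<Sum>i<d. of_int (c i) * (x ^ i * y ^ j))"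
        unfolding True d(2) by (simp add: sum_distrib_right mult.assoc)
      finally show ?thesis using ij base by (auto intro!: int_span_sum int_span_scale)
    next
      case False
      then have "Suc i < d" using ij by simp
      from base[OF this ij(2)] show ?thesis by (simp add: ij(3) mult.assoc)
    qed
  qed
  have y: "y * b \<in> int_span B" if "b \<in> B" for b
  proof -
    obtain i j where ij: "i < d" "j < e" "b = x ^ i * y ^ j" using \<open>b \<in> B\<close> by (auto simp: B_def)
    show ?thesis
    proof (cases "Suc j = e")
      case True
      have "y * b = x ^ i * y ^ Suc j" by (simp add: ij)
      also have "\<dots> = (\<Sum>j<e. of_int (c' j) * (x ^ i * y ^ j))"
        using e(2) True by (simp add: sum_distrib_left mult_ac)
      finally show ?thesis using ij base by (auto intro!: int_span_sum int_span_scale)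
    next
      case False
      then have "Suc j < e" using ij by simp
      from base[OF ij(1) this] show ?thesis by (simp add: ij(3) mult_ac)
    qed
  qed
  have ext: "z * b \<in> int_span B" if "\<And>b. b \<in> B \<Longrightarrow> z * b \<in> int_span B" "b \<in> int_span B" for z b
  proof -
    obtain f :: "'a \<Rightarrow> int" where "b = (\<Sum>c\<in>B. of_int (f c) * c)"
      using \<open>b \<in> int_span B\<close> by (auto simp: int_span_def)
    then have "z * b = (\<Sum>c\<in>B. of_int (f c) * (z * c))"
      by (simp add: sum_distrib_left mult_ac)
    then show ?thesis using that(1) by (auto intro!: int_span_sum int_span_scale)
  qed
  show ?thesis
    by (rule that[OF fin one]) (auto intro: ext x y)
qed

lemma algebraic_int_add [intro]:
  fixes x y :: "'a :: field_char_0"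
  assumes "algebraic_int x" "algebraic_int y"
  shows "algebraic_int (x + y)"
proof -
  obtain B where B: "finite B" "1 \<in> B"
    "\<And>b. b \<in> int_span B \<Longrightarrow> x * b \<in> int_span B" "\<And>b. b \<in> int_span B \<Longrightarrow> y * b \<in> int_span B"
    using algebraic_int_common_lattice[OF assms] by metis
  show ?thesis
    by (rule algebraic_int_if_stable[OF B(1,2)])
       (simp_all add: distrib_right int_span_add B(3,4) int_span_base[OF B(1)])
qed

lemma algebraic_int_mult [intro]:
  fixes x y :: "'a :: field_char_0"
  assumes "algebraic_int x" "algebraic_int y"
  shows "algebraic_int (x * y)"
proof -
  obtain B where B: "finite B" "1 \<in> B"
    "\<And>b. b \<in> int_span B \<Longrightarrow> x * b \<in> int_span B" "\<And>b. b \<in> int_span B \<Longrightarrow> y * b \<in> int_span B"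
    using algebraic_int_common_lattice[OF assms] by metis
  show ?thesis
    by (rule algebraic_int_if_stable[OF B(1,2)])
       (simp_all add: mult.assoc B(3,4) int_span_base[OF B(1)])
qed

lemma algebraic_int_diff [intro]:
  "algebraic_int x \<Longrightarrow> algebraic_int y \<Longrightarrow> algebraic_int (x - y :: 'a :: field_char_0)"
  using algebraic_int_add[of x "-y"] by auto

lemma algebraic_int_power [intro]:
  "algebraic_int x \<Longrightarrow> algebraic_int (x ^ k :: 'a :: field_char_0)"
  by (induction k) auto

lemma algebraic_int_sum [intro]:
  "(\<And>i. i \<in> I \<Longrightarrow> algebraic_int (f i)) \<Longrightarrow> algebraic_int (sum f I :: 'a :: field_char_0)"
  by (induction I rule: infinite_finite_induct) auto

lemma algebraic_int_prod [intro]: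
  "(\<And>i. i \<in> I \<Longrightarrow> algebraic_int (f i)) \<Longrightarrow> algebraic_int (prod f I :: 'a :: field_char_0)"
  by (induction I rule: infinite_finite_induct) auto

section \<open>Prime ideals of the ring of algebraic integers\<close>

text \<open>Ideals are taken in the ring of all algebraic integers of the ambient type and not in
  one number field, so that a single prime serves K', the compositum and all conjugates at
  once.\<close>

definition alg_ideal :: "'a::field_char_0 set \<Rightarrow> bool" where
  "alg_ideal I \<longleftrightarrow> 0 \<in> I \<and> (\<forall>x\<in>I. algebraic_int x) \<and> (\<forall>x\<in>I. \<forall>y\<in>I. x + y \<in> I) \<and>
     (\<forall>x\<in>I. \<forall>a. algebraic_int a \<longrightarrow> a * x \<in> I)"

definition prime_above :: "nat \<Rightarrow> 'a::field_char_0 set \<Rightarrow> bool" where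
  "prime_above p P \<longleftrightarrow> alg_ideal P \<and> of_nat p \<in> P \<and> 1 \<notin> P \<and>
     (\<forall>x y. algebraic_int x \<longrightarrow> algebraic_int y \<longrightarrow> x * y \<in> P \<longrightarrow> x \<in> P \<or> y \<in> P)"

lemma not_algebraic_int_inverse_nat:
  assumes "k > 1"
  shows "\<not> algebraic_int (1 / of_nat k :: 'a :: field_char_0)"
proof
  assume "algebraic_int (1 / of_nat k :: 'a)"
  moreover have "(1 / of_nat k :: 'a) \<in> \<rat>" by simp
  ultimately obtain z :: int where "(1 / of_nat k :: 'a) = of_int z"
    using rational_algebraic_int_is_int by (metis Ints_cases)
  then have "(1 :: 'a) = of_int (z * int k)"
    using assms by (simp add: field_simps)
  then have "z * int k = 1"
    by (metis of_int_eq_1_iff)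
  then have "int k dvd 1" by (metis dvd_triv_right)
  then show False using assms by simp
qed

text \<open>Zorn's lemma for the proper ideals containing p.\<close>

lemma ex_maximal_alg_ideal:
  assumes "prime p"
  obtains M :: "'a::field_char_0 set" where "alg_ideal M" "of_nat p \<in> M" "1 \<notin> M"
    "\<And>I. alg_ideal I \<Longrightarrow> M \<subseteq> I \<Longrightarrow> 1 \<notin> I \<Longrightarrow> I = M"
proof -
  define A :: "'a set set" where "A = {I. alg_ideal I \<and> of_nat p \<in> I \<and> 1 \<notin> I}"
  have p1: "p > 1" using assms prime_gt_1_nat by blast
  have "A \<noteq> {}"
  proof -
    \<comment> \<open>The principal ideal generated by p, which is proper because 1/p is not
      integral.\<close>
    define I :: "'a set" where "I = {x. algebraic_int (x / of_nat p)}"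
    have int: "algebraic_int x" if "x \<in> I" for x
    proof -
      have "algebraic_int (of_nat p * (x / of_nat p))"
        using that by (intro algebraic_int_mult) (auto simp: I_def)
      then show ?thesis using p1 by simp
    qed
    have "alg_ideal I"
      unfolding alg_ideal_def using int by (auto simp: I_def add_divide_distrib simp flip: times_divide_eq_right)
    moreover have "of_nat p \<in> I" using p1 by (simp add: I_def)
    moreover have "1 \<notin> I" using not_algebraic_int_inverse_nat[OF p1] by (simp add: I_def)
    ultimately show ?thesis by (auto simp: A_def)
  qed
  moreover have "\<Union>C \<in> A" if "C \<noteq> {}" "subset.chain A C" for C
  proof -
    have sub: "C \<subseteq> A" and lin: "\<And>X Y. X \<in> C \<Longrightarrow> Y \<in> C \<Longrightarrow> X \<subseteq> Y \<or> Y \<subseteq> X"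
      using that(2) by (auto simp: subset.chain_def)
    have "x + y \<in> \<Union>C" if "x \<in> \<Union>C" "y \<in> \<Union>C" for x y
    proof -
      obtain X Y where "X \<in> C" "x \<in> X" "Y \<in> C" "y \<in> Y" 
        using \<open>x \<in> \<Union>C\<close> \<open>y \<in> \<Union>C\<close> by blast
      then obtain Z where "Z \<in> C" "x \<in> Z" "y \<in> Z" using lin by blast
      then have "Z \<in> A" using sub by blast
      then have "x + y \<in> Z" using \<open>x \<in> Z\<close> \<open>y \<in> Z\<close> by (simp add: A_def alg_ideal_def)
      then show ?thesis using \<open>Z \<in> C\<close> by blast
    qed
    moreover obtain X where "X \<in> C" "X \<in> A" using sub \<open>C \<noteq> {}\<close> by blast
    then have "0 \<in> \<Union>C" "of_nat p \<in> \<Union>C" by (auto simp: A_def alg_ideal_def)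
    moreover have "1 \<notin> \<Union>C" "\<forall>x\<in>\<Union>C. algebraic_int x"
      using sub by (auto simp: A_def alg_ideal_def)
    moreover have "a * x \<in> \<Union>C" if "x \<in> \<Union>C" "algebraic_int a" for a x
    proof -
      obtain X where "X \<in> C" "x \<in> X" using \<open>x \<in> \<Union>C\<close> by blast
      then have "a * x \<in> X" using sub \<open>algebraic_int a\<close> by (auto simp: A_def alg_ideal_def)
      then show ?thesis using \<open>X \<in> C\<close> by blast
    qed
    ultimately show ?thesis unfolding A_def alg_ideal_def mem_Collect_eq by blast
  qed
  ultimately obtain M where "M \<in> A" "\<forall>X\<in>A. M \<subseteq> X \<longrightarrow> X = M"
    using subset_Zorn_nonempty[of A] by blast
  then show ?thesis by (intro that[of M]) (auto simp: A_def)
qed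

lemma ex_prime_above:
  assumes "prime p"
  shows "\<exists>P :: 'a::field_char_0 set. prime_above p P"
proof -
  obtain M :: "'a set" where M: "alg_ideal M" "of_nat p \<in> M" "1 \<notin> M"
    and max: "\<And>I. alg_ideal I \<Longrightarrow> M \<subseteq> I \<Longrightarrow> 1 \<notin> I \<Longrightarrow> I = M"
    using ex_maximal_alg_ideal[OF assms] by blast
  have comaximal: "\<exists>m a. m \<in> M \<and> algebraic_int a \<and> 1 = m + a * x" if x: "algebraic_int x" "x \<notin> M" for x
  proof -
    \<comment> \<open>The ideal M + (x); as x is not in M, maximality forces 1 into it.\<close>
    define I where "I = {m + a * x | m a. m \<in> M \<and> algebraic_int a}"
    have "alg_ideal I"
      unfolding alg_ideal_def
    proof (intro conjI ballI allI impI)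
      show "0 \<in> I" using M by (auto simp: I_def alg_ideal_def intro!: exI[of _ 0])
      show "algebraic_int z" if "z \<in> I" for z
        using that M x by (auto simp: I_def alg_ideal_def)
      show "z + z' \<in> I" if "z \<in> I" "z' \<in> I" for z z'
      proof -
        obtain m a m' a' where *: "z = m + a * x" "z' = m' + a' * x" "m \<in> M" "m' \<in> M"
          "algebraic_int a" "algebraic_int a'" using \<open>z \<in> I\<close> \<open>z' \<in> I\<close> by (auto simp: I_def)
        have "z + z' = (m + m') + (a + a') * x" by (simp add: * algebra_simps)
        moreover have "m + m' \<in> M" "algebraic_int (a + a')" using * M by (auto simp: alg_ideal_def)
        ultimately show ?thesis unfolding I_def by blast
      qed
      show "b * z \<in> I" if "z \<in> I" "algebraic_int b" for z b
      proof -
        obtain m a where *: "z = m + a * x" "m \<in> M" "algebraic_int a"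
          using \<open>z \<in> I\<close> by (auto simp: I_def)
        have "b * z = b * m + (b * a) * x" by (simp add: * algebra_simps)
        moreover have "b * m \<in> M" "algebraic_int (b * a)" using * M that by (auto simp: alg_ideal_def)
        ultimately show ?thesis unfolding I_def by blast
      qed
    qed
    moreover have "M \<subseteq> I" by (force simp: I_def)
    moreover have "x = 0 + 1 * x" "0 \<in> M" using M(1) by (simp_all add: alg_ideal_def)
    then have "x \<in> I" unfolding I_def using algebraic_int_1 by blast
    ultimately have "1 \<in> I" using max x by blast
    then show ?thesis by (auto simp: I_def)
  qed
  have "x \<in> M \<or> y \<in> M" if xy: "algebraic_int x" "algebraic_int y" "x * y \<in> M" for x y
  proof (rule ccontr)
    assume "\<not> (x \<in> M \<or> y \<in> M)"
    then obtain m a m' a' where *: "m \<in> M" "m' \<in> M" "algebraic_int a" "algebraic_int a'"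
      "1 = m + a * x" "1 = m' + a' * y" using comaximal xy by metis
    have "m' = 1 - a' * y" using *(6) by (simp add: algebra_simps)
    then have "1 = m' + a' * y * (m + a * x)" using *(5) by simp
    also have "\<dots> = m' + (a' * y) * m + (a * a') * (x * y)" by (simp add: algebra_simps)
    also have "\<dots> \<in> M"
    proof -
      have "a' * y * m \<in> M" "a * a' * (x * y) \<in> M"
        using * xy M(1) algebraic_int_mult unfolding alg_ideal_def by blast+
      then show ?thesis using *(2) M(1) unfolding alg_ideal_def by blast
    qed
    finally show False using M(3) by simp
  qed
  then show ?thesis using M unfolding prime_above_def by blast
qed

text \<open>One prime per p is chosen once and for all; the other primes of a Galois field above p
  are reached by applying \<open>cj r\<close> before testing membership.\<close>

definition prime_ideal_above :: "nat \<Rightarrow> 'a::field_char_0 set" (\<open>\<PP>\<close>) where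
  "\<PP> p = (SOME P. prime_above p P)"

lemma prime_above_PP: "prime p \<Longrightarrow> prime_above p (\<PP> p)"
  unfolding prime_ideal_above_def by (rule someI_ex[OF ex_prime_above])

context
  fixes p :: nat
  assumes p: "prime p"
begin

lemma PP_0: "0 \<in> \<PP> p"
  and PP_one: "1 \<notin> \<PP> p"
  and PP_p: "of_nat p \<in> \<PP> p"
  using prime_above_PP[OF p] by (auto simp: prime_above_def alg_ideal_def)

lemma PP_add: "x \<in> \<PP> p \<Longrightarrow> y \<in> \<PP> p \<Longrightarrow> x + y \<in> \<PP> p"
  and PP_mult_left: "x \<in> \<PP> p \<Longrightarrow> algebraic_int a \<Longrightarrow> a * x \<in> \<PP> p"
  and PP_mult_right: "x \<in> \<PP> p \<Longrightarrow> algebraic_int a \<Longrightarrow> x * a \<in> \<PP> p"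
  and PP_prime: "algebraic_int x \<Longrightarrow> algebraic_int y \<Longrightarrow> x * y \<in> \<PP> p \<Longrightarrow> x \<in> \<PP> p \<or> y \<in> \<PP> p"
  using prime_above_PP[OF p] by (auto simp: prime_above_def alg_ideal_def mult.commute[of x a])

lemma PP_minus: "x \<in> \<PP> p \<Longrightarrow> - x \<in> \<PP> p"
  using PP_mult_left[of x "-1"] by auto

lemma PP_diff: "x \<in> \<PP> p \<Longrightarrow> y \<in> \<PP> p \<Longrightarrow> x - y \<in> \<PP> p"
  using PP_add[of x "-y"] PP_minus[of y] by simp

lemma PP_diff_commute: "x - y \<in> \<PP> p \<Longrightarrow> y - x \<in> \<PP> p"
  using PP_minus[of "x - y"] by simp

lemma PP_diff_trans: "x - y \<in> \<PP> p \<Longrightarrow> y - z \<in> \<PP> p \<Longrightarrow> x - z \<in> \<PP> p"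
  using PP_add[of "x - y" "y - z"] by simp

lemma PP_diff_mem_iff: "x - y \<in> \<PP> p \<Longrightarrow> x \<in> \<PP> p \<longleftrightarrow> y \<in> \<PP> p"
  using PP_add[of "x - y" y] PP_diff[of x "x - y"] by auto

lemma PP_sum: "(\<And>i. i \<in> I \<Longrightarrow> f i \<in> \<PP> p) \<Longrightarrow> sum f I \<in> \<PP> p"
  by (induction I rule: infinite_finite_induct) (auto intro: PP_0 PP_add)

lemma PP_prod: "(\<And>i. i \<in> I \<Longrightarrow> algebraic_int (f i)) \<Longrightarrow> prod f I \<in> \<PP> p \<Longrightarrow> \<exists>i\<in>I. f i \<in> \<PP> p"
proof (induction I rule: infinite_finite_induct)
  case (insert x I)
  have "f x \<in> \<PP> p \<or> prod f I \<in> \<PP> p"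
    by (rule PP_prime) (use insert in auto)
  then show ?case using insert by auto
qed (use PP_one in auto)

lemma PP_power: "algebraic_int x \<Longrightarrow> x ^ k \<in> \<PP> p \<Longrightarrow> x \<in> \<PP> p"
  by (induction k) (use PP_one PP_prime algebraic_int_power in auto)

lemma PP_if_p_dvd:
  assumes "algebraic_int (x / of_nat p)"
  shows "x \<in> \<PP> p"
proof -
  have "x = of_nat p * (x / of_nat p)" using p prime_gt_0_nat by auto
  then show ?thesis using PP_mult_right[OF PP_p assms] by simp
qed

lemma PP_of_int_iff: "of_int k \<in> (\<PP> p :: 'a::field_char_0 set) \<longleftrightarrow> int p dvd k"
proof
  assume "int p dvd k"
  then obtain j where "k = int p * j" by blast
  then show "of_int k \<in> (\<PP> p :: 'a set)" using PP_mult_right[OF PP_p, of "of_int j"] by simp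
next
  assume k: "of_int k \<in> (\<PP> p :: 'a set)"
  show "int p dvd k"
  proof (rule ccontr)
    assume "\<not> int p dvd k"
    then have "coprime (int p) k" using p by (simp add: prime_imp_coprime)
    then obtain u v where "int p * u + k * v = 1"
      using bezout_int[of "int p" k] by (auto simp: mult.commute coprime_iff_gcd_eq_1)
    then have "1 = of_nat p * of_int u + of_int k * (of_int v :: 'a)"
      by (metis of_int_1 of_int_add of_int_mult of_int_of_nat_eq)
    moreover have "of_nat p * of_int u + of_int k * (of_int v :: 'a) \<in> \<PP> p"
      by (intro PP_add PP_mult_right PP_p k) auto
    ultimately show False using PP_one by metis
  qed
qed

lemma PP_residue_unique:
  assumes "x - of_nat r \<in> (\<PP> p :: 'a::field_char_0 set)" "x - of_nat s \<in> \<PP> p" "r < p" "s < p"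
  shows "r = s"
proof -
  have "of_int (int r - int s) \<in> (\<PP> p :: 'a set)"
    using PP_diff[OF assms(2,1)] by simp
  then have "int p dvd int r - int s" by (simp only: PP_of_int_iff)
  then have "int r mod int p = int s mod int p" by (simp add: mod_eq_dvd_iff)
  then show ?thesis using assms(3,4) by simp
qed

text \<open>Coprimality to \<open>p\<close> may be tested one place at a time: \<open>e\<close> is a local unit at \<open>\<PP> p\<close>.\<close>

lemma prime_power_dvd_if_PP_unit_mult:
  assumes e: "algebraic_int e" "e \<notin> \<PP> p"
    and div: "algebraic_int (e * of_int k / of_nat p ^ a)"
  shows "int p ^ a dvd k"
  using div
proof (induction a arbitrary: k)
  case (Suc a)
  have p0: "(of_nat p :: 'a) \<noteq> 0" using p prime_gt_0_nat by auto
  have "algebraic_int (of_nat p ^ a * (e * of_int k / of_nat p ^ Suc a))"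
    using Suc.prems by (intro algebraic_int_mult algebraic_int_power) auto
  also have "of_nat p ^ a * (e * of_int k / of_nat p ^ Suc a) = e * of_int k / of_nat p"
    using p0 by (simp add: field_simps)
  finally have "e * of_int k \<in> \<PP> p" by (rule PP_if_p_dvd)
  then have "(of_int k :: 'a) \<in> \<PP> p" using PP_prime[OF e(1), of "of_int k"] e(2) by auto
  then obtain j where j: "k = int p * j" by (auto simp: PP_of_int_iff)
  have "algebraic_int (e * of_int j / of_nat p ^ a)"
    using Suc.prems p0 by (simp add: j field_simps)
  then show ?case using Suc.IH[of j] by (simp add: j)
qed auto

end

section \<open>Frobenius congruences\<close>

text \<open>The inner binomial coefficients are divisible by p. Congruence modulo p is written as
  integrality of a quotient by p, which avoids quotient rings and is stronger than congruence modulo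
  \<open>\<PP> p\<close>.\<close>

lemma algebraic_int_freshmans_dream:
  fixes x y :: "'a::field_char_0"
  assumes p: "prime p" and x: "algebraic_int x" and y: "algebraic_int y"
  shows "algebraic_int (((x + y) ^ p - (x ^ p + y ^ p)) / of_nat p)"
proof -
  have p1: "p \<ge> 1" using p prime_ge_1_nat by blast
  have "(x + y) ^ p = (\<Sum>k\<le>p. of_nat (p choose k) * x ^ k * y ^ (p - k))"
    by (rule binomial_ring)
  also have "{..p} = insert 0 (insert p {1..<p})" using p1 by auto
  also have "(\<Sum>k\<in>\<dots>. of_nat (p choose k) * x ^ k * y ^ (p - k)) =
      x ^ p + y ^ p + (\<Sum>k=1..<p. of_nat (p choose k) * x ^ k * y ^ (p - k))"
    using p1 by (simp add: add_ac)
  finally have "((x + y) ^ p - (x ^ p + y ^ p)) / of_nat p =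
      (\<Sum>k=1..<p. of_nat (p choose k) * x ^ k * y ^ (p - k)) / of_nat p"
    by simp
  also have "\<dots> = (\<Sum>k=1..<p. of_nat ((p choose k) div p) * x ^ k * y ^ (p - k))"
    unfolding sum_divide_distrib
  proof (intro sum.cong refl)
    fix k assume "k \<in> {1..<p}"
    then have "p dvd (p choose k)" using p by (intro dvd_choose_prime) auto
    then have "(of_nat (p choose k) :: 'a) = of_nat p * of_nat ((p choose k) div p)"
      by (metis dvd_mult_div_cancel of_nat_mult)
    then show "of_nat (p choose k) * x ^ k * y ^ (p - k) / of_nat p =
        of_nat ((p choose k) div p) * x ^ k * y ^ (p - k)"
      using p1 by simp
  qed
  finally show ?thesis using x y by auto
qed

text \<open>Induction up and down from 0, with the freshman's dream for a sum with 1 as the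
  step.\<close>

lemma algebraic_int_fermat:
  assumes p: "prime p"
  shows "algebraic_int ((of_int a ^ p - of_int a) / of_nat p :: 'a::field_char_0)"
proof -
  have p0: "p > 0" using p prime_gt_0_nat by blast
  show ?thesis
  proof (induction a rule: int_induct[where k = 0])
    case base
    then show ?case using p0 by (simp add: zero_power)
  next
    case (step1 i)
    have "(of_int (i + 1) ^ p - of_int (i + 1)) / of_nat p =
      ((of_int i + 1) ^ p - (of_int i ^ p + 1 ^ p)) / of_nat p + (of_int i ^ p - of_int i :: 'a) / of_nat p"
      by (simp add: add_divide_distrib diff_divide_distrib)
    then show ?case using algebraic_int_freshmans_dream[OF p, of "of_int i :: 'a" 1] step1 by auto
  next
    case (step2 i)
    have "(of_int (i - 1) ^ p - of_int (i - 1)) / of_nat p = (of_int i ^ p - of_int i :: 'a) / of_nat p -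
      ((of_int (i - 1) + 1) ^ p - (of_int (i - 1) ^ p + 1 ^ p)) / of_nat p"
      by (simp add: add_divide_distrib diff_divide_distrib)
    then show ?case using algebraic_int_freshmans_dream[OF p, of "of_int (i - 1) :: 'a" 1] step2 by auto
  qed
qed

lemma algebraic_int_poly:
  "(\<And>i. algebraic_int (coeff q i)) \<Longrightarrow> algebraic_int x \<Longrightarrow> algebraic_int (poly q x :: 'a::field_char_0)"
  unfolding poly_altdef by auto

lemma algebraic_int_poly_of_int:
  "algebraic_int x \<Longrightarrow> algebraic_int (poly (of_int_poly q) x :: 'a::field_char_0)"
  by (rule algebraic_int_poly) (auto simp: coeff_map_poly)

text \<open>Modulo p the p-th power map is additive and fixes the integer coefficients.\<close>

lemma algebraic_int_poly_frobenius:
  fixes x :: "'a::field_char_0" and q :: "int poly"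
  assumes p: "prime p" and x: "algebraic_int x"
  shows "algebraic_int ((poly (of_int_poly q) x ^ p - poly (of_int_poly q) (x ^ p)) / of_nat p)"
proof (induction q)
  case 0
  then show ?case using p prime_gt_0_nat by (auto simp: power_0_left)
next
  case (pCons a q)
  let ?Q = "poly (of_int_poly q) x" and ?R = "poly (of_int_poly q) (x ^ p)"
  have "(of_int a + x * ?Q) ^ p - (of_int a + x ^ p * ?R) =
    ((of_int a + x * ?Q) ^ p - (of_int a ^ p + (x * ?Q) ^ p)) + (of_int a ^ p - of_int a) + x ^ p * (?Q ^ p - ?R)"
    by (simp add: algebra_simps power_mult_distrib)
  then have "((of_int a + x * ?Q) ^ p - (of_int a + x ^ p * ?R)) / of_nat p =
    ((of_int a + x * ?Q) ^ p - (of_int a ^ p + (x * ?Q) ^ p)) / of_nat p +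
    (of_int a ^ p - of_int a) / of_nat p + x ^ p * ((?Q ^ p - ?R) / of_nat p)"
    unfolding times_divide_eq_right add_divide_distrib[symmetric] by (rule arg_cong)
  moreover have "poly (of_int_poly (pCons a q)) z = of_int a + z * poly (of_int_poly q) z" for z :: 'a
    by (simp add: Polynomial.map_poly_pCons)
  ultimately show ?case
    using x pCons.IH
    by (simp only:) (intro algebraic_int_add algebraic_int_mult algebraic_int_power
        algebraic_int_freshmans_dream[OF p] algebraic_int_fermat[OF p] algebraic_int_poly_of_int
        algebraic_int_of_int)
qed

lemma algebraic_int_coeff_synthetic_div:
  fixes c :: "'a::field_char_0"
  assumes "algebraic_int c"
  shows "(\<forall>i. algebraic_int (coeff q i)) \<Longrightarrow> algebraic_int (coeff (synthetic_div q c) i)"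
proof (induction q arbitrary: i)
  case (pCons a q)
  have q: "algebraic_int (coeff q j)" for j
    using pCons.prems[rule_format, of "Suc j"] by simp
  have "algebraic_int (poly q c)"
    by (rule algebraic_int_poly) (use q assms in auto)
  then show ?case
    using pCons.IH q by (auto simp: coeff_pCons split: nat.splits)
qed auto

text \<open>A polynomial over an integral domain with more roots than its degree is zero. The domain
  is the ring of integers modulo \<open>\<PP> p\<close>, handled through lifts: synthetic division
  splits off one root a, and at the other roots b primality removes the factor b - a.\<close>

lemma PP_coeffs_if_many_roots:
  fixes q :: "'a::field_char_0 poly"
  assumes p: "prime p"
  shows "\<lbrakk>\<And>i. algebraic_int (coeff q i); degree q < card A; \<And>a. a \<in> A \<Longrightarrow> algebraic_int a;
     \<And>a b. a \<in> A \<Longrightarrow> b \<in> A \<Longrightarrow> a - b \<in> \<PP> p \<Longrightarrow> a = b;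
     \<And>a. a \<in> A \<Longrightarrow> poly q a \<in> \<PP> p\<rbrakk> \<Longrightarrow> coeff q i \<in> \<PP> p"
proof (induction "card A" arbitrary: q A i)
  case (Suc d)
  then obtain a where a: "a \<in> A" by (metis card.empty ex_in_conv nat.distinct(1))
  have fin: "finite A" using Suc.hyps(2) by (metis card.infinite nat.distinct(1))
  define s where "s = synthetic_div q a"
  have eq: "q = [:- a, 1:] * s + [:poly q a:]"
    by (simp only: s_def synthetic_div_correct')
  have sa: "algebraic_int (coeff s j)" for j
    unfolding s_def using algebraic_int_coeff_synthetic_div[of a q j] Suc.prems a by blast
  have "coeff s j \<in> \<PP> p" for j
  proof (cases "degree q = 0")
    case True
    then have "s = 0" by (simp add: s_def synthetic_div_eq_0_iff)
    then show ?thesis by (simp add: PP_0[OF p])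
  next
    case False
    have "d = card (A - {a})" using Suc.hyps(2) a fin by simp
    moreover have "degree s < card (A - {a})"
      using Suc.hyps(2) Suc.prems(2) a fin False by (simp add: s_def degree_synthetic_div)
    moreover have "poly s b \<in> \<PP> p" if "b \<in> A - {a}" for b
    proof -
      have "poly q b = (b - a) * poly s b + poly q a"
        by (subst eq) (simp add: algebra_simps)
      then have "(b - a) * poly s b \<in> \<PP> p"
        using PP_diff[OF p Suc.prems(5)[of b] Suc.prems(5)[of a]] that a by simp
      moreover have "algebraic_int (poly s b)"
        using that by (intro algebraic_int_poly sa Suc.prems(3)) auto
      ultimately have "b - a \<in> \<PP> p \<or> poly s b \<in> \<PP> p"
        using that a Suc.prems(3) by (intro PP_prime[OF p]) auto
      then show ?thesis using Suc.prems(4)[of b a] that a by auto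
    qed
    ultimately show ?thesis
      using Suc.hyps(1)[of "A - {a}" s j] sa Suc.prems(3,4) by blast
  qed
  then show ?case
    using Suc.prems(5)[OF a] Suc.prems(3)[OF a]
    by (subst eq) (auto simp: coeff_pCons split: nat.splits
        intro!: PP_add[OF p] PP_diff[OF p] PP_minus[OF p] PP_mult_left[OF p] PP_0[OF p])
qed auto

text \<open>Otherwise $X^p - X$ would have $p + 1$ roots in the residue domain.\<close>

lemma PP_residue_if_frobenius_fixed:
  fixes x :: "'a::field_char_0"
  assumes p: "prime p" and x: "algebraic_int x" and fixed: "x ^ p - x \<in> \<PP> p"
  obtains r where "r < p" "x - of_nat r \<in> \<PP> p"
proof -
  have "\<exists>r<p. x - of_nat r \<in> \<PP> p"
  proof (rule ccontr)
    assume no: "\<not> ?thesis"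
    have p1: "p > 1" using p prime_gt_1_nat by blast
    have one: "(1 :: 'a) \<notin> \<PP> p" by (rule PP_one[OF p])
    define A :: "'a set" where "A = insert x (of_nat ` {..<p})"
    define q :: "'a poly" where "q = monom 1 p - monom 1 1"
    have xA: "x \<notin> of_nat ` {..<p}" using no PP_0[OF p] by fastforce
    have "coeff q p \<in> \<PP> p"
    proof (rule PP_coeffs_if_many_roots[OF p, where A = A])
      have "degree q \<le> p" using p1 unfolding q_def by (intro degree_diff_le) (auto simp: degree_monom_eq)
      moreover have "card A = Suc p" using xA by (simp add: A_def card_image)
      ultimately show "degree q < card A" by simp
      show "algebraic_int a" if "a \<in> A" for a using that x by (auto simp: A_def)
      show "a = b" if "a \<in> A" "b \<in> A" "a - b \<in> \<PP> p" for a b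
      proof -
        have no': "x - of_nat r \<notin> \<PP> p" "of_nat r - x \<notin> \<PP> p" if "r < p" for r
          using no that PP_diff_commute[OF p, of "of_nat r" x] by auto
        consider "a = x" "b = x" | r where "a = x" "r < p" "b = of_nat r" | r where "b = x" "r < p" "a = of_nat r"
          | r s where "a = of_nat r" "b = of_nat s" "r < p" "s < p"
          using \<open>a \<in> A\<close> \<open>b \<in> A\<close> unfolding A_def by blast
        then show ?thesis
        proof cases
          case (4 r s)
          then have "r = s"
            using that(3) by (intro PP_residue_unique[OF p, of "of_nat r :: 'a" r s]) (auto simp: PP_0[OF p])
          then show ?thesis using 4 by simp
        qed (use no' that(3) in auto)
      qed
      show "poly q a \<in> \<PP> p" if "a \<in> A" for a
      proof -
        have "(of_nat r) ^ p - of_nat r \<in> (\<PP> p :: 'a set)" for r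
          using algebraic_int_fermat[OF p, of "int r"] by (intro PP_if_p_dvd[OF p]) auto
        then show ?thesis using that fixed by (auto simp: A_def q_def poly_monom)
      qed
    qed (auto simp: q_def)
    then show False using p1 one by (simp add: q_def)
  qed
  then show ?thesis using that by blast
qed

section \<open>Minimal polynomials and simple extensions\<close>

definition rpoly :: "rat poly \<Rightarrow> 'a::field_char_0 \<Rightarrow> 'a" where
  "rpoly b x = poly (of_rat_poly b) x"

lemma rpoly_0 [simp]: "rpoly 0 x = 0"
  by (simp add: rpoly_def)

lemma rpoly_pCons [simp]: "rpoly (pCons a b) x = of_rat a + x * rpoly b x"
  by (simp add: rpoly_def Polynomial.map_poly_pCons)

lemma rpoly_1 [simp]: "rpoly 1 x = 1"
  by (simp add: one_pCons)

lemma rpoly_add [simp]: "rpoly (a + b) x = rpoly a x + rpoly b x"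
proof -
  have "of_rat_poly (a + b) = (of_rat_poly a + of_rat_poly b :: 'a poly)"
    by (rule poly_eqI) (simp add: coeff_map_poly of_rat_add)
  then show ?thesis by (simp add: rpoly_def)
qed

lemma rpoly_smult [simp]: "rpoly (Polynomial.smult c b) x = of_rat c * rpoly b x"
proof -
  have "of_rat_poly (Polynomial.smult c b) = (Polynomial.smult (of_rat c) (of_rat_poly b) :: 'a poly)"
    by (rule poly_eqI) (simp add: coeff_map_poly of_rat_mult)
  then show ?thesis by (simp add: rpoly_def)
qed

lemma rpoly_minus [simp]: "rpoly (- b) x = - rpoly b x"
  using rpoly_smult[of "-1" b x] by simp

lemma rpoly_diff [simp]: "rpoly (a - b) x = rpoly a x - rpoly b x"
  using rpoly_add[of a "- b" x] by simp

lemma rpoly_mult [simp]: "rpoly (a * b) x = rpoly a x * rpoly b x"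
  by (induction a) (auto simp: algebra_simps)

lemma rpoly_power [simp]: "rpoly (a ^ k) x = rpoly a x ^ k"
  by (induction k) auto

lemma rpoly_sum [simp]: "rpoly (sum f I) x = (\<Sum>i\<in>I. rpoly (f i) x)"
  by (induction I rule: infinite_finite_induct) auto

lemma rpoly_monom [simp]: "rpoly (monom c i) x = of_rat c * x ^ i"
  by (induction i) (auto simp: monom_0 monom_Suc)

lemma rpoly_pcompose [simp]: "rpoly (pcompose a b) x = rpoly a (rpoly b x)"
  by (induction a) (auto simp: pcompose_pCons)

lemma rpoly_altdef: "rpoly b x = (\<Sum>i\<le>degree b. of_rat (coeff b i) * x ^ i)"
  by (simp add: rpoly_def poly_altdef coeff_map_poly)

lemma rpoly_altdef': "degree b < n \<Longrightarrow> rpoly b x = (\<Sum>i<n. of_rat (coeff b i) * x ^ i)"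
  unfolding rpoly_altdef by (rule sum.mono_neutral_left) (auto simp: coeff_eq_0)

text \<open>This is the ring Q[x]; for algebraic x it is the field Q(x), by
  \<open>simple_ext_inverse\<close>.\<close>

definition simple_ext :: "'a::field_char_0 \<Rightarrow> 'a set" where
  "simple_ext x = range (\<lambda>b. rpoly b x)"

lemma simple_extI: "y = rpoly b x \<Longrightarrow> y \<in> simple_ext x"
  by (auto simp: simple_ext_def)

lemma simple_extE:
  assumes "y \<in> simple_ext x"
  obtains b where "y = rpoly b x"
  using assms by (auto simp: simple_ext_def)

lemma simple_ext_of_rat [simp]: "of_rat q \<in> simple_ext x"
  by (rule simple_extI[of _ "[:q:]"]) simp

lemma simple_ext_0 [simp]: "0 \<in> simple_ext x"
  and simple_ext_1 [simp]: "1 \<in> simple_ext x"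
  and simple_ext_of_int [simp]: "of_int k \<in> simple_ext x"
  and simple_ext_of_nat [simp]: "of_nat j \<in> simple_ext x"
  using simple_ext_of_rat[of 0 x] simple_ext_of_rat[of 1 x] simple_ext_of_rat[of "of_int k" x]
    simple_ext_of_rat[of "of_nat j" x] by (simp_all del: simple_ext_of_rat)

lemma simple_ext_self [simp]: "x \<in> simple_ext x"
  by (rule simple_extI[of _ "[:0, 1:]"]) simp

lemma simple_ext_add: "y \<in> simple_ext x \<Longrightarrow> z \<in> simple_ext x \<Longrightarrow> y + z \<in> simple_ext x"
  by (metis rpoly_add simple_extE simple_extI)

lemma simple_ext_mult: "y \<in> simple_ext x \<Longrightarrow> z \<in> simple_ext x \<Longrightarrow> y * z \<in> simple_ext x"
  by (metis rpoly_mult simple_extE simple_extI)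

lemma simple_ext_minus: "y \<in> simple_ext x \<Longrightarrow> - y \<in> simple_ext x"
  by (metis rpoly_minus simple_extE simple_extI)

lemma simple_ext_diff: "y \<in> simple_ext x \<Longrightarrow> z \<in> simple_ext x \<Longrightarrow> y - z \<in> simple_ext x"
  by (metis rpoly_diff simple_extE simple_extI)

lemma simple_ext_power: "y \<in> simple_ext x \<Longrightarrow> y ^ k \<in> simple_ext x"
  by (metis rpoly_power simple_extE simple_extI)

lemma simple_ext_sum: "(\<And>i. i \<in> I \<Longrightarrow> f i \<in> simple_ext x) \<Longrightarrow> sum f I \<in> simple_ext x"
  by (induction I rule: infinite_finite_induct) (auto intro: simple_ext_add)

lemma simple_ext_prod: "(\<And>i. i \<in> I \<Longrightarrow> f i \<in> simple_ext x) \<Longrightarrow> prod f I \<in> simple_ext x"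
  by (induction I rule: infinite_finite_induct) (auto intro: simple_ext_mult)

lemma simple_ext_mono: "y \<in> simple_ext x \<Longrightarrow> simple_ext y \<subseteq> simple_ext x"
  by (auto elim!: simple_extE intro: simple_extI[of _ "pcompose _ _"])

definition is_minpoly :: "rat poly \<Rightarrow> 'a::field_char_0 \<Rightarrow> bool" where
  "is_minpoly g x \<longleftrightarrow> irreducible g \<and> lead_coeff g = 1 \<and> rpoly g x = 0"

text \<open>Otherwise a Bezout identity u g + v b = 1, evaluated at x, would read 0 = 1.\<close>

lemma irreducible_dvd_if_common_root:
  assumes "irreducible g" "rpoly g x = 0" "rpoly b x = 0"
  shows "g dvd b"
proof (rule ccontr)
  assume "\<not> g dvd b"
  then have cop: "coprime g b"
    by (intro prime_elem_imp_coprime irreducible_imp_prime_elem_gcd assms(1))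
  obtain u v where uv: "bezout_coefficients g b = (u, v)" by fastforce
  then have "u * g + v * b = gcd g b" by (rule bezout_coefficients)
  then have "u * g + v * b = 1" using cop by simp
  then have "rpoly (u * g + v * b) x = 1" by simp
  then show False using assms by simp
qed

text \<open>Since g divides b, b vanishes wherever g does. All conjugations and embeddings below are
  well defined for this reason.\<close>

lemma root_transfer:
  assumes "irreducible g" "rpoly g x = 0" "rpoly g y = 0" "rpoly b x = 0"
  shows "rpoly b y = 0"
  using irreducible_dvd_if_common_root[OF assms(1,2,4)] assms(3) by (auto elim!: dvdE)

lemma rpoly_eq_transfer:
  assumes "irreducible g" "rpoly g x = 0" "rpoly g y = 0" "rpoly b x = rpoly c x"
  shows "rpoly b y = rpoly c y"
  using root_transfer[OF assms(1-3), of "b - c"] assms(4) by simp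

lemma rpoly_eq_0_degree_less:
  assumes "irreducible g" "rpoly g x = 0" "rpoly b x = 0" "degree b < degree g"
  shows "b = 0"
  using irreducible_dvd_if_common_root[OF assms(1-3)] assms(4) dvd_imp_degree_le leD by blast

lemma irreducible_rat_degree_pos:
  assumes "irreducible (g :: rat poly)"
  shows "degree g > 0"
  using assms by (metis bot_nat_0.not_eq_extremum irreducible_def is_unit_iff_degree)

text \<open>Take an annihilating polynomial of least degree and make it monic: of two factors, the
  one vanishing at x already has full degree, so the other is constant.\<close>

lemma ex_minpoly:
  assumes "algebraic x"
  obtains g where "is_minpoly g x"
proof -
  define Q where "Q = (\<lambda>b :: rat poly. b \<noteq> 0 \<and> rpoly b x = 0)"
  obtain p where p: "p \<noteq> 0" "poly (of_int_poly p) x = 0"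
    using assms by (auto elim: algebraicE')
  have "rpoly (of_int_poly p) x = poly (of_int_poly p) x"
    by (simp add: rpoly_def map_poly_map_poly o_def)
  moreover have "(of_int_poly p :: rat poly) \<noteq> 0" using p(1) by simp
  ultimately have "Q (of_int_poly p)" using p by (simp add: Q_def)
  then obtain b where b: "Q b" "\<And>c. Q c \<Longrightarrow> degree b \<le> degree c"
    using exists_least_iff[of "\<lambda>d. \<exists>b. Q b \<and> degree b = d"] by (metis not_le)
  define g where "g = Polynomial.smult (inverse (lead_coeff b)) b"
  have g: "Q g" "lead_coeff g = 1" "degree g = degree b"
    using b(1) by (auto simp: g_def Q_def)
  have "irreducible g"
  proof (rule irreducibleI)
    show "g \<noteq> 0" using g by (auto simp: Q_def)
    show "\<not> g dvd 1"
    proof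
      assume "g dvd 1"
      then have "degree g = 0" using \<open>g \<noteq> 0\<close> by (simp add: is_unit_iff_degree)
      then obtain c where "g = [:c:]" by (auto elim: degree_eq_zeroE)
      then show False using g by (auto simp: Q_def)
    qed
    fix u v assume uv: "g = u * v"
    then have nz: "u \<noteq> 0" "v \<noteq> 0" using \<open>g \<noteq> 0\<close> by auto
    have deg: "degree g = degree u + degree v" unfolding uv by (rule degree_mult_eq[OF nz])
    have "rpoly u x = 0 \<or> rpoly v x = 0" using g(1) uv by (auto simp: Q_def)
    then have "degree v = 0 \<or> degree u = 0"
      using b(2)[of u] b(2)[of v] nz deg g(3) by (auto simp: Q_def)
    then show "u dvd 1 \<or> v dvd 1" using nz by (auto simp: is_unit_iff_degree)
  qed
  then show ?thesis using g by (intro that[of g]) (auto simp: is_minpoly_def Q_def)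
qed

text \<open>Bezout for the minimal polynomial and a polynomial representing y.\<close>

lemma simple_ext_inverse:
  assumes "algebraic x" "y \<in> simple_ext x"
  shows "inverse y \<in> simple_ext x"
proof (cases "y = 0")
  case False
  obtain g where g: "is_minpoly g x" using ex_minpoly[OF assms(1)] by blast
  obtain b where b: "y = rpoly b x" using assms(2) by (rule simple_extE)
  have "\<not> g dvd b" using False b g by (auto simp: is_minpoly_def elim!: dvdE)
  then have cop: "coprime g b"
    using g by (intro prime_elem_imp_coprime irreducible_imp_prime_elem_gcd) (auto simp: is_minpoly_def)
  obtain u v where uv: "bezout_coefficients g b = (u, v)" by fastforce
  then have "u * g + v * b = gcd g b" by (rule bezout_coefficients)
  then have "u * g + v * b = 1" using cop by simp
  then have "rpoly (u * g + v * b) x = 1" by simp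
  then have "rpoly v x * y = 1" using b g by (simp add: is_minpoly_def)
  then have "inverse y = rpoly v x" by (metis inverse_unique mult.commute)
  then show ?thesis by (rule simple_extI)
qed simp

lemma simple_ext_divide:
  "algebraic x \<Longrightarrow> y \<in> simple_ext x \<Longrightarrow> z \<in> simple_ext x \<Longrightarrow> y / z \<in> simple_ext x"
  unfolding divide_inverse by (intro simple_ext_mult simple_ext_inverse)

text \<open>A double root is also a root of the derivative, which in characteristic 0 is nonzero and
  has degree below that of g.\<close>

lemma minpoly_separable:
  assumes "irreducible (g :: rat poly)" "rpoly g x = 0"
  shows "\<not> [:- x, 1:]^2 dvd of_rat_poly g"
proof
  assume "[:- x, 1:]^2 dvd of_rat_poly g"
  then obtain q where q: "of_rat_poly g = [:- x, 1:]^2 * q"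
    by (rule dvdE)
  have "poly (pderiv (of_rat_poly g)) x = 0"
    unfolding q power2_eq_square pderiv_mult by simp
  moreover have "pderiv (of_rat_poly g) = (of_rat_poly (pderiv g) :: 'a poly)"
    by (rule poly_eqI) (simp add: coeff_map_poly coeff_pderiv of_rat_mult of_rat_add)
  ultimately have "rpoly (pderiv g) x = 0" by (simp add: rpoly_def)
  moreover have "degree (pderiv g) < degree g"
    using irreducible_rat_degree_pos[OF assms(1)] by (simp add: degree_pderiv)
  ultimately have "pderiv g = 0" using rpoly_eq_0_degree_less assms by blast
  then show False using irreducible_rat_degree_pos[OF assms(1)] by (simp add: pderiv_eq_0_iff)
qed

definition roots :: "rat poly \<Rightarrow> 'a::field_char_0 set" where
  "roots g = {r. rpoly g r = 0}"

lemma finite_roots: "irreducible g \<Longrightarrow> finite (roots g)"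
  unfolding roots_def rpoly_def by (rule poly_roots_finite) auto

lemma minpoly_factorization:
  fixes x :: "'a::{field_char_0, alg_closed_field}"
  assumes "is_minpoly g x"
  shows "of_rat_poly g = (\<Prod>r\<in>roots g. [:- r, 1:] :: 'a poly)" "card (roots g :: 'a set) = degree g"
proof -
  let ?g = "of_rat_poly g :: 'a poly"
  have g: "irreducible g" "lead_coeff g = 1" using assms by (auto simp: is_minpoly_def)
  have deg: "degree ?g = degree g" by simp
  have lc: "lead_coeff ?g = 1" using g by (simp add: coeff_map_poly)
  then have "?g \<noteq> 0" by auto
  then obtain A where A: "size A = degree ?g" "?g = (\<Prod>x\<in>#A. [:- x, 1:])"
    using alg_closed_imp_factorization[of ?g] unfolding lc Polynomial.smult_1_left by blast
  have "count A r = (if r \<in> roots g then 1 else 0)" for r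
  proof -
    have "r \<in># A \<longleftrightarrow> r \<in> roots g"
      unfolding roots_def rpoly_def A(2) by (auto simp: poly_prod_mset prod_mset_zero_iff)
    moreover have "count A r \<le> 1"
    proof (rule ccontr)
      assume "\<not> count A r \<le> 1"
      then have "{#r, r#} \<subseteq># A" by (auto simp: subseteq_mset_def)
      then obtain B where "A = {#r, r#} + B" by (metis subset_mset.add_diff_inverse)
      then have "?g = [:- r, 1:]^2 * (\<Prod>x\<in>#B. [:- x, 1:])"
        by (simp only: A(2) power2_eq_square image_mset_union prod_mset.union image_mset_add_mset
            prod_mset.add_mset image_mset_empty prod_mset.empty mult_1_right)
      then have "[:- r, 1:]^2 dvd ?g" by (rule dvdI)
      moreover have "r \<in> roots g"
        using \<open>r \<in># A \<longleftrightarrow> r \<in> roots g\<close> \<open>A = {#r, r#} + B\<close> by auto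
      ultimately show False using minpoly_separable[OF g(1)] by (auto simp: roots_def)
    qed
    ultimately show ?thesis by (metis count_greater_eq_one_iff le_antisym not_in_iff)
  qed
  then have "A = mset_set (roots g)"
    by (intro multiset_eqI) (simp add: finite_roots[OF g(1)] count_mset_set')
  then show "?g = (\<Prod>r\<in>roots g. [:- r, 1:])" "card (roots g :: 'a set) = degree g"
    using A deg by (simp_all add: prod_unfold_prod_mset)
qed

lemma algebraic_int_multiple:
  fixes x :: "'a::field_char_0"
  assumes "algebraic x"
  obtains n :: nat where "n > 0" "algebraic_int (of_nat n * x)"
proof -
  obtain p where p: "p \<noteq> 0" "poly (of_int_poly p) x = 0"
    using assms by (auto elim: algebraicE')
  define d where "d = degree p"
  define a where "a = lead_coeff p"
  have "a \<noteq> 0" using p by (simp add: a_def)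
  have root: "(\<Sum>i\<le>d. of_int (coeff p i) * x ^ i) = 0"
    using p(2) by (simp add: poly_altdef d_def coeff_map_poly)
  have "d > 0"
  proof (rule ccontr)
    assume "\<not> d > 0"
    then have "of_int a = (0 :: 'a)" using root by (simp add: a_def d_def)
    then show False using \<open>a \<noteq> 0\<close> by simp
  qed
  \<comment> \<open>This is a^(d-1) p(X/a), which is monic with integer coefficients and has the
    root a x.\<close>
  define q where "q = (\<Sum>i<d. monom (coeff p i * a ^ (d - 1 - i)) i) + monom 1 d"
  have "degree (\<Sum>i<d. monom (coeff p i * a ^ (d - 1 - i)) i) < d"
    using \<open>d > 0\<close> by (intro degree_sum_less) (auto intro: le_less_trans[OF degree_monom_le])
  then have q: "degree q = d" "lead_coeff q = 1"
    by (simp_all add: q_def degree_add_eq_right degree_monom_eq coeff_eq_0)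
  have "poly (of_int_poly q) (of_int a * x) =
      (\<Sum>i<d. of_int (coeff p i * a ^ (d - 1 - i)) * (of_int a * x) ^ i) + (of_int a * x) ^ d"
    by (simp add: q_def of_int_poly_hom.hom_add of_int_poly_hom.hom_sum poly_sum poly_monom)
  also have "(\<Sum>i<d. of_int (coeff p i * a ^ (d - 1 - i)) * (of_int a * x) ^ i) =
      (\<Sum>i<d. of_int a ^ (d - 1) * (of_int (coeff p i) * x ^ i))"
  proof (intro sum.cong refl)
    fix i assume "i \<in> {..<d}"
    then have "d - 1 = (d - 1 - i) + i" by simp
    then have "(of_int a :: 'a) ^ (d - 1) = of_int a ^ (d - 1 - i) * of_int a ^ i"
      by (metis power_add)
    then show "of_int (coeff p i * a ^ (d - 1 - i)) * (of_int a * x) ^ i =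
        of_int a ^ (d - 1) * (of_int (coeff p i) * x ^ i)"
      by (simp add: power_mult_distrib mult_ac)
  qed
  also have "\<dots> + (of_int a * x) ^ d = of_int a ^ (d - 1) * (\<Sum>i\<le>d. of_int (coeff p i) * x ^ i)"
  proof -
    have "(of_int a :: 'a) ^ d = of_int a ^ (d - 1) * of_int a"
      using \<open>d > 0\<close> by (metis power_minus_mult)
    then show ?thesis
      by (simp add: lessThan_Suc_atMost[symmetric] sum_distrib_left distrib_left power_mult_distrib
          a_def d_def mult_ac)
  qed
  finally have "poly (of_int_poly q) (of_int a * x) = 0" using root by simp
  then have int: "algebraic_int (of_int a * x)"
    using q by (subst algebraic_int_altdef_ipoly) blast
  have "algebraic_int (of_int \<bar>a\<bar> * x)"
  proof (cases "a \<ge> 0")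
    case False
    then have "of_int \<bar>a\<bar> * x = - (of_int a * x)" by simp
    then show ?thesis using int by (metis algebraic_int_minus)
  qed (use int in simp)
  then show ?thesis
    using \<open>a \<noteq> 0\<close> by (intro that[of "nat \<bar>a\<bar>"]) auto
qed

section \<open>Primitive elements\<close>

text \<open>The classical primitive element argument: for all but finitely many c, the polynomials h
  and f(\<theta> - c X) have only the root b in common, so their gcd over Q(\<theta>) is linear and
  exhibits b in Q(\<theta>). As Q(\<theta>) is a set and not a type, the gcd is found as an element
  q of least degree in the ideal I of polynomials over Q(\<theta>) vanishing at b.\<close>

lemma exists_primitive_sum:
  fixes a b :: "'a::{field_char_0, alg_closed_field}"
  assumes "algebraic_int a" "algebraic_int b"
  obtains c :: nat where "a \<in> simple_ext (a + of_nat c * b)" "b \<in> simple_ext (a + of_nat c * b)"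
proof -
  obtain f where f: "is_minpoly f a" using ex_minpoly assms by blast
  obtain h where h: "is_minpoly h b" using ex_minpoly assms by blast
  have fin: "finite (roots f :: 'a set)" "finite (roots h :: 'a set)"
    using f h by (auto intro: finite_roots simp: is_minpoly_def)
  \<comment> \<open>The values c with a + c b = a' + c b' for some b' different from b; pairs with
    b' = b contribute only 0.\<close>
  define Z where "Z = (\<lambda>(a', b'). (a' - a) / (b - b')) ` (roots f \<times> roots h)"
  have "infinite (range (of_nat :: nat \<Rightarrow> 'a))"
    by (simp add: finite_image_iff)
  moreover have "finite Z" using fin by (simp add: Z_def)
  ultimately have "\<not> range (of_nat :: nat \<Rightarrow> 'a) \<subseteq> Z"
    using finite_subset by blast
  then obtain c :: nat where c: "(of_nat c :: 'a) \<notin> Z"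
    by blast
  define \<theta> where "\<theta> = a + of_nat c * b"
  have alg\<theta>: "algebraic \<theta>" using assms unfolding \<theta>_def by (intro algebraic_int_imp_algebraic) auto
  define I where "I = {q :: 'a poly. (\<forall>i. coeff q i \<in> simple_ext \<theta>) \<and> poly q b = 0}"
  define h' where "h' = (of_rat_poly h :: 'a poly)"
  define f' where "f' = pcompose (of_rat_poly f) [:\<theta>, - of_nat c:]"
  have "h' \<in> I" using h by (auto simp: I_def h'_def coeff_map_poly is_minpoly_def rpoly_def)
  have "h' \<noteq> 0" using h by (auto simp: h'_def is_minpoly_def)
  have "f' \<in> I"
  proof -
    have "coeff (pcompose (of_rat_poly q) [:\<theta>, - of_nat c:]) i \<in> simple_ext \<theta>" for q :: "rat poly" and i
    proof (induction q arbitrary: i)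
      case 0
      show ?case by (simp only: Polynomial.map_poly_0 pcompose_0 coeff_0 simple_ext_0)
    next
      case (pCons u q)
      have "coeff (pcompose (of_rat_poly q) [:\<theta>, - of_nat c:] * [:\<theta>, - of_nat c:]) i \<in> simple_ext \<theta>"
        using pCons.IH[of 0]
        by (auto simp: coeff_pCons pCons.IH split: nat.splits
            intro!: simple_ext_add simple_ext_diff simple_ext_minus simple_ext_mult)
      moreover have "poly (of_rat_poly q) \<theta> \<in> simple_ext \<theta>"
        by (rule simple_extI) (simp add: rpoly_def)
      ultimately show ?case
        by (auto simp: Polynomial.map_poly_pCons pcompose_pCons coeff_pCons mult.commute split: nat.splits
            intro!: simple_ext_add)
    qed
    then show ?thesis using f by (simp add: I_def f'_def poly_pcompose \<theta>_def is_minpoly_def rpoly_def)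
  qed
  obtain q where q: "q \<in> I" "q \<noteq> 0" and qmin: "\<And>s. s \<in> I \<Longrightarrow> s \<noteq> 0 \<Longrightarrow> degree q \<le> degree s"
    using exists_least_iff[of "\<lambda>d. \<exists>s. s \<in> I \<and> s \<noteq> 0 \<and> degree s = d"] \<open>h' \<in> I\<close> \<open>h' \<noteq> 0\<close>
    by (metis not_le)
  have dvd: "q dvd s" if "s \<in> I" for s
    using that
  proof (induction "degree s" arbitrary: s rule: less_induct)
    case less
    show ?case
    proof (cases "s = 0")
      case False
      define k where "k = degree s - degree q"
      define m where "m = monom (lead_coeff s / lead_coeff q) k"
      define s' where "s' = s - m * q"
      have le: "degree q \<le> degree s" using qmin less.prems False by blast
      have "lead_coeff s / lead_coeff q \<noteq> 0" using False q by simp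
      then have "degree m = k" unfolding m_def by (rule degree_monom_eq)
      then have degmq: "degree (m * q) = degree s"
      proof -
        have "m \<noteq> 0" using \<open>lead_coeff s / lead_coeff q \<noteq> 0\<close> by (simp add: m_def)
        then show ?thesis using \<open>degree m = k\<close> q le by (subst degree_mult_eq) (auto simp: k_def)
      qed
      have "lead_coeff (m * q) = lead_coeff s"
        using q \<open>degree m = k\<close> unfolding lead_coeff_mult by (simp add: m_def)
      then have lead: "coeff s' (degree s) = 0" by (simp add: s'_def degmq)
      have s'I: "s' \<in> I"
        using less.prems q alg\<theta>
        by (auto simp: I_def s'_def m_def coeff_monom_mult
            intro!: simple_ext_diff simple_ext_mult simple_ext_divide)
      have "q dvd s'"
      proof (cases "s' = 0")
        case False
        have "degree s' \<le> degree s" unfolding s'_def using degmq by (intro degree_diff_le) auto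
        then have "degree s' < degree s"
          using lead False by (metis leading_coeff_0_iff le_neq_implies_less)
        then show ?thesis using less.hyps s'I by blast
      qed simp
      moreover have "s = s' + m * q" by (simp add: s'_def)
      ultimately show ?thesis by (metis dvd_add dvd_triv_right)
    qed simp
  qed
  \<comment> \<open>A root of q is common to h and f(\<theta> - c X), so unless it is b it puts c
    into Z.\<close>
  have root: "t = b" if "poly q t = 0" for t
  proof (rule ccontr)
    assume "t \<noteq> b"
    have "poly h' t = 0" "poly f' t = 0"
      using dvd[OF \<open>h' \<in> I\<close>] dvd[OF \<open>f' \<in> I\<close>] that by (auto elim!: dvdE)
    then have "t \<in> roots h" "\<theta> - of_nat c * t \<in> roots f"
      by (auto simp: roots_def rpoly_def h'_def f'_def poly_pcompose mult.commute)
    then have "((\<theta> - of_nat c * t) - a) / (b - t) \<in> Z" unfolding Z_def by force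
    moreover have "((\<theta> - of_nat c * t) - a) / (b - t) = of_nat c"
      using \<open>t \<noteq> b\<close> by (simp add: \<theta>_def field_simps)
    ultimately show False using c by simp
  qed
  have "poly q b = 0" using q by (simp add: I_def)
  then obtain s where s: "q = [:- b, 1:] * s" by (metis dvdE poly_eq_0_iff_dvd)
  \<comment> \<open>A further root of q would again be b, and a double root contradicts the
    separability of h.\<close>
  have "degree s = 0"
  proof (rule ccontr)
    assume "degree s \<noteq> 0"
    then obtain t where "poly s t = 0" using alg_closed_imp_poly_has_root[of s] by auto
    then have "poly s b = 0" using root[of t] s by auto
    then have "[:- b, 1:] dvd s" by (simp only: poly_eq_0_iff_dvd)
    then have "[:- b, 1:]^2 dvd q" unfolding s power2_eq_square by (intro mult_dvd_mono dvd_refl)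
    then have "[:- b, 1:]^2 dvd h'" using dvd[OF \<open>h' \<in> I\<close>] by (rule dvd_trans)
    then show False using minpoly_separable[of h b] h by (simp add: h'_def is_minpoly_def)
  qed
  then obtain e where "s = [:e:]" by (auto elim: degree_eq_zeroE)
  then have q_eq: "q = [:- (e * b), e:]" "e \<noteq> 0" using s q(2) by (auto simp: mult.commute)
  have "coeff q 0 \<in> simple_ext \<theta>" "coeff q 1 \<in> simple_ext \<theta>" using q by (auto simp only: I_def mem_Collect_eq)
  then have "- (e * b) \<in> simple_ext \<theta>" "e \<in> simple_ext \<theta>" by (simp_all add: q_eq)
  then have "- (- (e * b)) / e \<in> simple_ext \<theta>"
    by (rule simple_ext_divide[OF alg\<theta> simple_ext_minus])
  then have b: "b \<in> simple_ext \<theta>" using q_eq by simp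
  moreover have "a = \<theta> - of_nat c * b" by (simp add: \<theta>_def)
  then have "a \<in> simple_ext \<theta>" using b by (metis simple_ext_diff simple_ext_mult simple_ext_of_nat simple_ext_self)
  ultimately show ?thesis using that[of c] by (simp add: \<theta>_def)
qed

lemma subfield_add: "is_subfield K \<Longrightarrow> x \<in> K \<Longrightarrow> y \<in> K \<Longrightarrow> x + y \<in> K"
  and subfield_mult: "is_subfield K \<Longrightarrow> x \<in> K \<Longrightarrow> y \<in> K \<Longrightarrow> x * y \<in> K"
  by (simp_all add: is_subfield_def)

lemma subfield_of_rat:
  assumes "is_subfield K"
  shows "of_rat q \<in> K"
proof -
  have nat: "of_nat k \<in> K" for k
    by (induction k) (use assms in \<open>auto simp: is_subfield_def\<close>)
  have "of_int k \<in> K" for k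
    by (cases k rule: int_cases2) (use nat assms in \<open>auto simp: is_subfield_def\<close>)
  then have "of_int a * inverse (of_int b) \<in> K" for a b
    using assms by (auto simp: is_subfield_def)
  moreover obtain a b where "q = of_int a / of_int b" by (cases q) (auto simp: Fract_of_int_quotient)
  ultimately show ?thesis by (simp add: of_rat_mult of_rat_inverse divide_inverse)
qed

lemma simple_ext_subset_subfield:
  assumes "is_subfield K" "x \<in> K"
  shows "simple_ext x \<subseteq> K"
proof
  have "rpoly b x \<in> K" for b
    by (induction b) (use assms subfield_of_rat[OF assms(1)] in \<open>auto simp: is_subfield_def\<close>)
  then show "y \<in> K" if "y \<in> simple_ext x" for y using that by (auto elim: simple_extE)
qed

text \<open>The elements of a spanning set are adjoined one at a time. Each is first multiplied by a
  positive integer n to become integral, as \<open>exists_primitive_sum\<close> demands; division by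
  n is possible in the resulting field.\<close>

lemma number_field_primitive_element:
  fixes K :: "'a::{field_char_0, alg_closed_field} set"
  assumes alg: "\<forall>x::'a. algebraic x" and K: "number_field K"
  obtains \<kappa> where "algebraic_int \<kappa>" "K = simple_ext \<kappa>"
proof -
  interpret vs: vector_space "rat_scale :: rat \<Rightarrow> 'a \<Rightarrow> 'a" by (rule vector_space_rat_scale)
  have sf: "is_subfield K" using K by (simp add: number_field_def)
  obtain B where B: "finite B" "B \<subseteq> K" "vs.span B = K"
    using K by (auto simp: number_field_def finite_over_rat_def)
  have "\<exists>\<kappa>\<in>K. algebraic_int \<kappa> \<and> C \<subseteq> simple_ext \<kappa>" if "finite C" "C \<subseteq> K" for C
    using that
  proof (induction C)
    case empty
    show ?case using sf by (intro bexI[of _ 0]) (auto simp: is_subfield_def)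
  next
    case (insert b C)
    then obtain \<kappa> where \<kappa>: "\<kappa> \<in> K" "algebraic_int \<kappa>" "C \<subseteq> simple_ext \<kappa>" by auto
    obtain n :: nat where n: "n > 0" "algebraic_int (of_nat n * b)"
      using algebraic_int_multiple alg by blast
    obtain c :: nat where c: "\<kappa> \<in> simple_ext (\<kappa> + of_nat c * (of_nat n * b))"
      "of_nat n * b \<in> simple_ext (\<kappa> + of_nat c * (of_nat n * b))"
      using exists_primitive_sum[OF \<kappa>(2) n(2)] by blast
    let ?\<theta> = "\<kappa> + of_nat c * (of_nat n * b)"
    have nK: "of_nat k \<in> K" for k using subfield_of_rat[OF sf, of "of_nat k"] by simp
    have "of_nat n * b / of_nat n \<in> simple_ext ?\<theta>"
      using alg c(2) by (intro simple_ext_divide) auto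
    then have "b \<in> simple_ext ?\<theta>" using n(1) by simp
    moreover have "C \<subseteq> simple_ext ?\<theta>" using \<kappa>(3) simple_ext_mono[OF c(1)] by blast
    moreover have "?\<theta> \<in> K" 
      using sf \<kappa>(1) insert.prems nK by (intro subfield_add subfield_mult) auto
    moreover have "algebraic_int ?\<theta>" using \<kappa>(2) n(2) by auto
    ultimately show ?case by auto
  qed
  then obtain \<kappa> where \<kappa>: "\<kappa> \<in> K" "algebraic_int \<kappa>" "B \<subseteq> simple_ext \<kappa>" using B by blast
  have "vs.subspace (simple_ext \<kappa>)"
    by (auto simp: vs.subspace_def intro: simple_ext_add simple_ext_mult)
  then have "K \<subseteq> simple_ext \<kappa>" using vs.span_minimal[OF \<kappa>(3)] B(3) by simp
  then show ?thesis using that[of \<kappa>] \<kappa> simple_ext_subset_subfield[OF sf \<kappa>(1)] by blast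
qed

text \<open>A proper extension has relative degree at least 2: the elements
  \<open>\<alpha> ^ i\<close> and \<open>x * \<alpha> ^ i\<close> with i < n are 2n independent
  ones, since a relation would express x in Q(\<alpha>), and they lie in the span of m powers of
  \<theta>.\<close>

lemma degree_double_if_proper_extension:
  fixes \<alpha> \<theta> x :: "'a::field_char_0"
  assumes g: "is_minpoly g \<alpha>" and h: "is_minpoly h \<theta>"
    and \<alpha>: "\<alpha> \<in> simple_ext \<theta>" and x: "x \<in> simple_ext \<theta>" "x \<notin> simple_ext \<alpha>"
  shows "2 * degree g \<le> degree h"
proof -
  interpret vs: vector_space "rat_scale :: rat \<Rightarrow> 'a \<Rightarrow> 'a" by (rule vector_space_rat_scale)
  define n where "n = degree g"
  define m where "m = degree h"
  have alg: "algebraic \<alpha>"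
  proof (rule algebraicI')
    show "poly (of_rat_poly g) \<alpha> = 0" using g by (simp add: is_minpoly_def rpoly_def)
    show "of_rat_poly g \<noteq> (0 :: 'a poly)" using g by (auto simp: is_minpoly_def)
  qed (auto simp: coeff_map_poly)
  define T where "T = (\<lambda>i. \<theta> ^ i) ` {..<m}"
  have span: "simple_ext \<theta> \<subseteq> vs.span T"
  proof
    fix y assume "y \<in> simple_ext \<theta>"
    then obtain b where b: "y = rpoly b \<theta>" by (rule simple_extE)
    have "y = rpoly (b mod h) \<theta>"
    proof -
      have "y = rpoly (b div h * h + b mod h) \<theta>" by (simp only: b div_mult_mod_eq)
      also have "\<dots> = rpoly (b mod h) \<theta>"
        using h unfolding rpoly_add rpoly_mult by (simp add: is_minpoly_def)
      finally show ?thesis .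
    qed
    also have "\<dots> = (\<Sum>i<m. of_rat (coeff (b mod h) i) * \<theta> ^ i)"
      unfolding m_def
      using degree_mod_less'[of h b] irreducible_rat_degree_pos[of h] h
      by (intro rpoly_altdef') (cases "b mod h = 0"; auto simp: is_minpoly_def)
    finally show "y \<in> vs.span T"
      by (simp only:) (intro vs.span_sum vs.span_scale vs.span_base, auto simp: T_def)
  qed
  have indep_poly: "b = 0" if "rpoly b \<alpha> = 0" "degree b < n" for b
    using rpoly_eq_0_degree_less[of g \<alpha> b] that g by (simp add: is_minpoly_def n_def)
  have npos: "n > 0" using g irreducible_rat_degree_pos by (auto simp: n_def is_minpoly_def)
  have inj: "inj_on (\<lambda>i. \<alpha> ^ i) {..<n}"
  proof (rule inj_onI)
    fix i j assume ij: "i \<in> {..<n}" "j \<in> {..<n}" "\<alpha> ^ i = \<alpha> ^ j"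
    have "degree (monom 1 i - monom 1 j :: rat poly) \<le> max i j"
      by (intro order_trans[OF degree_diff_le_max]) (simp add: degree_monom_eq)
    then have "monom 1 i - monom 1 j = (0 :: rat poly)"
      using ij by (intro indep_poly) (auto intro: le_less_trans)
    then show "i = j" by (metis monom_eq_iff' right_minus_eq zero_neq_one)
  qed
  have x0: "x \<noteq> 0" using x by auto
  have inj': "inj_on (\<lambda>i. x * \<alpha> ^ i) {..<n}"
    using inj x0 by (auto simp: inj_on_def)
  define A1 where "A1 = (\<lambda>i. \<alpha> ^ i) ` {..<n}"
  define A2 where "A2 = (\<lambda>i. x * \<alpha> ^ i) ` {..<n}"
  have no_rel: "u = 0 \<and> v = 0"
    if "rpoly u \<alpha> + x * rpoly v \<alpha> = 0" "degree u < n" "degree v < n" for u v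
  proof -
    have "rpoly v \<alpha> = 0"
    proof (rule ccontr)
      assume "rpoly v \<alpha> \<noteq> 0"
      moreover have "x * rpoly v \<alpha> = rpoly (- u) \<alpha>"
        using that(1) by (simp add: eq_neg_iff_add_eq_0 add.commute)
      ultimately have "x = rpoly (- u) \<alpha> / rpoly v \<alpha>"
        by (subst eq_divide_eq) simp
      then have "x \<in> simple_ext \<alpha>"
        using alg by (metis simple_ext_divide simple_extI)
      then show False using x by simp
    qed
    then show ?thesis using that indep_poly by auto
  qed
  have disj: "A1 \<inter> A2 = {}"
  proof (rule ccontr)
    assume "A1 \<inter> A2 \<noteq> {}"
    then obtain i j where ij: "i < n" "j < n" "\<alpha> ^ i = x * \<alpha> ^ j" by (auto simp: A1_def A2_def)
    then have "- monom 1 j = (0 :: rat poly)"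
      using no_rel[of "monom 1 i" "- monom 1 j"] by (auto simp: degree_monom_eq)
    then show False by simp
  qed
  have "vs.independent (A1 \<union> A2)"
  proof
    assume "vs.dependent (A1 \<union> A2)"
    then obtain c where c: "\<exists>v\<in>A1 \<union> A2. c v \<noteq> 0" "(\<Sum>v\<in>A1 \<union> A2. rat_scale (c v) v) = 0"
      by (subst (asm) vs.dependent_finite) (auto simp: A1_def A2_def)
    define u where "u = (\<Sum>i<n. monom (c (\<alpha> ^ i)) i)"
    define v where "v = (\<Sum>i<n. monom (c (x * \<alpha> ^ i)) i)"
    have "(\<Sum>v\<in>A1 \<union> A2. rat_scale (c v) v) = (\<Sum>v\<in>A1. rat_scale (c v) v) + (\<Sum>v\<in>A2. rat_scale (c v) v)"
      using disj by (intro sum.union_disjoint) (auto simp: A1_def A2_def)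
    also have "(\<Sum>v\<in>A1. rat_scale (c v) v) = rpoly u \<alpha>"
      by (simp add: A1_def sum.reindex[OF inj] u_def)
    also have "(\<Sum>v\<in>A2. rat_scale (c v) v) = x * rpoly v \<alpha>"
      by (simp add: A2_def sum.reindex[OF inj'] v_def sum_distrib_left mult_ac)
    finally have "rpoly u \<alpha> + x * rpoly v \<alpha> = 0" using c(2) by simp
    moreover have "degree u < n" "degree v < n"
      unfolding u_def v_def using npos
      by (auto intro!: degree_sum_less intro: le_less_trans[OF degree_monom_le])
    ultimately have "u = 0" "v = 0" using no_rel by auto
    have coeff: "coeff (\<Sum>i<n. monom (f i) i) j = f j" if "j < n" for f :: "nat \<Rightarrow> rat" and j
      using that by (simp add: coeff_sum)
    have "c (\<alpha> ^ i) = 0" "c (x * \<alpha> ^ i) = 0" if "i < n" for i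
      using coeff[OF that, of "\<lambda>i. c (\<alpha> ^ i)"] coeff[OF that, of "\<lambda>i. c (x * \<alpha> ^ i)"] \<open>u = 0\<close> \<open>v = 0\<close>
      by (auto simp: u_def v_def)
    then show False using c(1) by (auto simp: A1_def A2_def)
  qed
  moreover have "A1 \<union> A2 \<subseteq> vs.span T"
    using \<alpha> x by (auto simp: A1_def A2_def intro!: subsetD[OF span] simple_ext_mult simple_ext_power)
  ultimately have "card (A1 \<union> A2) \<le> card T"
    using vs.independent_span_bound[of T "A1 \<union> A2"] by (simp add: T_def)
  moreover have "card T \<le> m" using card_image_le[of "{..<m}" "\<lambda>i. \<theta> ^ i"] by (simp add: T_def)
  moreover have "card (A1 \<union> A2) = 2 * n"
    using disj card_image[OF inj] card_image[OF inj'] by (subst card_Un_disjoint) (auto simp: A1_def A2_def)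
  ultimately show ?thesis by (simp add: n_def m_def)
qed

section \<open>Conjugation in a Galois number field\<close>

lemma algebraic_int_div_coprime:
  fixes y :: "'a::field_char_0"
  assumes p: "prime p" "\<not> p dvd E" and y: "algebraic_int y" "algebraic_int (of_nat E * y / of_nat p)"
  shows "algebraic_int (y / of_nat p)"
proof -
  have "coprime p E" using p by (rule prime_imp_coprime)
  then have "coprime (int E) (int p)" by (simp add: coprime_commute)
  then obtain u v where uv: "u * int E + v * int p = 1"
    using bezout_int[of "int E" "int p"] by (auto simp: coprime_iff_gcd_eq_1)
  then have 1: "of_int u * of_nat E + of_int v * of_nat p = (1 :: 'a)"
    by (metis of_int_1 of_int_add of_int_mult of_int_of_nat_eq)
  have "y / of_nat p = (of_int u * of_nat E + of_int v * of_nat p) * y / of_nat p" by (simp only: 1 mult_1_left)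
  also have "\<dots> = of_int u * (of_nat E * y / of_nat p) + of_int v * y"
    using prime_gt_0_nat[OF p(1)] by (simp add: field_simps)
  also have "algebraic_int \<dots>" using y by (intro algebraic_int_add algebraic_int_mult) auto
  finally show ?thesis .
qed

lemma algebraic_int_poly_cong:
  fixes x y :: "'a::field_char_0" and q :: "int poly"
  assumes "algebraic_int x" "algebraic_int y" "algebraic_int ((x - y) / d)"
  shows "algebraic_int ((poly (of_int_poly q) x - poly (of_int_poly q) y) / d)"
proof (induction q)
  case (pCons a q)
  have "(poly (of_int_poly (pCons a q)) x - poly (of_int_poly (pCons a q)) y) / d =
      x * ((poly (of_int_poly q) x - poly (of_int_poly q) y) / d) +
      (x - y) / d * poly (of_int_poly q) y"
    by (simp add: Polynomial.map_poly_pCons algebra_simps add_divide_distrib diff_divide_distrib)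
  then show ?case
    by (simp only:) (intro algebraic_int_add algebraic_int_mult assms pCons.IH algebraic_int_poly_of_int)
qed simp

lemma PP_poly_cong:
  fixes x y :: "'a::field_char_0" and q :: "int poly"
  assumes p: "prime p" and "algebraic_int x" "algebraic_int y" "x - y \<in> \<PP> p"
  shows "poly (of_int_poly q) x - poly (of_int_poly q) y \<in> \<PP> p"
proof (induction q)
  case 0
  show ?case by (simp add: PP_0[OF p])
next
  case (pCons a q)
  have "poly (of_int_poly (pCons a q)) x - poly (of_int_poly (pCons a q)) y =
      x * (poly (of_int_poly q) x - poly (of_int_poly q) y) + (x - y) * poly (of_int_poly q) y"
    by (simp add: Polynomial.map_poly_pCons algebra_simps)
  then show ?case
    by (simp only:) (intro PP_add[OF p] PP_mult_left[OF p pCons.IH] PP_mult_right[OF p] assms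
        algebraic_int_poly_of_int)
qed

lemma algebraic_int_rat_is_int:
  assumes "algebraic_int (of_rat q :: 'a::field_char_0)"
  obtains k :: int where "q = of_int k"
proof -
  have "(of_rat q :: 'a) \<in> \<int>" using rational_algebraic_int_is_int[OF assms] by simp
  then obtain k :: int where "(of_rat q :: 'a) = of_int k" by (auto elim: Ints_cases)
  then have "(of_rat q :: 'a) = of_rat (of_int k)" by simp
  then show ?thesis using that by (simp only: of_rat_eq_iff)
qed

lemma algebraic_int_coeff_prod_linear:
  "finite A \<Longrightarrow> (\<And>a. a \<in> A \<Longrightarrow> algebraic_int a) \<Longrightarrow> algebraic_int (coeff (\<Prod>a\<in>A. [:- a, 1:]) i :: 'a::field_char_0)"
proof (induction A arbitrary: i rule: finite_induct)
  case empty
  show ?case by (simp add: one_pCons coeff_pCons split: nat.splits)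
next
  case (insert a A)
  then show ?case by (auto simp: coeff_pCons split: nat.splits)
qed

text \<open>A Galois field Q(\<alpha>) with integral generator; normality is the condition that all
  conjugates of \<alpha> lie in it. The theory is needed twice, for K' and for the
  compositum.\<close>

locale galois_gen =
  fixes \<alpha> :: "'a::{field_char_0, alg_closed_field}" and g :: "rat poly"
  assumes minpoly: "is_minpoly g \<alpha>"
    and int: "algebraic_int \<alpha>"
    and normal: "roots g \<subseteq> simple_ext \<alpha>"
begin

abbreviation M where "M \<equiv> simple_ext \<alpha>"
abbreviation R :: "'a set" where "R \<equiv> roots g"
abbreviation n where "n \<equiv> degree g"

lemma irred: "irreducible g" and root_\<alpha>: "rpoly g \<alpha> = 0"
  using minpoly by (auto simp: is_minpoly_def)

lemma finite_R [simp]: "finite R"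
  by (rule finite_roots[OF irred])

lemma card_R: "card R = n"
  by (rule minpoly_factorization(2)[OF minpoly])

lemma n_pos: "n > 0"
  by (rule irreducible_rat_degree_pos[OF irred])

lemma \<alpha>_R [simp]: "\<alpha> \<in> R"
  by (simp add: roots_def root_\<alpha>)

lemma R_M: "r \<in> R \<Longrightarrow> r \<in> M"
  using normal by blast

text \<open>The automorphism of M sending \<alpha> to r, so the set R of conjugates stands in for
  the Galois group. On M the chosen polynomial expression for x is immaterial by
  \<open>cj_rpoly\<close>.\<close>

definition cj :: "'a \<Rightarrow> 'a \<Rightarrow> 'a" where
  "cj r x = rpoly (SOME b. x = rpoly b \<alpha>) r"

lemma cj_rpoly: 
  assumes "r \<in> R"
  shows "cj r (rpoly b \<alpha>) = rpoly b r"
proof -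
  have "rpoly b \<alpha> = rpoly (SOME c. rpoly b \<alpha> = rpoly c \<alpha>) \<alpha>"
    by (rule someI[of "\<lambda>c. rpoly b \<alpha> = rpoly c \<alpha>" b]) simp
  then show ?thesis
    unfolding cj_def using rpoly_eq_transfer[OF irred root_\<alpha>, of r] assms by (metis (mono_tags) mem_Collect_eq roots_def)
qed

lemma cj_add: "r \<in> R \<Longrightarrow> x \<in> M \<Longrightarrow> y \<in> M \<Longrightarrow> cj r (x + y) = cj r x + cj r y"
  by (metis cj_rpoly rpoly_add simple_extE)

lemma cj_mult: "r \<in> R \<Longrightarrow> x \<in> M \<Longrightarrow> y \<in> M \<Longrightarrow> cj r (x * y) = cj r x * cj r y"
  by (metis cj_rpoly rpoly_mult simple_extE)

lemma cj_diff: "r \<in> R \<Longrightarrow> x \<in> M \<Longrightarrow> y \<in> M \<Longrightarrow> cj r (x - y) = cj r x - cj r y"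
  by (metis cj_rpoly rpoly_diff simple_extE)

lemma cj_power: "r \<in> R \<Longrightarrow> x \<in> M \<Longrightarrow> cj r (x ^ k) = cj r x ^ k"
  by (metis cj_rpoly rpoly_power simple_extE)

lemma cj_of_rat: "r \<in> R \<Longrightarrow> cj r (of_rat q) = of_rat q"
  using cj_rpoly[of r "[:q:]"] by simp

lemma cj_of_nat: "r \<in> R \<Longrightarrow> cj r (of_nat k) = of_nat k"
  using cj_of_rat[of r "of_nat k"] by simp

lemma cj_0: "r \<in> R \<Longrightarrow> cj r 0 = 0" and cj_1: "r \<in> R \<Longrightarrow> cj r 1 = 1"
  using cj_of_rat[of r 0] cj_of_rat[of r 1] by simp_all

lemma cj_\<alpha>: "r \<in> R \<Longrightarrow> cj r \<alpha> = r"
  using cj_rpoly[of r "[:0, 1:]"] by simp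

lemma cj_rpoly': "r \<in> R \<Longrightarrow> x \<in> M \<Longrightarrow> cj r (rpoly b x) = rpoly b (cj r x)"
  by (metis cj_rpoly rpoly_pcompose simple_extE)

lemma rpoly_M: "x \<in> M \<Longrightarrow> rpoly b x \<in> M"
  by (metis rpoly_pcompose simple_extE simple_extI)

lemma cj_M: "r \<in> R \<Longrightarrow> x \<in> M \<Longrightarrow> cj r x \<in> M"
  by (metis R_M cj_rpoly rpoly_M simple_extE)

lemma cj_eq_0_iff: "r \<in> R \<Longrightarrow> x \<in> M \<Longrightarrow> cj r x = 0 \<longleftrightarrow> x = 0"
proof -
  assume r: "r \<in> R" and "x \<in> M"
  then obtain b where b: "x = rpoly b \<alpha>" by (elim simple_extE)
  have r0: "rpoly g r = 0" using r by (simp add: roots_def)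
  show ?thesis
    using root_transfer[OF irred r0 root_\<alpha>, of b] root_transfer[OF irred root_\<alpha> r0, of b] r
    by (auto simp: b cj_rpoly)
qed

lemma cj_inj: "r \<in> R \<Longrightarrow> x \<in> M \<Longrightarrow> y \<in> M \<Longrightarrow> cj r x = cj r y \<Longrightarrow> x = y"
  using cj_eq_0_iff[of r "x - y"] by (simp add: cj_diff simple_ext_diff)

lemma cj_R: "s \<in> R \<Longrightarrow> r \<in> R \<Longrightarrow> cj s r \<in> R"
  using cj_rpoly'[of s r g] R_M cj_0 by (simp add: roots_def)

lemma cj_bij:
  assumes "s \<in> R"
  shows "bij_betw (cj s) R R"
proof -
  have "inj_on (cj s) R" using assms cj_inj R_M by (auto intro!: inj_onI)
  moreover have "cj s ` R = R"
    using assms cj_R by (intro endo_inj_surj[OF finite_R _ \<open>inj_on (cj s) R\<close>]) auto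
  ultimately show ?thesis by (simp add: bij_betw_def)
qed

text \<open>Both sides are automorphisms with the same value on \<alpha>; this is the group law,
  transported to R.\<close>

lemma cj_comp: 
  assumes "s \<in> R" "r \<in> R" "x \<in> M"
  shows "cj s (cj r x) = cj (cj s r) x"
proof -
  obtain b where b: "x = rpoly b \<alpha>" using assms by (elim simple_extE)
  have "cj s (cj r x) = rpoly b (cj s r)"
    unfolding b cj_rpoly[OF assms(2)] by (rule cj_rpoly'[OF assms(1) R_M[OF assms(2)]])
  then show ?thesis unfolding b cj_rpoly[OF cj_R[OF assms(1,2)]] .
qed

lemma cj_algebraic_int:
  assumes "r \<in> R" "x \<in> M" "algebraic_int x"
  shows "algebraic_int (cj r x)"
proof -
  obtain p where p: "poly (of_int_poly p) x = 0" "lead_coeff p = 1"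
    using assms(3) algebraic_int_altdef_ipoly by blast
  have eq: "poly (of_int_poly p) y = rpoly (of_int_poly p) y" for y :: 'a
    by (simp add: rpoly_def map_poly_map_poly o_def)
  have "poly (of_int_poly p) (cj r x) = cj r (poly (of_int_poly p) x)"
    by (simp only: eq cj_rpoly'[OF assms(1,2)])
  also have "\<dots> = 0" using p assms by (simp add: cj_0)
  finally show ?thesis using p(2) algebraic_int_altdef_ipoly by blast
qed

abbreviation OM where "OM \<equiv> \<O> M"

lemma OM_M: "x \<in> OM \<Longrightarrow> x \<in> M" and OM_algebraic_int: "x \<in> OM \<Longrightarrow> algebraic_int x"
  by (auto simp: ring_of_integers_def)

lemma OM_I: "x \<in> M \<Longrightarrow> algebraic_int x \<Longrightarrow> x \<in> OM"
  by (auto simp: ring_of_integers_def)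

lemma OM_add: "x \<in> OM \<Longrightarrow> y \<in> OM \<Longrightarrow> x + y \<in> OM"
  and OM_diff: "x \<in> OM \<Longrightarrow> y \<in> OM \<Longrightarrow> x - y \<in> OM"
  and OM_mult: "x \<in> OM \<Longrightarrow> y \<in> OM \<Longrightarrow> x * y \<in> OM"
  and OM_power: "x \<in> OM \<Longrightarrow> x ^ k \<in> OM"
  and OM_of_int: "of_int j \<in> OM"
  and OM_of_nat: "of_nat i \<in> OM"
  by (auto simp: ring_of_integers_def simple_ext_add simple_ext_diff simple_ext_mult simple_ext_power)

lemma OM_prod: "(\<And>i. i \<in> I \<Longrightarrow> f i \<in> OM) \<Longrightarrow> prod f I \<in> OM"
  by (auto simp: ring_of_integers_def intro: simple_ext_prod)

lemma OM_cj: "r \<in> R \<Longrightarrow> x \<in> OM \<Longrightarrow> cj r x \<in> OM"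
  by (auto simp: ring_of_integers_def intro: cj_M cj_algebraic_int)

lemma OM_\<alpha>: "\<alpha> \<in> OM"
  using int by (auto simp: ring_of_integers_def)

lemma OM_R: "r \<in> R \<Longrightarrow> r \<in> OM"
  using OM_cj[of r \<alpha>] OM_\<alpha> cj_\<alpha> by simp

lemma ex_reduced_rpoly:
  assumes "x \<in> M"
  obtains b where "x = rpoly b \<alpha>" "degree b < n"
proof -
  obtain b where b: "x = rpoly b \<alpha>" using assms by (rule simple_extE)
  have "x = rpoly (b div g * g + b mod g) \<alpha>" by (simp only: b div_mult_mod_eq)
  also have "\<dots> = rpoly (b mod g) \<alpha>" unfolding rpoly_add rpoly_mult by (simp add: root_\<alpha>)
  finally show ?thesis
    using that[of "b mod g"] degree_mod_less'[of g b] n_pos irred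
    by (cases "b mod g = 0") auto
qed

lemma poly_eq_if_eq_on_R:
  fixes p q :: "'a poly"
  assumes "degree p < n" "degree q < n" "\<And>r. r \<in> R \<Longrightarrow> poly p r = poly q r"
  shows "p = q"
proof (rule ccontr)
  assume "p \<noteq> q"
  have "card R \<le> card {x. poly (p - q) x = 0}"
    using \<open>p \<noteq> q\<close> assms(3) by (intro card_mono poly_roots_finite) auto
  also have "\<dots> \<le> degree (p - q)"
    using \<open>p \<noteq> q\<close> by (intro card_poly_roots_bound) auto
  also have "\<dots> < n" using assms(1,2) by (intro degree_diff_less)
  finally show False by (simp add: card_R)
qed

text \<open>A polynomial of degree below n representing x takes the value x at all n conjugates of
  \<alpha>, hence is constant.\<close>

lemma rational_if_cj_fixed:
  assumes x: "x \<in> M" and fixed: "\<And>r. r \<in> R \<Longrightarrow> cj r x = x"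
  obtains q where "x = of_rat q"
proof -
  obtain b where b: "x = rpoly b \<alpha>" "degree b < n" using ex_reduced_rpoly[OF x] .
  have "of_rat_poly b = [:x:]"
  proof (rule poly_eq_if_eq_on_R)
    fix r assume r: "r \<in> R"
    show "poly (of_rat_poly b) r = poly [:x:] r"
      using fixed[OF r] cj_rpoly[OF r, of b] by (simp only: b(1)[symmetric]) (simp add: rpoly_def)
  qed (use b(2) n_pos in simp_all)
  from arg_cong[OF this, of "\<lambda>q. coeff q 0"] have "x = of_rat (coeff b 0)"
    by (simp add: coeff_map_poly)
  then show ?thesis using that by blast
qed

section \<open>The norm of M\<close>

definition nrm :: "'a \<Rightarrow> int" where
  "nrm x = (SOME k. (\<Prod>r\<in>R. cj r x) = of_int k)"

text \<open>Conjugation permutes the factors, so the product is rational, and a rational algebraic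
  integer is an integer.\<close>

lemma nrm:
  assumes x: "x \<in> OM"
  shows "(\<Prod>r\<in>R. cj r x) = of_int (nrm x)"
proof -
  let ?N = "\<Prod>r\<in>R. cj r x"
  have N: "?N \<in> OM" using x by (intro OM_prod OM_cj)
  have "cj s ?N = ?N" if s: "s \<in> R" for s
  proof -
    have cj_prod: "cj s (prod f I) = (\<Prod>i\<in>I. cj s (f i))" if "\<And>i. i \<in> I \<Longrightarrow> f i \<in> M" for f and I :: "'a set"
      using that s by (induction I rule: infinite_finite_induct) (auto simp: cj_1 cj_mult simple_ext_prod)
    have "cj s ?N = (\<Prod>r\<in>R. cj (cj s r) x)"
      using x s by (subst cj_prod) (auto simp: cj_comp cj_M OM_M)
    also have "\<dots> = ?N"
      using prod.reindex_bij_betw[OF cj_bij[OF s], of "\<lambda>r. cj r x"] .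
    finally show ?thesis .
  qed
  then obtain q where q: "?N = of_rat q" using rational_if_cj_fixed[OF OM_M[OF N]] by blast
  then obtain k where "q = of_int k" using algebraic_int_rat_is_int[of q] OM_algebraic_int[OF N] by metis
  then have "?N = of_int k" using q by simp
  then show ?thesis unfolding nrm_def by (rule someI)
qed

lemma nrm_eq_0_iff: "x \<in> OM \<Longrightarrow> nrm x = 0 \<longleftrightarrow> x = 0"
proof -
  assume x: "x \<in> OM"
  have "nrm x = 0 \<longleftrightarrow> (\<Prod>r\<in>R. cj r x) = 0" by (simp add: nrm[OF x])
  also have "\<dots> \<longleftrightarrow> (\<exists>r\<in>R. cj r x = 0)" by simp
  also have "\<dots> \<longleftrightarrow> x = 0" using \<alpha>_R cj_eq_0_iff[OF _ OM_M[OF x]] by blast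
  finally show ?thesis .
qed

lemma nrm_of_nat_mult: "x \<in> OM \<Longrightarrow> nrm (of_nat k * x) = int k ^ n * nrm x"
proof -
  assume x: "x \<in> OM"
  have "(of_int (nrm (of_nat k * x)) :: 'a) = (\<Prod>r\<in>R. of_nat k * cj r x)"
    using x by (subst nrm[symmetric]) (auto simp: OM_mult OM_of_nat cj_mult cj_of_nat OM_M intro!: prod.cong)
  also have "\<dots> = of_int (int k ^ n * nrm x)"
    by (simp add: prod.distrib card_R nrm[OF x])
  finally show ?thesis by (simp only: of_int_eq_iff)
qed

text \<open>The ideal \<open>\<PP> p\<close> is prime and meets the integers in the multiples of
  p.\<close>

lemma dvd_nrm_iff:
  assumes p: "prime p" and x: "x \<in> OM"
  shows "int p dvd nrm x \<longleftrightarrow> (\<exists>r\<in>R. cj r x \<in> \<PP> p)"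
proof -
  have "int p dvd nrm x \<longleftrightarrow> (\<Prod>r\<in>R. cj r x) \<in> \<PP> p"
    by (simp add: nrm[OF x] PP_of_int_iff[OF p])
  also have "\<dots> \<longleftrightarrow> (\<exists>r\<in>R. cj r x \<in> \<PP> p)"
  proof
    assume "(\<Prod>r\<in>R. cj r x) \<in> \<PP> p"
    then show "\<exists>r\<in>R. cj r x \<in> \<PP> p"
      using x by (intro PP_prod[OF p]) (auto intro: OM_algebraic_int OM_cj)
  next
    assume "\<exists>r\<in>R. cj r x \<in> \<PP> p"
    then obtain r where r: "r \<in> R" "cj r x \<in> \<PP> p" by blast
    have "(\<Prod>r\<in>R. cj r x) = cj r x * (\<Prod>r\<in>R - {r}. cj r x)"
      using r by (simp add: prod.remove)
    then show "(\<Prod>r\<in>R. cj r x) \<in> \<PP> p"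
      using r x by (auto intro!: PP_mult_right[OF p] algebraic_int_prod OM_algebraic_int[OF OM_cj])
  qed
  finally show ?thesis .
qed

text \<open>The first clause says that E OM lies in Z[\<alpha>]. The second makes every p not
  dividing E unramified: an x in all primes above p has all coordinates of E x divisible by
  p.\<close>

definition is_denominator :: "nat \<Rightarrow> bool" where
  "is_denominator E \<longleftrightarrow> E > 0 \<and> (\<forall>x\<in>OM. \<exists>c :: nat \<Rightarrow> int. of_nat E * x = (\<Sum>i<n. of_int (c i) * \<alpha> ^ i) \<and>
       (\<forall>p. prime p \<longrightarrow> (\<forall>r\<in>R. cj r x \<in> \<PP> p) \<longrightarrow> (\<forall>i<n. int p dvd c i)))"

text \<open>Lagrange interpolation at the conjugates of \<open>\<alpha>\<close> bounds the denominators of coordinates; since the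
  coordinates are linear in the conjugates, they inherit divisibility from them.\<close>

lemma ex_denominator: "\<exists>E. is_denominator E"
proof -
  \<comment> \<open>Here \<open>w r\<close> is g'(r) and \<open>q r\<close> is g / (X - r), so their
    quotient is the Lagrange basis polynomial at r. E will clear the denominators of all inverses of
    \<open>w r\<close>.\<close>
  define w where "w r = (\<Prod>s\<in>R - {r}. r - s)" for r
  define q where "q r = (\<Prod>s\<in>R - {r}. [:- s, 1:])" for r :: 'a
  have w0: "w r \<noteq> 0" if "r \<in> R" for r
    unfolding w_def using that by auto
  have "\<exists>k>0. algebraic_int (of_nat k * inverse (w r))" if "r \<in> R" for r
  proof -
    have "algebraic_int (w r)"
      unfolding w_def using that
      by (intro algebraic_int_prod algebraic_int_diff) (auto intro: OM_algebraic_int[OF OM_R])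
    then have "algebraic (inverse (w r))" by (intro algebraic_inverse algebraic_int_imp_algebraic)
    then show ?thesis using algebraic_int_multiple by blast
  qed
  then obtain k where k: "\<And>r. r \<in> R \<Longrightarrow> k r > (0::nat)"
    "\<And>r. r \<in> R \<Longrightarrow> algebraic_int (of_nat (k r) * inverse (w r))" by metis
  define E where "E = (\<Prod>r\<in>R. k r)"
  have "E > 0" using k(1) by (auto simp: E_def)
  define u where "u r i = of_nat E * inverse (w r) * coeff (q r) i" for r i
  have u: "algebraic_int (u r i)" if r: "r \<in> R" for r i
  proof -
    have "of_nat E * inverse (w r) = of_nat (\<Prod>r\<in>R - {r}. k r) * (of_nat (k r) * inverse (w r))"
      using r by (simp add: E_def prod.remove)
    moreover have "algebraic_int (coeff (q r) i)"
      unfolding q_def by (rule algebraic_int_coeff_prod_linear) (auto intro: OM_algebraic_int OM_R)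
    ultimately show ?thesis
      unfolding u_def using k(2)[OF r] by (metis algebraic_int_mult algebraic_int_of_nat)
  qed
  have degq: "degree (q r) = n - 1" if "r \<in> R" for r
  proof -
    have "degree (q r) = (\<Sum>s\<in>R - {r}. degree [:- s, 1:])"
      unfolding q_def by (rule degree_prod_eq_sum_degree) auto
    also have "\<dots> = n - 1" using that by (simp add: card_R)
    finally show ?thesis .
  qed
  have pq: "poly (q r) s = (if s = r then w r else 0)" if "r \<in> R" "s \<in> R" for r s
  proof (cases "s = r")
    case False
    then have "\<exists>t\<in>R - {r}. poly [:- t, 1:] s = 0" using that by auto
    then show ?thesis using False by (simp add: q_def poly_prod)
  qed (simp add: q_def w_def poly_prod)
  have "\<exists>c :: nat \<Rightarrow> int. of_nat E * x = (\<Sum>i<n. of_int (c i) * \<alpha> ^ i) \<and>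
       (\<forall>p. prime p \<longrightarrow> (\<forall>r\<in>R. cj r x \<in> \<PP> p) \<longrightarrow> (\<forall>i<n. int p dvd c i))" if x: "x \<in> OM" for x
  proof -
    obtain b where b: "x = rpoly b \<alpha>" "degree b < n" using ex_reduced_rpoly OM_M[OF x] by blast
    have "of_rat_poly b = (\<Sum>r\<in>R. Polynomial.smult (cj r x * inverse (w r)) (q r))"
    proof (rule poly_eq_if_eq_on_R)
      show "degree (\<Sum>r\<in>R. Polynomial.smult (cj r x * inverse (w r)) (q r)) < n"
        using n_pos degq by (intro degree_sum_less le_less_trans[OF degree_smult_le]) auto
      fix s assume s: "s \<in> R"
      have "poly (\<Sum>r\<in>R. Polynomial.smult (cj r x * inverse (w r)) (q r)) s =
          (\<Sum>r\<in>R. if r = s then cj s x else 0)"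
        unfolding poly_sum
      proof (intro sum.cong refl)
        fix r assume "r \<in> R"
        then show "poly (Polynomial.smult (cj r x * inverse (w r)) (q r)) s = (if r = s then cj s x else 0)"
          using pq[of r s] w0[of r] s by (cases "r = s") simp_all
      qed
      also have "\<dots> = cj s x" using s by simp
      also have "\<dots> = poly (of_rat_poly b) s" 
        using cj_rpoly[OF s, of b] by (simp only: b(1) rpoly_def)
      finally show "poly (of_rat_poly b) s = poly (\<Sum>r\<in>R. Polynomial.smult (cj r x * inverse (w r)) (q r)) s" ..
    qed (simp add: b(2))
    then have "of_nat E * coeff (of_rat_poly b) i = (\<Sum>r\<in>R. cj r x * u r i)" for i
      by (simp add: coeff_sum u_def sum_distrib_left mult.assoc mult.left_commute[of "of_nat E"])
    then have co: "of_rat (of_nat E * coeff b i) = (\<Sum>r\<in>R. cj r x * u r i)" for i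
      by (simp add: coeff_map_poly of_rat_mult)
    have "\<exists>k :: int. of_nat E * coeff b i = of_int k" for i
    proof -
      have "algebraic_int (of_rat (of_nat E * coeff b i) :: 'a)"
        unfolding co using u x by (intro algebraic_int_sum algebraic_int_mult) (auto intro: OM_algebraic_int[OF OM_cj])
      then show ?thesis using algebraic_int_rat_is_int by blast
    qed
    then obtain c :: "nat \<Rightarrow> int" where c: "\<And>i. of_nat E * coeff b i = of_int (c i)" by metis
    have "of_nat E * x = (\<Sum>i<n. of_rat (of_nat E * coeff b i) * \<alpha> ^ i)"
      unfolding b(1) rpoly_altdef'[OF b(2)] by (simp add: sum_distrib_left of_rat_mult mult.assoc)
    then have "of_nat E * x = (\<Sum>i<n. of_int (c i) * \<alpha> ^ i)" by (simp add: c)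
    moreover have "int p dvd c i" if p: "prime p" and "\<forall>r\<in>R. cj r x \<in> \<PP> p" for p i
    proof -
      have "(of_int (c i) :: 'a) = (\<Sum>r\<in>R. cj r x * u r i)" using co[of i] by (simp add: c)
      also have "\<dots> \<in> \<PP> p" using that u by (intro PP_sum[OF p] PP_mult_right[OF p]) auto
      finally show ?thesis using PP_of_int_iff[OF p] by blast
    qed
    ultimately show ?thesis by blast
  qed
  then have "is_denominator E" unfolding is_denominator_def using \<open>E > 0\<close> by blast
  then show ?thesis ..
qed

definition E :: nat where
  "E = (SOME E. is_denominator E)"

lemma is_denominator_E: "is_denominator E"
  unfolding E_def by (rule someI_ex[OF ex_denominator])

lemma E_pos: "E > 0"
  using is_denominator_E unfolding is_denominator_def by (rule conjunct1)

lemma E_lattice: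
  "x \<in> OM \<Longrightarrow> \<exists>c :: nat \<Rightarrow> int. of_nat E * x = (\<Sum>i<n. of_int (c i) * \<alpha> ^ i) \<and>
       (\<forall>p. prime p \<longrightarrow> (\<forall>r\<in>R. cj r x \<in> \<PP> p) \<longrightarrow> (\<forall>i<n. int p dvd c i))"
  using is_denominator_E unfolding is_denominator_def by (elim conjE) (rule bspec)

lemma E_poly:
  assumes "x \<in> OM"
  obtains q :: "int poly" where "of_nat E * x = poly (of_int_poly q) \<alpha>"
    "\<And>r. r \<in> R \<Longrightarrow> of_nat E * cj r x = poly (of_int_poly q) r"
proof -
  obtain c :: "nat \<Rightarrow> int" where c: "of_nat E * x = (\<Sum>i<n. of_int (c i) * \<alpha> ^ i)"
    using E_lattice[OF assms] by blast
  define q where "q = (\<Sum>i<n. monom (c i) i)"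
  have eq: "poly (of_int_poly q) y = rpoly (of_int_poly q) y" for y :: 'a
    by (simp add: rpoly_def map_poly_map_poly o_def)
  have 1: "of_nat E * x = rpoly (of_int_poly q) \<alpha>"
    unfolding eq[symmetric] c by (simp add: q_def of_int_poly_hom.hom_sum poly_sum poly_monom)
  have "of_nat E * cj r x = rpoly (of_int_poly q) r" if "r \<in> R" for r
    using arg_cong[OF 1, of "cj r"] that assms by (simp add: cj_rpoly cj_mult cj_of_nat OM_M)
  then show ?thesis using that[of q] 1 by (simp add: eq)
qed

text \<open>Unramifiedness of p: the second clause of \<open>is_denominator\<close> gives that p
  divides E x, and E is prime to p.\<close>

lemma p_dvd_if_all_conjugates_in_PP:
  assumes p: "prime p" "\<not> p dvd E" and x: "x \<in> OM" "\<And>r. r \<in> R \<Longrightarrow> cj r x \<in> \<PP> p"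
  shows "algebraic_int (x / of_nat p)"
proof -
  obtain c :: "nat \<Rightarrow> int" where c: "of_nat E * x = (\<Sum>i<n. of_int (c i) * \<alpha> ^ i)"
    "\<forall>i<n. int p dvd c i" using E_lattice[OF x(1)] p(1) x(2) by blast
  define k where "k i = c i div int p" for i
  have k: "c i = int p * k i" if "i < n" for i using c(2) that by (simp add: k_def)
  have "of_nat E * x / of_nat p = (\<Sum>i<n. of_int (k i) * \<alpha> ^ i)"
    using prime_gt_0_nat[OF p(1)] by (simp add: c(1) sum_divide_distrib k)
  then have "algebraic_int (of_nat E * x / of_nat p)" using int by auto
  then show ?thesis using algebraic_int_div_coprime[OF p OM_algebraic_int[OF x(1)]] by blast
qed

section \<open>Primes above an unramified p\<close>

lemma cj_funpow_periodic:
  assumes t: "t \<in> R"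
  obtains k where "k > 0" "\<And>x. x \<in> M \<Longrightarrow> (cj t ^^ k) x = x"
proof -
  define f where "f i = (cj t ^^ i) \<alpha>" for i
  have fR: "f i \<in> R" for i by (induction i) (auto simp: f_def cj_R t)
  have "\<not> inj f"
  proof
    assume "inj f"
    moreover have "finite (range f)" using fR by (intro finite_subset[OF _ finite_R]) auto
    ultimately show False using finite_imageD by blast
  qed
  then obtain i j where ij: "f i = f j" "i \<noteq> j" by (auto simp: inj_def)
  define a k where "a = min i j" and "k = max i j - min i j"
  have ik: "f (a + k) = f a" "k > 0" using ij by (auto simp: a_def k_def min_def max_def)
  have "f k = f 0"
    using ik(1)
  proof (induction a)
    case (Suc i)
    have "cj t (f (i + k)) = cj t (f i)" using Suc.prems by (simp add: f_def)
    then have "f (i + k) = f i" using cj_inj[OF t] fR R_M by blast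
    then show ?case by (rule Suc.IH)
  qed simp
  then have fk: "(cj t ^^ k) \<alpha> = \<alpha>" by (simp add: f_def)
  have "(cj t ^^ i) (rpoly b \<alpha>) = rpoly b (f i)" for i b
  proof (induction i)
    case (Suc i)
    then show ?case using cj_rpoly'[OF t R_M[OF fR[of i]], of b] by (simp add: f_def)
  qed (simp add: f_def)
  then have "(cj t ^^ k) x = x" if "x \<in> M" for x
    using that fk by (auto simp: f_def elim!: simple_extE)
  then show ?thesis using that ik(2) by blast
qed

text \<open>This replaces the incomparability of distinct primes above p. If there were no such e,
  then \<open>cj t\<close> would map the complement of \<open>\<PP> p\<close> to itself, and the
  iterates starting with \<open>cj t x\<close> would avoid \<open>\<PP> p\<close>; but
  \<open>cj t\<close> has finite order, so they return to x.\<close>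

lemma PP_stable_or_unit:
  assumes p: "prime p" and t: "t \<in> R" and x: "x \<in> OM" "x \<in> \<PP> p" "cj t x \<notin> \<PP> p"
  shows "\<exists>e\<in>OM. e \<notin> \<PP> p \<and> cj t e \<in> \<PP> p"
proof (rule ccontr)
  assume no: "\<not> ?thesis"
  obtain k where k: "k > 0" "\<And>x. x \<in> M \<Longrightarrow> (cj t ^^ k) x = x" using cj_funpow_periodic[OF t] by blast
  have OM: "(cj t ^^ i) x \<in> OM" for i by (induction i) (auto intro: OM_cj t x)
  have "(cj t ^^ Suc i) x \<notin> \<PP> p" for i
  proof (induction i)
    case (Suc i)
    then show ?case using no OM[of "Suc i"] by auto
  qed (use x in auto)
  then have "(cj t ^^ k) x \<notin> \<PP> p" using k(1) by (cases k) auto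
  then show False using k(2) x OM_M by auto
qed

text \<open>Locally the prime is generated by p: e lies outside \<open>\<PP> p\<close> but in all
  other primes above p, so for x in \<open>\<PP> p\<close> the product e x lies in every prime above
  p and is divisible by p.\<close>

lemma ex_local_unit:
  assumes p: "prime p" "\<not> p dvd E"
  obtains e where "algebraic_int e" "e \<notin> \<PP> p" "\<And>x. x \<in> OM \<Longrightarrow> x \<in> \<PP> p \<Longrightarrow> algebraic_int (e * x / of_nat p)"
proof -
  \<comment> \<open>The decomposition group: the automorphisms that map the prime of M into
    itself.\<close>
  define D where "D = {t\<in>R. \<forall>x\<in>OM. x \<in> \<PP> p \<longrightarrow> cj t x \<in> \<PP> p}"
  have "\<forall>t\<in>R - D. \<exists>e\<in>OM. e \<notin> \<PP> p \<and> cj t e \<in> \<PP> p"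
    using PP_stable_or_unit[OF p(1)] by (auto simp: D_def)
  then obtain f where f: "\<And>t. t \<in> R - D \<Longrightarrow> f t \<in> OM \<and> f t \<notin> \<PP> p \<and> cj t (f t) \<in> \<PP> p"
    by metis
  define e where "e = (\<Prod>t\<in>R - D. f t)"
  have e: "e \<in> OM" using f by (auto simp: e_def intro: OM_prod)
  have "e \<notin> \<PP> p"
    using PP_prod[OF p(1), of "R - D" f] f by (auto simp: e_def intro: OM_algebraic_int)
  moreover have "algebraic_int (e * x / of_nat p)" if x: "x \<in> OM" "x \<in> \<PP> p" for x
  proof (rule p_dvd_if_all_conjugates_in_PP[OF p])
    show "e * x \<in> OM" using e x by (intro OM_mult)
    fix t assume t: "t \<in> R"
    have cj: "cj t (e * x) = cj t e * cj t x" using t e x by (intro cj_mult OM_M)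
    show "cj t (e * x) \<in> \<PP> p"
    proof (cases "t \<in> D")
      case True
      then have "cj t x \<in> \<PP> p" using x by (auto simp: D_def)
      then show ?thesis unfolding cj using e t by (intro PP_mult_left[OF p(1)] OM_algebraic_int OM_cj)
    next
      case False
      then have "e = f t * (\<Prod>t\<in>R - D - {t}. f t)" using t by (simp add: e_def prod.remove)
      moreover have rest: "(\<Prod>t\<in>R - D - {t}. f t) \<in> OM" using f by (intro OM_prod) auto
      ultimately have "cj t e = cj t (f t) * cj t (\<Prod>t\<in>R - D - {t}. f t)"
        using f t False by (simp add: cj_mult OM_M)
      then have "cj t e \<in> \<PP> p"
        using f[of t] t False rest by (auto intro!: PP_mult_right[OF p(1)] OM_algebraic_int OM_cj)
      then show ?thesis unfolding cj using x t by (intro PP_mult_right[OF p(1)] OM_algebraic_int OM_cj)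
    qed
  qed
  ultimately show ?thesis using that e OM_algebraic_int by blast
qed

text \<open>Each conjugate in \<open>\<PP> p\<close> becomes divisible by p after multiplication by
  the local unit e. J consists of conjugates rather than primes, so a prime of residue degree f may
  count f times, as it does in the norm.\<close>

lemma prime_power_dvd_nrm:
  assumes p: "prime p" "\<not> p dvd E" and x: "x \<in> OM" and J: "J \<subseteq> R" "\<And>s. s \<in> J \<Longrightarrow> cj s x \<in> \<PP> p"
  shows "int p ^ card J dvd nrm x"
proof -
  obtain e where e: "algebraic_int e" "e \<notin> \<PP> p" 
    "\<And>x. x \<in> OM \<Longrightarrow> x \<in> \<PP> p \<Longrightarrow> algebraic_int (e * x / of_nat p)" using ex_local_unit[OF p] by blast
  have "(\<Prod>r\<in>R. cj r x) = (\<Prod>r\<in>R - J. cj r x) * (\<Prod>r\<in>J. cj r x)"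
    using J(1) by (intro prod.subset_diff) auto
  then have "e ^ card J * of_int (nrm x) / of_nat p ^ card J =
      (\<Prod>r\<in>J. e * cj r x / of_nat p) * (\<Prod>r\<in>R - J. cj r x)"
    by (simp add: nrm[OF x, symmetric] prod_dividef prod.distrib)
  moreover have "algebraic_int \<dots>"
    using x J e(3) by (intro algebraic_int_mult algebraic_int_prod) (auto intro: OM_algebraic_int OM_cj)
  ultimately have "algebraic_int (e ^ card J * of_int (nrm x) / of_nat p ^ card J)" by simp
  then show ?thesis
    using e PP_power[OF p(1) e(1)] by (intro prime_power_dvd_if_PP_unit_mult[OF p(1)]) auto
qed

section \<open>Frobenius elements and complete splitting\<close>

lemma ex_int_minpoly: 
  obtains G :: "int poly" where "of_rat_poly g = (of_int_poly G :: 'a poly)"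
proof -
  have "\<exists>k :: int. coeff g i = of_int k" for i
  proof -
    have "algebraic_int (coeff (of_rat_poly g :: 'a poly) i)"
      unfolding minpoly_factorization(1)[OF minpoly]
      by (rule algebraic_int_coeff_prod_linear[OF finite_R OM_algebraic_int[OF OM_R]])
    then have "algebraic_int (of_rat (coeff g i) :: 'a)"
      by (simp only: coeff_map_poly of_rat_0)
    then obtain k where "coeff g i = of_int k" by (rule algebraic_int_rat_is_int)
    then show ?thesis ..
  qed
  then obtain k :: "nat \<Rightarrow> int" where k: "\<And>i. coeff g i = of_int (k i)" by metis
  define G where "G = (\<Sum>i\<le>n. monom (k i) i)"
  have kz: "k i = 0" if "i > n" for i using k[of i] that by (simp add: coeff_eq_0)
  have "coeff G i = k i" for i
    by (cases "i \<le> n") (auto simp: G_def coeff_sum kz)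
  then have "of_rat_poly g = (of_int_poly G :: 'a poly)"
    by (intro poly_eqI) (simp add: coeff_map_poly k)
  then show ?thesis by (rule that)
qed

lemma E_notin_PP:
  assumes "prime p" "\<not> p dvd E"
  shows "(of_nat E :: 'a) \<notin> \<PP> p"
  using PP_of_int_iff[OF assms(1), of "int E", where ?'a = 'a] assms(2) by simp

text \<open>Modulo p, g(\<alpha>^p) is congruent to g(\<alpha>)^p = 0, so \<alpha>^p is congruent to
  a conjugate s modulo \<open>\<PP> p\<close>. The congruence passes to Z[\<alpha>], and from there
  to OM because E is prime to p.\<close>

lemma ex_frobenius:
  assumes p: "prime p" "\<not> p dvd E"
  obtains s where "s \<in> R" "\<alpha> ^ p - s \<in> \<PP> p" "\<And>x. x \<in> OM \<Longrightarrow> x ^ p - cj s x \<in> \<PP> p"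
proof -
  obtain G :: "int poly" where G: "of_rat_poly g = (of_int_poly G :: 'a poly)" using ex_int_minpoly .
  have G0: "poly (of_int_poly G) \<alpha> = 0" using root_\<alpha> G by (simp add: rpoly_def)
  have "algebraic_int ((0 ^ p - poly (of_int_poly G) (\<alpha> ^ p)) / of_nat p)"
    using algebraic_int_poly_frobenius[OF p(1) int, of G] by (simp add: G0)
  then have "- poly (of_int_poly G) (\<alpha> ^ p) \<in> \<PP> p"
    using prime_gt_0_nat[OF p(1)] by (intro PP_if_p_dvd[OF p(1)]) (simp add: zero_power)
  then have "poly (of_rat_poly g) (\<alpha> ^ p) \<in> \<PP> p"
    using PP_minus[OF p(1)] G by fastforce
  then have "(\<Prod>s\<in>R. \<alpha> ^ p - s) \<in> \<PP> p"
    by (simp add: minpoly_factorization(1)[OF minpoly] poly_prod)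
  then obtain s where s: "s \<in> R" "\<alpha> ^ p - s \<in> \<PP> p"
    using PP_prod[OF p(1), of R "\<lambda>s. \<alpha> ^ p - s"] int OM_R OM_algebraic_int by blast
  have s_int: "algebraic_int s" using s OM_R OM_algebraic_int by blast
  have "x ^ p - cj s x \<in> \<PP> p" if x: "x \<in> OM" for x
  proof -
    obtain q :: "int poly" where q: "of_nat E * x = poly (of_int_poly q) \<alpha>"
      "\<And>r. r \<in> R \<Longrightarrow> of_nat E * cj r x = poly (of_int_poly q) r" using E_poly[OF x] by blast
    have "(of_nat E * x) ^ p - poly (of_int_poly q) (\<alpha> ^ p) \<in> \<PP> p"
      unfolding q(1) by (rule PP_if_p_dvd[OF p(1) algebraic_int_poly_frobenius[OF p(1) int]])
    moreover have "poly (of_int_poly q) (\<alpha> ^ p) - of_nat E * cj s x \<in> \<PP> p"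
      unfolding q(2)[OF s(1)] using int s s_int by (intro PP_poly_cong[OF p(1)]) auto
    ultimately have 1: "(of_nat E * x) ^ p - of_nat E * cj s x \<in> \<PP> p"
      using PP_diff_trans[OF p(1)] by blast
    have "(of_nat E ^ p - of_nat E :: 'a) \<in> \<PP> p"
      using algebraic_int_fermat[OF p(1), of "int E"] by (intro PP_if_p_dvd[OF p(1)]) simp
    then have "(of_nat E ^ p - of_nat E) * x ^ p \<in> \<PP> p"
      using OM_algebraic_int[OF x] by (intro PP_mult_right[OF p(1)]) auto
    with 1 have "((of_nat E * x) ^ p - of_nat E * cj s x) - (of_nat E ^ p - of_nat E) * x ^ p \<in> \<PP> p"
      by (rule PP_diff[OF p(1)])
    also have "((of_nat E * x) ^ p - of_nat E * cj s x) - (of_nat E ^ p - of_nat E) * x ^ p =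
        of_nat E * (x ^ p - cj s x)"
      by (simp add: algebra_simps power_mult_distrib)
    finally show ?thesis
      using PP_prime[OF p(1), of "of_nat E" "x ^ p - cj s x"] E_notin_PP[OF p]
        OM_algebraic_int[OF x] OM_algebraic_int[OF OM_cj[OF s(1) x]] by auto
  qed
  then show ?thesis using that s by blast
qed

text \<open>For \<open>p\<close> not dividing \<open>E\<close> this says that \<open>p\<close> splits completely in \<open>M\<close>.\<close>

definition split :: "nat \<Rightarrow> bool" where
  "split p \<longleftrightarrow> algebraic_int ((\<alpha> ^ p - \<alpha>) / of_nat p)"

text \<open>One place decides for all: \<alpha> is congruent to an integer modulo
  \<open>\<PP> p\<close>, hence so is E r for every conjugate r, being an integer polynomial in
  \<alpha>. So all conjugates of \<alpha>^p - \<alpha> lie in \<open>\<PP> p\<close>, and p is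
  unramified.\<close>

lemma split_if_frobenius_trivial:
  assumes p: "prime p" "\<not> p dvd E" and fixed: "\<alpha> ^ p - \<alpha> \<in> \<PP> p"
  shows "split p"
  unfolding split_def
proof (rule p_dvd_if_all_conjugates_in_PP[OF p])
  show "\<alpha> ^ p - \<alpha> \<in> OM" by (intro OM_diff OM_power OM_\<alpha>)
  obtain k where k: "\<alpha> - of_nat k \<in> \<PP> p"
    using PP_residue_if_frobenius_fixed[OF p(1) int fixed] by blast
  fix r assume r: "r \<in> R"
  have r_int: "algebraic_int r" using r OM_R OM_algebraic_int by blast
  obtain q :: "int poly" where q: "of_nat E * r = poly (of_int_poly q) \<alpha>"
    using E_poly[OF OM_R[OF r]] by blast
  have "poly (of_int_poly q) \<alpha> - poly (of_int_poly q) (of_int (int k)) \<in> \<PP> p"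
    using k int by (intro PP_poly_cong[OF p(1)]) auto
  then have 1: "of_nat E * r - of_int (poly q (int k)) \<in> \<PP> p"
    unfolding q of_int_hom.poly_map_poly .
  define z where "z = poly q (int k)"
  have fermat: "(of_int a ^ p - of_int a :: 'a) \<in> \<PP> p" for a
    by (rule PP_if_p_dvd[OF p(1) algebraic_int_fermat[OF p(1)]])
  have pow: "(of_nat E * r) ^ p - (of_int z) ^ p \<in> \<PP> p"
    using PP_poly_cong[OF p(1) _ _ 1[folded z_def], of "monom 1 p"]
      algebraic_int_mult[OF algebraic_int_of_nat r_int] by (simp add: poly_monom)
  then have "(of_nat E * r) ^ p - of_int z \<in> \<PP> p" using fermat[of z] PP_diff_trans[OF p(1)] by blast
  then have 2: "(of_nat E * r) ^ p - of_nat E * r \<in> \<PP> p"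
    using PP_diff_commute[OF p(1) 1[folded z_def]] PP_diff_trans[OF p(1)] by blast
  have "(of_nat E ^ p - of_nat E) * r ^ p \<in> \<PP> p"
    using fermat[of "int E"] r_int by (intro PP_mult_right[OF p(1)]) auto
  with 2 have "((of_nat E * r) ^ p - of_nat E * r) - (of_nat E ^ p - of_nat E) * r ^ p \<in> \<PP> p"
    by (rule PP_diff[OF p(1)])
  also have "((of_nat E * r) ^ p - of_nat E * r) - (of_nat E ^ p - of_nat E) * r ^ p =
      of_nat E * (r ^ p - r)"
    by (simp add: algebra_simps power_mult_distrib)
  finally have "r ^ p - r \<in> \<PP> p"
    using PP_prime[OF p(1), of "of_nat E" "r ^ p - r"] E_notin_PP[OF p] r_int by auto
  then show "cj r (\<alpha> ^ p - \<alpha>) \<in> \<PP> p"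
    using r by (simp add: cj_diff cj_power cj_\<alpha> simple_ext_power)
qed

lemma split_imp_frobenius_trivial:
  assumes p: "prime p" "\<not> p dvd E" "split p" and x: "x \<in> OM"
  shows "algebraic_int ((x ^ p - x) / of_nat p)"
proof (rule algebraic_int_div_coprime[OF p(1,2)])
  show "algebraic_int (x ^ p - x)" using OM_algebraic_int[OF x] by auto
  obtain q :: "int poly" where q: "of_nat E * x = poly (of_int_poly q) \<alpha>" using E_poly[OF x] by blast
  \<comment> \<open>The last term corrects for (E x)^p, which carries E^p in place of E.\<close>
  have "of_nat E * (x ^ p - x) / of_nat p =
     (poly (of_int_poly q) \<alpha> ^ p - poly (of_int_poly q) (\<alpha> ^ p)) / of_nat p +
     (poly (of_int_poly q) (\<alpha> ^ p) - poly (of_int_poly q) \<alpha>) / of_nat p -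
     x ^ p * ((of_int (int E) ^ p - of_int (int E)) / of_nat p)"
    unfolding q[symmetric]
    by (simp add: add_divide_distrib diff_divide_distrib algebra_simps power_mult_distrib)
  moreover have "algebraic_int \<dots>"
    using p(3) int OM_algebraic_int[OF x] unfolding split_def
    by (intro algebraic_int_add algebraic_int_diff algebraic_int_mult algebraic_int_power
        algebraic_int_poly_frobenius[OF p(1)] algebraic_int_fermat[OF p(1)] algebraic_int_poly_cong)
  ultimately show "algebraic_int (of_nat E * (x ^ p - x) / of_nat p)" by simp
qed

text \<open>For split p each label r gives a residue map from OM onto p classes; this makes (p, r) a
  prime of norm p and feeds the pigeonhole argument.\<close>

lemma split_residue:
  assumes p: "prime p" "\<not> p dvd E" "split p" and x: "x \<in> OM" and r: "r \<in> R"
  obtains k where "k < p" "cj r x - of_nat k \<in> \<PP> p"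
proof -
  have "algebraic_int ((cj r x ^ p - cj r x) / of_nat p)"
    by (rule split_imp_frobenius_trivial[OF p OM_cj[OF r x]])
  then have "cj r x ^ p - cj r x \<in> \<PP> p" by (rule PP_if_p_dvd[OF p(1)])
  then show ?thesis
    using PP_residue_if_frobenius_fixed[OF p(1) OM_algebraic_int[OF OM_cj[OF r x]]] that by blast
qed

text \<open>If \<open>p\<close> does not split completely, its Frobenius moves the prime factors of \<open>x\<close> in pairs.\<close>

lemma nonsplit_square_dvd_nrm:
  assumes p: "prime p" "\<not> p dvd E" "\<not> split p" and x: "x \<in> OM" "int p dvd nrm x"
  shows "int p ^ 2 dvd nrm x"
proof -
  obtain s where s: "s \<in> R" "\<alpha> ^ p - s \<in> \<PP> p" "\<And>x. x \<in> OM \<Longrightarrow> x ^ p - cj s x \<in> \<PP> p"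
    using ex_frobenius[OF p(1,2)] by blast
  have "s \<noteq> \<alpha>" using split_if_frobenius_trivial p s(2) by blast
  obtain r where r: "r \<in> R" "cj r x \<in> \<PP> p" using x dvd_nrm_iff[OF p(1)] by blast
  \<comment> \<open>\<alpha> is a polynomial in r, so an automorphism fixing r fixes \<alpha>,
    whereas this one moves \<alpha> to s.\<close>
  have "cj s r \<noteq> r"
  proof
    assume eq: "cj s r = r"
    obtain t where t: "t \<in> R" "cj r t = \<alpha>"
      using cj_bij[OF r(1)] \<alpha>_R unfolding bij_betw_def by (metis imageE)
    obtain b where b: "t = rpoly b \<alpha>" using R_M[OF t(1)] by (rule simple_extE)
    have "\<alpha> = rpoly b r" using t b r cj_rpoly by simp
    then have "cj s \<alpha> = \<alpha>" using cj_rpoly'[OF s(1) R_M[OF r(1)], of b] eq by simp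
    then show False using cj_\<alpha>[OF s(1)] \<open>s \<noteq> \<alpha>\<close> by simp
  qed
  have "cj r x ^ p \<in> \<PP> p"
    using PP_mult_right[OF p(1) r(2), of "cj r x ^ (p - 1)"] prime_gt_0_nat[OF p(1)] OM_algebraic_int[OF OM_cj[OF r(1) x(1)]]
    by (metis algebraic_int_power power_eq_if less_irrefl)
  then have "cj s (cj r x) \<in> \<PP> p"
    using PP_diff_mem_iff[OF p(1) s(3)[OF OM_cj[OF r(1) x(1)]]] by blast
  then have "cj (cj s r) x \<in> \<PP> p" using cj_comp[OF s(1) r(1) OM_M[OF x(1)]] by simp
  then have "int p ^ card {r, cj s r} dvd nrm x"
    using r s by (intro prime_power_dvd_nrm[OF p(1,2) x(1)]) (auto intro: cj_R)
  then show ?thesis using \<open>cj s r \<noteq> r\<close> by (simp add: power2_eq_square)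
qed

text \<open>The elements whose norm is divisible by \<open>p\<^sup>2\<close> are covered by the \<open>n\<^sup>2\<close> additive groups
  \<open>square_class p r s\<close>; for \<open>r = s\<close> it is the contracted square of the prime ideal \<open>cj r\<inverse> \<PP>\<close>.\<close>

definition square_class :: "nat \<Rightarrow> 'a \<Rightarrow> 'a \<Rightarrow> 'a set" where
  "square_class p r s = {x \<in> OM. if r = s
     then \<exists>e. algebraic_int e \<and> e \<notin> \<PP> p \<and> algebraic_int (e * cj r x / of_nat p ^ 2)
     else cj r x \<in> \<PP> p \<and> cj s x \<in> \<PP> p}"

text \<open>Closure under differences is what the packing argument needs. For r = s the two
  multipliers are multiplied, which by primality keeps them outside \<open>\<PP> p\<close>.\<close>

lemma square_class_diff:
  assumes p: "prime p" and rs: "r \<in> R" "s \<in> R" and x: "x \<in> square_class p r s" and y: "y \<in> square_class p r s"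
  shows "x - y \<in> square_class p r s"
proof (cases "r = s")
  case True
  then obtain e f where e: "algebraic_int e" "e \<notin> \<PP> p" "algebraic_int (e * cj r x / of_nat p ^ 2)"
    and f: "algebraic_int f" "f \<notin> \<PP> p" "algebraic_int (f * cj r y / of_nat p ^ 2)"
    and OM: "x \<in> OM" "y \<in> OM"
    using x y by (auto simp: square_class_def)
  have "e * f \<notin> \<PP> p" using PP_prime[OF p] e f by blast
  moreover have "algebraic_int (e * f * cj r (x - y) / of_nat p ^ 2)"
  proof -
    have "e * f * cj r (x - y) / of_nat p ^ 2 =
        f * (e * cj r x / of_nat p ^ 2) - e * (f * cj r y / of_nat p ^ 2)"
      using OM rs by (simp add: cj_diff OM_M algebra_simps diff_divide_distrib)
    also have "algebraic_int \<dots>" by (intro algebraic_int_diff algebraic_int_mult e f)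
    finally show ?thesis .
  qed
  ultimately show ?thesis
    using True e f OM OM_diff by (auto simp: square_class_def intro!: exI[of _ "e * f"])
next
  case False
  then show ?thesis using x y rs
    by (auto simp: square_class_def cj_diff OM_M OM_diff intro: PP_diff[OF p])
qed

lemma square_dvd_nrm_if_square_class:
  assumes p: "prime p" "\<not> p dvd E" and rs: "r \<in> R" "s \<in> R" and x: "x \<in> square_class p r s"
  shows "int p ^ 2 dvd nrm x"
proof (cases "r = s")
  case True
  then obtain e where e: "algebraic_int e" "e \<notin> \<PP> p" "algebraic_int (e * cj r x / of_nat p ^ 2)"
    and OM: "x \<in> OM" using x by (auto simp: square_class_def)
  have "(\<Prod>r\<in>R. cj r x) = cj r x * (\<Prod>r\<in>R - {r}. cj r x)"
    using rs by (simp add: prod.remove)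
  then have "e * of_int (nrm x) / of_nat p ^ 2 = (e * cj r x / of_nat p ^ 2) * (\<Prod>r\<in>R - {r}. cj r x)"
    unfolding nrm[OF OM, symmetric] by simp
  also have "algebraic_int \<dots>"
    using e OM by (intro algebraic_int_mult algebraic_int_prod) (auto intro: OM_algebraic_int OM_cj)
  finally show ?thesis
    by (rule prime_power_dvd_if_PP_unit_mult[OF p(1) e(1,2)])
next
  case False
  then have "int p ^ card {r, s} dvd nrm x"
    using x rs by (intro prime_power_dvd_nrm[OF p]) (auto simp: square_class_def)
  then show ?thesis using False by (simp add: power2_eq_square)
qed

text \<open>If only one conjugate of x lies in \<open>\<PP> p\<close>, the product of the other
  conjugates serves as multiplier e, and e times that conjugate is the norm.\<close>

lemma square_class_covers:
  assumes p: "prime p" and x: "x \<in> OM" "int p ^ 2 dvd nrm x"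
  obtains r s where "r \<in> R" "s \<in> R" "x \<in> square_class p r s"
proof -
  have "int p dvd nrm x" using x(2) by (auto simp: power2_eq_square intro: dvd_mult_left)
  then obtain r where r: "r \<in> R" "cj r x \<in> \<PP> p" using dvd_nrm_iff[OF p x(1)] by blast
  show ?thesis
  proof (cases "\<exists>s\<in>R - {r}. cj s x \<in> \<PP> p")
    case True
    then obtain s where "s \<in> R" "s \<noteq> r" "cj s x \<in> \<PP> p" by blast
    then show ?thesis using that[of r s] r x by (auto simp: square_class_def)
  next
    case False
    define e where "e = (\<Prod>s\<in>R - {r}. cj s x)"
    have int_e: "algebraic_int e"
      using x by (auto simp: e_def intro!: OM_algebraic_int OM_prod OM_cj)
    have "e \<notin> \<PP> p"
      using PP_prod[OF p, of "R - {r}" "\<lambda>s. cj s x"] False x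
      by (auto simp: e_def intro: OM_algebraic_int OM_cj)
    moreover have "e * cj r x = of_int (nrm x)"
      using r by (simp add: nrm[OF x(1), symmetric] e_def prod.remove mult.commute)
    moreover obtain k where "nrm x = int p ^ 2 * k" using x(2) by blast
    ultimately have "e * cj r x / of_nat p ^ 2 = of_int k"
      using prime_gt_0_nat[OF p] by simp
    then have "x \<in> square_class p r r"
      using \<open>e \<notin> \<PP> p\<close> int_e x by (auto simp: square_class_def intro!: exI[of _ e])
    then show ?thesis using that r by blast
  qed
qed

end

section \<open>Counting sets of split primes: the upper bound\<close>

text \<open>The norm of the product of the primes named by T, when all p in T split and so each
  prime has norm p.\<close>

definition weight :: "(nat \<times> 'b) set \<Rightarrow> nat" where
  "weight T = (\<Prod>t\<in>T. fst t)"

text \<open>Labels are of arbitrary type because the final comparison copies the labels of one field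
  into those of another.\<close>

definition weighted_sets :: "nat set \<Rightarrow> 'b set \<Rightarrow> real \<Rightarrow> (nat \<times> 'b) set set" where
  "weighted_sets S I x = {T. finite T \<and> T \<subseteq> S \<times> I \<and> real (weight T) \<le> x}"

lemma weight_pos: "finite T \<Longrightarrow> T \<subseteq> S \<times> I \<Longrightarrow> (\<And>p. p \<in> S \<Longrightarrow> p > 0) \<Longrightarrow> weight T > 0"
  unfolding weight_def by (intro prod_pos) auto

lemma fst_le_weight:
  assumes "finite T" "T \<subseteq> S \<times> I" "\<And>p. p \<in> S \<Longrightarrow> p > 0" "t \<in> T"
  shows "fst t \<le> weight T"
proof -
  have "fst t dvd weight T" unfolding weight_def by (rule dvd_prodI[OF assms(1,4)])
  then show ?thesis using weight_pos[OF assms(1-3)] by (intro dvd_imp_le) auto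
qed

lemma finite_weighted_sets:
  assumes "finite I" "\<And>p. p \<in> S \<Longrightarrow> p > 0"
  shows "finite (weighted_sets S I x)"
proof (rule finite_subset)
  show "weighted_sets S I x \<subseteq> Pow ({..nat \<lfloor>x\<rfloor>} \<times> I)"
  proof
    fix T assume T: "T \<in> weighted_sets S I x"
    have "fst t \<le> nat \<lfloor>x\<rfloor>" if "t \<in> T" for t
    proof -
      have "fst t \<le> weight T"
        using T fst_le_weight[OF _ _ assms(2) that, of S I] by (auto simp: weighted_sets_def)
      then have "real (fst t) \<le> x" using T by (simp add: weighted_sets_def)
      then show ?thesis by (simp add: le_nat_floor)
    qed
    then show "T \<in> Pow ({..nat \<lfloor>x\<rfloor>} \<times> I)" using T by (fastforce simp: weighted_sets_def)
  qed
qed (use assms in auto)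

lemma less_Suc_nth_root_nat_power: "k > 0 \<Longrightarrow> m < (nth_root_nat k m + 1) ^ k"
  using nth_root_nat_ge[of k "nth_root_nat k m + 1" m] by fastforce

lemma prod_dvd_if_coprime_factors:
  fixes f :: "'b \<Rightarrow> int"
  assumes "finite P" "\<And>p. p \<in> P \<Longrightarrow> f p dvd N" "\<And>p q. p \<in> P \<Longrightarrow> q \<in> P \<Longrightarrow> p \<noteq> q \<Longrightarrow> coprime (f p) (f q)"
  shows "(\<Prod>p\<in>P. f p) dvd N"
  using assms
proof (induction P rule: finite_induct)
  case (insert p P)
  have "coprime (f p) (\<Prod>q\<in>P. f q)"
    using insert by (intro prod_coprime_right) auto
  then show ?case using insert by (auto intro!: divides_mult)
qed auto

text \<open>v behaves like the modulus of one complex embedding of M. One embedding suffices, as the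
  others arise by composing it with \<open>cj r\<close>.\<close>

locale galois_abs = galois_gen +
  fixes v :: "'a \<Rightarrow> real"
  assumes v_mult: "x \<in> simple_ext \<alpha> \<Longrightarrow> y \<in> simple_ext \<alpha> \<Longrightarrow> v (x * y) = v x * v y"
    and v_add: "x \<in> simple_ext \<alpha> \<Longrightarrow> y \<in> simple_ext \<alpha> \<Longrightarrow> v (x + y) \<le> v x + v y"
    and v_of_int: "v (of_int k) = \<bar>real_of_int k\<bar>"
begin

lemma v_nonneg:
  assumes "x \<in> M"
  shows "v x \<ge> 0"
proof -
  have "v (- 1 * x) = v x"
    using v_mult[of "of_int (-1)" x] v_of_int[of "-1"] assms by (simp add: simple_ext_minus)
  then have "v (x + - 1 * x) \<le> v x + v x"
    using v_add[OF assms simple_ext_minus[OF assms]] by simp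
  then show ?thesis using v_of_int[of 0] by simp
qed

lemma v_sum: "(\<And>i. i \<in> A \<Longrightarrow> f i \<in> M) \<Longrightarrow> v (sum f A) \<le> (\<Sum>i\<in>A. v (f i))"
proof (induction A rule: infinite_finite_induct)
  case (insert i A)
  have "v (f i + sum f A) \<le> v (f i) + v (sum f A)"
    using insert by (intro v_add simple_ext_sum) auto
  then show ?case using insert by auto
qed (use v_of_int[of 0] in auto)

lemma v_prod: "(\<And>i. i \<in> A \<Longrightarrow> f i \<in> M) \<Longrightarrow> v (prod f A) = (\<Prod>i\<in>A. v (f i))"
  by (induction A rule: infinite_finite_induct)
     (use v_of_int[of 1] in \<open>auto simp: v_mult simple_ext_prod\<close>)

section \<open>Sizes of lattice points\<close>

definition lat :: "(nat \<Rightarrow> int) \<Rightarrow> 'a" where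
  "lat c = (\<Sum>i<n. of_int (c i) * \<alpha> ^ i)"

lemma lat_rpoly: "lat c = rpoly (\<Sum>i<n. monom (of_int (c i)) i) \<alpha>"
  by (simp add: lat_def)

lemma lat_OM: "lat c \<in> OM"
  unfolding lat_rpoly
  by (rule OM_I[OF simple_extI[OF refl]]) (use int in \<open>auto intro!: algebraic_int_sum algebraic_int_mult algebraic_int_power\<close>)

lemma cj_lat:
  assumes "r \<in> R"
  shows "cj r (lat c) = (\<Sum>i<n. of_int (c i) * r ^ i)"
  unfolding lat_rpoly cj_rpoly[OF assms] by simp

lemma lat_diff: "lat (\<lambda>i. c i - d i) = lat c - lat d"
  by (simp add: lat_def sum_subtractf algebra_simps)

lemma lat_cong: "(\<And>i. i < n \<Longrightarrow> c i = d i) \<Longrightarrow> lat c = lat d"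
  by (simp add: lat_def)

lemma lat_eq_0:
  assumes "lat c = 0" "i < n"
  shows "c i = 0"
proof -
  let ?q = "\<Sum>i<n. monom (rat_of_int (c i)) i"
  have "degree ?q < n"
    using n_pos by (intro degree_sum_less le_less_trans[OF degree_monom_le]) auto
  then have "?q = 0" using rpoly_eq_0_degree_less[OF irred root_\<alpha>] assms(1) lat_rpoly by metis
  then have "coeff ?q i = 0" by simp
  then show ?thesis using assms(2) by (simp add: coeff_sum)
qed

text \<open>Every conjugate of \<open>lat c\<close> has size at most C times the largest coordinate.
  The successor gives C \<ge> 1.\<close>

definition C :: nat where
  "C = Suc (nat \<lceil>\<Sum>r\<in>R. \<Sum>i<n. v (r ^ i)\<rceil>)"

lemma C_pos: "C \<ge> 1"
  by (simp add: C_def)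

lemma sum_v_powers_le_C:
  assumes r: "r \<in> R"
  shows "(\<Sum>i<n. v (r ^ i)) \<le> real C"
proof -
  have "(\<Sum>i<n. v (r ^ i)) \<le> (\<Sum>r\<in>R. \<Sum>i<n. v (r ^ i))"
    using r by (intro member_le_sum sum_nonneg v_nonneg simple_ext_power R_M) auto
  then show ?thesis unfolding C_def by linarith
qed

lemma v_cj_lat_le:
  assumes r: "r \<in> R" and c: "\<And>i. i < n \<Longrightarrow> \<bar>real_of_int (c i)\<bar> \<le> b"
  shows "v (cj r (lat c)) \<le> real C * b"
proof -
  have b: "b \<ge> 0" using c[OF n_pos] by linarith
  have rM: "r ^ i \<in> M" for i using r R_M simple_ext_power by blast
  have "v (cj r (lat c)) \<le> (\<Sum>i<n. v (of_int (c i) * r ^ i))"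
    unfolding cj_lat[OF r] by (intro v_sum simple_ext_mult rM simple_ext_of_int)
  also have "\<dots> = (\<Sum>i<n. \<bar>real_of_int (c i)\<bar> * v (r ^ i))"
    by (simp add: v_mult rM v_of_int)
  also have "\<dots> \<le> (\<Sum>i<n. b * v (r ^ i))"
    using c by (intro sum_mono mult_right_mono v_nonneg rM) auto
  also have "\<dots> = b * (\<Sum>i<n. v (r ^ i))" by (simp add: sum_distrib_left)
  also have "\<dots> \<le> b * C" using sum_v_powers_le_C[OF r] b by (rule mult_left_mono)
  finally show ?thesis by (simp add: mult.commute)
qed

lemma abs_nrm:
  assumes x: "x \<in> OM"
  shows "\<bar>real_of_int (nrm x)\<bar> = (\<Prod>r\<in>R. v (cj r x))"
proof -
  have "\<bar>real_of_int (nrm x)\<bar> = v (\<Prod>r\<in>R. cj r x)" by (simp add: nrm[OF x] v_of_int)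
  also have "\<dots> = (\<Prod>r\<in>R. v (cj r x))" using x by (intro v_prod cj_M OM_M)
  finally show ?thesis .
qed

lemma abs_nrm_le:
  assumes x: "x \<in> OM" and b: "\<And>r. r \<in> R \<Longrightarrow> v (cj r x) \<le> b"
  shows "\<bar>real_of_int (nrm x)\<bar> \<le> b ^ n"
proof -
  have "(\<Prod>r\<in>R. v (cj r x)) \<le> (\<Prod>r\<in>R. b)"
    using x b by (intro prod_mono) (auto intro: v_nonneg cj_M OM_M)
  then show ?thesis by (simp add: abs_nrm[OF x] card_R)
qed

lemma abs_nrm_ge:
  assumes x: "x \<in> OM" and b: "b \<ge> 0" "\<And>r. r \<in> R \<Longrightarrow> b \<le> v (cj r x)"
  shows "b ^ n \<le> \<bar>real_of_int (nrm x)\<bar>"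
proof -
  have "(\<Prod>r\<in>R. b) \<le> (\<Prod>r\<in>R. v (cj r x))"
    using x b by (intro prod_mono) auto
  then show ?thesis by (simp add: abs_nrm[OF x] card_R)
qed

text \<open>Cut the box into cells of side \<open>s\<close>: two points of a cell differ by an element of small norm.\<close>

lemma packing:
  assumes X: "X \<subseteq> {..<n} \<rightarrow>\<^sub>E {0..int L}" and s: "s \<ge> 1"
    and sep: "\<And>c d. c \<in> X \<Longrightarrow> d \<in> X \<Longrightarrow> c \<noteq> d \<Longrightarrow>
       real (C * (s - 1)) ^ n < \<bar>real_of_int (nrm (lat (\<lambda>i. c i - d i)))\<bar>"
  shows "card X \<le> (L div s + 1) ^ n"
proof -
  define f where "f c = (\<lambda>i\<in>{..<n}. c i div int s)" for c :: "nat \<Rightarrow> int"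
  have "inj_on f X"
  proof (rule inj_onI, rule ccontr)
    fix c d assume cd: "c \<in> X" "d \<in> X" "f c = f d" "c \<noteq> d"
    have "\<bar>real_of_int (c i - d i)\<bar> \<le> real (s - 1)" if i: "i < n" for i
    proof -
      have "c i div int s = d i div int s" using cd(3) i by (simp add: f_def restrict_def fun_eq_iff) (metis i)
      then have eq: "c i - d i = c i mod int s - d i mod int s"
        by (metis add_diff_cancel_left div_mult_mod_eq)
      have "0 \<le> c i mod int s" "c i mod int s < int s" "0 \<le> d i mod int s" "d i mod int s < int s"
        using s by simp_all
      then have "\<bar>c i - d i\<bar> \<le> int (s - 1)" using s unfolding eq by linarith
      then show ?thesis by linarith
    qed
    then have "v (cj r (lat (\<lambda>i. c i - d i))) \<le> real C * real (s - 1)" if "r \<in> R" for r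
      by (rule v_cj_lat_le[OF that]) (use \<open>\<And>i. i < n \<Longrightarrow> \<bar>real_of_int (c i - d i)\<bar> \<le> real (s - 1)\<close> in blast)
    then have "\<bar>real_of_int (nrm (lat (\<lambda>i. c i - d i)))\<bar> \<le> (real C * real (s - 1)) ^ n"
      by (intro abs_nrm_le lat_OM)
    then show False using sep[OF cd(1,2,4)] by simp
  qed
  moreover have "f ` X \<subseteq> {..<n} \<rightarrow>\<^sub>E {0..int (L div s)}"
  proof (rule image_subsetI)
    fix c assume "c \<in> X"
    then have "c i \<in> {0..int L}" if "i < n" for i using X that by (auto simp: PiE_iff)
    then have "c i div int s \<in> {0..int (L div s)}" if "i < n" for i
      using that s zdiv_mono1[of "c i" "int L" "int s"] by (simp add: zdiv_int pos_imp_zdiv_nonneg_iff)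
    then show "f c \<in> {..<n} \<rightarrow>\<^sub>E {0..int (L div s)}" by (auto simp: f_def)
  qed
  moreover have "finite ({..<n} \<rightarrow>\<^sub>E {0..int (L div s)})" by (intro finite_PiE) auto
  ultimately have "card X \<le> card ({..<n} \<rightarrow>\<^sub>E {0..int (L div s)})"
    by (metis card_image card_mono)
  also have "\<dots> = (L div s + 1) ^ n" by (simp add: card_PiE nat_add_distrib)
  finally show ?thesis .
qed

text \<open>Group T by primes: k labels at p force p^k into the norm, and powers of distinct primes
  are coprime.\<close>

lemma weight_dvd_nrm:
  assumes T: "finite T" "T \<subseteq> S \<times> R" and S: "\<And>p. p \<in> S \<Longrightarrow> prime p \<and> \<not> p dvd E"
    and x: "x \<in> OM" "\<And>p r. (p, r) \<in> T \<Longrightarrow> cj r x \<in> \<PP> p"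
  shows "int (weight T) dvd nrm x"
proof -
  define J where "J p = {r. (p, r) \<in> T}" for p
  have JR: "J p \<subseteq> R" for p using T by (auto simp: J_def)
  have "weight T = (\<Prod>p\<in>fst ` T. \<Prod>t\<in>{t\<in>T. fst t = p}. fst t)"
    unfolding weight_def by (rule prod.image_gen[OF T(1)])
  also have "\<dots> = (\<Prod>p\<in>fst ` T. p ^ card (J p))"
  proof (rule prod.cong[OF refl])
    fix p
    have "{t\<in>T. fst t = p} = Pair p ` J p" by (auto simp: J_def)
    moreover have "card (Pair p ` J p) = card (J p)" by (rule card_image) (auto simp: inj_on_def)
    ultimately show "(\<Prod>t\<in>{t\<in>T. fst t = p}. fst t) = p ^ card (J p)"
      by (simp add: prod.reindex inj_on_def)
  qed
  finally have w: "int (weight T) = (\<Prod>p\<in>fst ` T. int p ^ card (J p))" by simp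
  show ?thesis
    unfolding w
  proof (rule prod_dvd_if_coprime_factors)
    show "finite (fst ` T)" using T by simp
    fix p assume p: "p \<in> fst ` T"
    then have p': "prime p" "\<not> p dvd E" using S T by auto
    show "int p ^ card (J p) dvd nrm x"
      by (rule prime_power_dvd_nrm[OF p' x(1) JR]) (auto simp: J_def x(2))
    fix q assume q: "q \<in> fst ` T" "p \<noteq> q"
    then have "prime q" using S T by auto
    then have "coprime p q" using p'(1) q(2) by (simp add: primes_coprime)
    then show "coprime (int p ^ card (J p)) (int q ^ card (J q))" by simp
  qed
qed

text \<open>A form of Thue's lemma: the (B + 1)^n points with coordinates in 0..B outnumber the
  \<open>weight T\<close> possible systems of residues at the pairs of T, and two points with equal
  residues differ by the element sought.\<close>

lemma pigeonhole_lattice_point: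
  assumes T: "finite T" "T \<subseteq> S \<times> R" and S: "\<And>p. p \<in> S \<Longrightarrow> prime p \<and> \<not> p dvd E \<and> split p"
    and B: "weight T < (B + 1) ^ n"
  obtains c where "c \<in> {..<n} \<rightarrow>\<^sub>E {- int B..int B}" "lat c \<noteq> 0" "\<And>p r. (p, r) \<in> T \<Longrightarrow> cj r (lat c) \<in> \<PP> p"
proof -
  have "\<exists>k<p. cj r (lat c) - of_nat k \<in> \<PP> p" if "(p, r) \<in> T" for p r c
    using that T S split_residue[of p "lat c" r] lat_OM by blast
  then obtain k where k: "\<And>p r c. (p, r) \<in> T \<Longrightarrow> k p r c < p \<and> cj r (lat c) - of_nat (k p r c) \<in> \<PP> p"
    by metis
  define f where "f c = (\<lambda>t\<in>T. k (fst t) (snd t) c)" for c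
  define box where "box = {..<n} \<rightarrow>\<^sub>E {0..int B}"
  have "f ` box \<subseteq> (\<Pi>\<^sub>E t\<in>T. {..<fst t})" using k by (auto simp: f_def)
  moreover have "finite (\<Pi>\<^sub>E t\<in>T. {..<fst t})" using T by (intro finite_PiE) auto
  ultimately have "card (f ` box) \<le> card (\<Pi>\<^sub>E t\<in>T. {..<fst t})" by (rule card_mono[rotated])
  also have "\<dots> = weight T" using T by (simp add: card_PiE weight_def)
  also have "\<dots> < card box" using B by (simp add: box_def card_PiE nat_add_distrib)
  finally have "\<not> inj_on f box" using card_image by fastforce
  then obtain c d where cd: "c \<in> box" "d \<in> box" "f c = f d" "c \<noteq> d" by (auto simp: inj_on_def)
  define e where "e = (\<lambda>i\<in>{..<n}. c i - d i)"
  have lat_e: "lat e = lat c - lat d"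
    unfolding lat_diff[symmetric] by (rule lat_cong) (simp add: e_def)
  have "lat e \<noteq> 0"
  proof
    assume "lat e = 0"
    then have "c i = d i" if "i < n" for i using lat_eq_0[of e i] that by (simp add: e_def)
    then have "c = d" using cd(1,2) unfolding box_def by (intro PiE_ext[of c _ _ d]) auto
    then show False using cd(4) by simp
  qed
  moreover have "e \<in> {..<n} \<rightarrow>\<^sub>E {- int B..int B}"
  proof (rule PiE_I)
    fix i assume "i \<in> {..<n}"
    then have "c i \<in> {0..int B}" "d i \<in> {0..int B}" "e i = c i - d i"
      using cd(1,2) by (auto simp: box_def e_def PiE_iff)
    then show "e i \<in> {- int B..int B}" by auto
  qed (simp add: e_def)
  moreover have "cj r (lat e) \<in> \<PP> p" if t: "(p, r) \<in> T" for p r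
  proof -
    have p: "prime p" and r: "r \<in> R" using t T S by auto
    have eq: "k p r c = k p r d" using fun_cong[OF cd(3), of "(p, r)"] t by (simp add: f_def)
    have "(cj r (lat c) - of_nat (k p r c)) - (cj r (lat d) - of_nat (k p r d)) \<in> \<PP> p"
      using k[OF t] by (simp add: PP_diff[OF p])
    then show ?thesis by (simp add: lat_e eq cj_diff r lat_OM OM_M)
  qed
  ultimately show ?thesis using that by blast
qed

text \<open>T is encoded by its lattice point \<open>c T\<close> and by the pairs that divide this
  point but are missing from T. The norm of the point is at most C^n times the weight of T, so a
  missing pair has p \<le> C^n, and the second component ranges over the fixed finite set V.\<close>

lemma card_weighted_sets_upper:
  assumes S: "\<And>p. p \<in> S \<Longrightarrow> prime p \<and> \<not> p dvd E \<and> split p"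
  obtains K where "K > 0" "\<And>x. x \<ge> 1 \<Longrightarrow> real (card (weighted_sets S R x)) \<le> K * x"
proof -
  define V where "V = Pow ({..C ^ n} \<times> R)"
  \<comment> \<open>The factor 3^n comes from 2 \<open>B0\<close> + 1 \<le> 3
    \<open>B0\<close>.\<close>
  define K where "K = 3 ^ n * real (card V)"
  have finV: "finite V" by (simp add: V_def)
  have "V \<noteq> {}" by (auto simp: V_def)
  then have K: "K > 0" using finV by (simp add: K_def card_gt_0_iff)
  have S_pos: "p > 0" if "p \<in> S" for p using S[OF that] prime_gt_0_nat by blast
  have "real (card (weighted_sets S R x)) \<le> K * x" if x: "x \<ge> 1" for x
  proof -
    \<comment> \<open>The box is adapted to the weight of T and not to x; this is what bounds the
      cofactor independently of x. The common side \<open>B0\<close> serves for counting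
      only.\<close>
    define B where "B T = nth_root_nat n (weight T)" for T :: "(nat \<times> 'a) set"
    define B0 where "B0 = nth_root_nat n (nat \<lfloor>x\<rfloor>)"
    define P where "P T d \<longleftrightarrow> d \<in> {..<n} \<rightarrow>\<^sub>E {- int (B T)..int (B T)} \<and> lat d \<noteq> 0 \<and>
      (\<forall>p r. (p, r) \<in> T \<longrightarrow> cj r (lat d) \<in> \<PP> p)" for T d
    define c where "c T = (SOME d. P T d)" for T
    have P: "P T (c T)" if T: "T \<in> weighted_sets S R x" for T
    proof -
      have "finite T" "T \<subseteq> S \<times> R" using T by (auto simp: weighted_sets_def)
      moreover have "weight T < (B T + 1) ^ n"
        unfolding B_def by (rule less_Suc_nth_root_nat_power[OF n_pos])
      ultimately obtain d where "d \<in> {..<n} \<rightarrow>\<^sub>E {- int (B T)..int (B T)}" "lat d \<noteq> 0"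
        "\<And>p r. (p, r) \<in> T \<Longrightarrow> cj r (lat d) \<in> \<PP> p"
        using pigeonhole_lattice_point[OF _ _ S] by metis
      then have "P T d" by (simp add: P_def)
      then show ?thesis unfolding c_def by (rule someI[of "P T"])
    qed
    have c: "c T \<in> {..<n} \<rightarrow>\<^sub>E {- int (B T)..int (B T)}" "lat (c T) \<noteq> 0"
      "\<And>p r. (p, r) \<in> T \<Longrightarrow> cj r (lat (c T)) \<in> \<PP> p" if "T \<in> weighted_sets S R x" for T
      using P[OF that] by (auto simp: P_def)
    define full where "full d = {(p, r). p \<in> S \<and> r \<in> R \<and> cj r (lat d) \<in> \<PP> p}" for d
    define f where "f T = (c T, full (c T) - T)" for T
    have "T = full (fst (f T)) - snd (f T)" if "T \<in> weighted_sets S R x" for T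
      using c(3)[OF that] that by (auto simp: f_def full_def weighted_sets_def)
    then have "inj_on f (weighted_sets S R x)" by (metis inj_onI)
    moreover have "f ` weighted_sets S R x \<subseteq> ({..<n} \<rightarrow>\<^sub>E {- int B0..int B0}) \<times> V"
    proof (rule image_subsetI)
      fix T assume T: "T \<in> weighted_sets S R x"
      then have T': "finite T" "T \<subseteq> S \<times> R" "weight T \<le> nat \<lfloor>x\<rfloor>"
        by (auto simp: weighted_sets_def le_nat_floor)
      have "B T \<le> B0"
        unfolding B_def B0_def using T'(3) by (rule nth_root_nat_mono)
      have "c T \<in> {..<n} \<rightarrow>\<^sub>E {- int B0..int B0}"
      proof (rule PiE_I)
        fix i assume "i \<in> {..<n}"
        then have "c T i \<in> {- int (B T)..int (B T)}" using c(1)[OF T] by (auto simp: PiE_iff)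
        then show "c T i \<in> {- int B0..int B0}" using \<open>B T \<le> B0\<close> by auto
      qed (use c(1)[OF T] in \<open>auto simp: PiE_iff extensional_def\<close>)
      moreover have "full (c T) - T \<in> V"
        unfolding V_def
      proof (intro PowI subsetI)
        fix t assume t: "t \<in> full (c T) - T"
        obtain p r where pr: "t = (p, r)" by fastforce
        have prS: "p \<in> S" "r \<in> R" "cj r (lat (c T)) \<in> \<PP> p" using t by (auto simp: full_def pr)
        \<comment> \<open>Adding the missing pair multiplies the weight by p, and the larger weight
          still divides the norm.\<close>
        have "int (weight (insert t T)) dvd nrm (lat (c T))"
          using T' prS c(3)[OF T] S lat_OM
          by (intro weight_dvd_nrm[of _ S]) (auto simp: pr)
        moreover have "weight (insert t T) = p * weight T"
          using t T' by (simp add: weight_def pr)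
        ultimately have dvd: "int (p * weight T) dvd nrm (lat (c T))" by simp
        have "nrm (lat (c T)) \<noteq> 0" using c(2)[OF T] nrm_eq_0_iff[OF lat_OM] by blast
        then have "int (p * weight T) \<le> \<bar>nrm (lat (c T))\<bar>"
          using dvd by (metis dvd_abs_iff zdvd_imp_le zero_less_abs_iff)
        then have "real (p * weight T) \<le> \<bar>real_of_int (nrm (lat (c T)))\<bar>" by linarith
        also have "\<dots> \<le> (real C * real (B T)) ^ n"
        proof (intro abs_nrm_le lat_OM v_cj_lat_le)
          fix i assume "i < n"
          then have "c T i \<in> {- int (B T)..int (B T)}" using c(1)[OF T] by (auto simp: PiE_iff)
          then show "\<bar>real_of_int (c T i)\<bar> \<le> real (B T)" by auto
        qed
        also have "\<dots> = real (C ^ n * B T ^ n)" by (simp add: power_mult_distrib)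
        also have "\<dots> \<le> real (C ^ n * weight T)"
          unfolding B_def using nth_root_nat_power_le[OF n_pos] by (intro of_nat_mono mult_le_mono) auto
        finally have "p * weight T \<le> C ^ n * weight T" by linarith
        then have "p \<le> C ^ n" using weight_pos[OF T'(1,2) S_pos] by simp
        then show "t \<in> {..C ^ n} \<times> R" using prS by (simp add: pr)
      qed
      ultimately show "f T \<in> ({..<n} \<rightarrow>\<^sub>E {- int B0..int B0}) \<times> V" by (simp add: f_def)
    qed
    moreover have "finite (({..<n} \<rightarrow>\<^sub>E {- int B0..int B0}) \<times> V)"
      using finV by (intro finite_cartesian_product finite_PiE) auto
    ultimately have "card (weighted_sets S R x) \<le> card (({..<n} \<rightarrow>\<^sub>E {- int B0..int B0}) \<times> V)"
      by (metis card_image card_mono)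
    also have "\<dots> = (2 * B0 + 1) ^ n * card V"
    proof -
      have "nat (int B0 - - int B0 + 1) = 2 * B0 + 1" by simp
      then show ?thesis by (simp add: card_cartesian_product card_PiE)
    qed
    finally have "real (card (weighted_sets S R x)) \<le> real ((2 * B0 + 1) ^ n * card V)" by (rule of_nat_mono)
    also have "\<dots> \<le> real ((3 * B0) ^ n * card V)"
    proof -
      have "B0 \<ge> 1"
        unfolding B0_def using x by (intro nth_root_nat_ge n_pos) (simp add: le_nat_iff)
      then show ?thesis by (intro of_nat_mono mult_le_mono power_mono) auto
    qed
    also have "\<dots> = K * real (B0 ^ n)" by (simp add: K_def power_mult_distrib)
    also have "\<dots> \<le> K * x"
    proof (rule mult_left_mono)
      have "B0 ^ n \<le> nat \<lfloor>x\<rfloor>" unfolding B0_def by (rule nth_root_nat_power_le[OF n_pos])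
      then show "real (B0 ^ n) \<le> x" using x by linarith
    qed (use K in simp)
    finally show ?thesis .
  qed
  then show ?thesis using that K by blast
qed

end

section \<open>Counting sets of split primes: the lower bound\<close>

text \<open>Telescoping, from 1/k^2 \<le> 1/(k-1) - 1/k.\<close>

lemma sum_inverse_squares_le:
  assumes "Y \<ge> 1"
  shows "(\<Sum>k\<in>{Y<..N}. 1 / (real k)\<^sup>2) \<le> 1 / real Y"
proof (cases "Y \<le> N")
  case True
  then have "(\<Sum>k\<in>{Y<..N}. 1 / (real k)\<^sup>2) \<le> 1 / real Y - 1 / real N"
  proof (induction N rule: dec_induct)
    case (step N)
    have N: "real N > 0" using step assms by simp
    have "1 / (real (Suc N))\<^sup>2 \<le> 1 / (real N * real (Suc N))"
      using N by (intro divide_left_mono) (auto simp: power2_eq_square)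
    also have "\<dots> = 1 / real N - 1 / real (Suc N)" using N by (simp add: field_simps)
    finally have "1 / (real (Suc N))\<^sup>2 \<le> 1 / real N - 1 / real (Suc N)" .
    moreover have "{Y<..Suc N} = insert (Suc N) {Y<..N}" using step by auto
    ultimately show ?case using step.IH by simp
  qed simp
  then show ?thesis by (smt (verit) of_nat_0_le_iff zero_le_divide_1_iff)
qed simp

lemma real_div_le: "real (m div k) \<le> real m / real k"
proof (cases "k = 0")
  case False
  have "real (m div k * k) \<le> real m" by (intro of_nat_mono) simp
  then show ?thesis using False by (simp add: pos_le_divide_eq)
qed simp

lemma real_le_div_Suc:
  assumes "k > 0"
  shows "real m / real k \<le> real (m div k + 1)"
proof -
  have "m < (m div k + 1) * k" using dividend_less_times_div[OF assms, of m] by (simp add: mult.commute)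
  then have "real m \<le> real ((m div k + 1) * k)" by (intro of_nat_mono) simp
  then show ?thesis using assms by (simp only: of_nat_mult) (simp add: pos_divide_le_eq)
qed

lemma power_add_le: "(a + b) ^ k \<le> 2 ^ k * (a ^ k + b ^ k)" if "a \<ge> 0" "b \<ge> 0" for a b :: real
proof -
  have "(a + b) ^ k \<le> (2 * max a b) ^ k" using that by (intro power_mono) auto
  also have "\<dots> = 2 ^ k * max a b ^ k" by (rule power_mult_distrib)
  also have "\<dots> \<le> 2 ^ k * (a ^ k + b ^ k)" using that by (intro mult_left_mono) (auto simp: max_def)
  finally show ?thesis .
qed

lemma prod_prime_factors_squarefree:
  fixes N :: nat
  assumes N: "N > 0" "\<And>p. prime p \<Longrightarrow> \<not> p ^ 2 dvd N"
  shows "(\<Prod>p\<in>prime_factors N. p) = N"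
proof -
  have "multiplicity p N = 1" if p: "p \<in> prime_factors N" for p
  proof -
    have "prime p" "p dvd N" using p by auto
    have "\<not> 2 \<le> multiplicity p N"
      using N \<open>prime p\<close> by (subst power_dvd_iff_le_multiplicity[symmetric]) auto
    moreover have "1 \<le> multiplicity p N"
      using N \<open>prime p\<close> \<open>p dvd N\<close> by (subst power_dvd_iff_le_multiplicity[symmetric]) auto
    ultimately show ?thesis by simp
  qed
  then have "(\<Prod>p\<in>prime_factors N. p) = (\<Prod>p\<in>prime_factors N. p ^ multiplicity p N)"
    by (intro prod.cong) auto
  also have "\<dots> = N" using N by (subst prod_prime_factors) auto
  finally show ?thesis .
qed

lemma card_le_image_times_fibre:
  assumes "finite A" "\<And>y. y \<in> f ` A \<Longrightarrow> card {x\<in>A. f x = y} \<le> k"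
  shows "card A \<le> card (f ` A) * k"
proof -
  have "card A = (\<Sum>y\<in>f ` A. card {x\<in>A. f x = y})"
    using sum.image_gen[OF assms(1), of "\<lambda>_. 1::nat" f] by simp
  also have "\<dots> \<le> (\<Sum>y\<in>f ` A. k)" using assms(2) by (rule sum_mono)
  finally show ?thesis by simp
qed

context galois_abs
begin

lemma v_minus: "x \<in> M \<Longrightarrow> v (- x) = v x"
  using v_mult[of "of_int (-1)" x] v_of_int[of "-1"] by (simp add: simple_ext_minus)

lemma v_diff: "x \<in> M \<Longrightarrow> y \<in> M \<Longrightarrow> v (x - y) \<le> v x + v y"
  using v_add[of x "- y"] by (simp add: v_minus simple_ext_minus)

text \<open>A box far away from the origin, on which all conjugates are comparable to \<open>B\<close>.\<close>

definition box :: "nat \<Rightarrow> (nat \<Rightarrow> int) set" where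
  "box B = (\<Pi>\<^sub>E i\<in>{..<n}. if i = 0 then {int B..int (2 * B)} else {0..int (B div (2 * C))})"

lemma finite_box: "finite (box B)"
  unfolding box_def by (intro finite_PiE) auto

lemma box_subset: "box B \<subseteq> {..<n} \<rightarrow>\<^sub>E {0..int (2 * B)}"
proof -
  have "B div (2 * C) \<le> B" by (rule div_le_dividend)
  then have le: "int (B div (2 * C)) \<le> int (2 * B)" by linarith
  show ?thesis
    unfolding box_def by (rule PiE_mono) (use le in auto)
qed

lemma card_box: "(real B / real (2 * C)) ^ n \<le> real (card (box B))"
proof -
  have W: "real (2 * C) \<ge> 1" using C_pos by linarith
  have "real B / real (2 * C) \<le> real B" 
    using W mult_left_mono[OF W, of "real B"] by (simp add: divide_le_eq)
  moreover have "real B / real (2 * C) \<le> real (B div (2 * C) + 1)"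
    using C_pos by (intro real_le_div_Suc) simp
  ultimately have le: "real B / real (2 * C) \<le>
      real (card (if i = 0 then {int B..int (2 * B)} else {0..int (B div (2 * C))}))" for i :: nat
    by (simp add: nat_add_distrib)
  have "(real B / real (2 * C)) ^ n = (\<Prod>i<n. real B / real (2 * C))" by simp
  also have "\<dots> \<le> (\<Prod>i<n. real (card (if i = 0 then {int B..int (2 * B)} else {0..int (B div (2 * C))})))"
    using le by (intro prod_mono) auto
  also have "\<dots> = real (card (box B))" unfolding box_def by (subst card_PiE) auto
  finally show ?thesis .
qed

text \<open>The coordinate c 0 is at least B and enters all conjugates unchanged, while the others
  together contribute at most C B / (2 C) = B / 2. This is the origin of the short sides
  \<open>B div (2 * C)\<close>.\<close>

lemma v_cj_lat_box:
  assumes c: "c \<in> box B" and r: "r \<in> R"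
  shows "real B / 2 \<le> v (cj r (lat c))" "v (cj r (lat c)) \<le> real C * real (2 * B)"
proof -
  have c_le: "c i \<in> {0..int (2 * B)}" if "i < n" for i
    using PiE_mem[OF subsetD[OF box_subset c], of i] that by simp
  show "v (cj r (lat c)) \<le> real C * real (2 * B)"
  proof (rule v_cj_lat_le[OF r])
    fix i assume "i < n"
    then have "0 \<le> c i" "c i \<le> int (2 * B)" using c_le by auto
    then show "\<bar>real_of_int (c i)\<bar> \<le> real (2 * B)" by simp
  qed
  define c' where "c' = c(0 := 0)"
  have c'_le: "\<bar>real_of_int (c' i)\<bar> \<le> real (B div (2 * C))" if "i < n" for i
  proof (cases "i = 0")
    case False
    then have "c i \<in> {0..int (B div (2 * C))}" using c that by (auto simp: box_def PiE_iff split: if_splits)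
    then have "0 \<le> c i" "c i \<le> int (B div (2 * C))" by auto
    then have "\<bar>real_of_int (c i)\<bar> \<le> real_of_int (int (B div (2 * C)))"
      by (simp only: abs_of_nonneg of_int_0_le_iff of_int_le_iff)
    then show ?thesis using False by (simp add: c'_def)
  qed (simp add: c'_def)
  have "v (cj r (lat c')) \<le> real C * real (B div (2 * C))"
    by (rule v_cj_lat_le[OF r c'_le])
  also have "\<dots> \<le> real C * (real B / real (2 * C))"
    by (intro mult_left_mono real_div_le) auto
  also have "\<dots> = real B / 2" using C_pos by simp
  finally have 1: "v (cj r (lat c')) \<le> real B / 2" .
  have "cj r (lat c) - cj r (lat c') = (\<Sum>i<n. if i = 0 then of_int (c 0) else 0)"
    unfolding cj_lat[OF r] sum_subtractf[symmetric] by (intro sum.cong) (auto simp: c'_def)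
  also have "\<dots> = of_int (c 0)" using n_pos by simp
  finally have "\<bar>real_of_int (c 0)\<bar> = v (cj r (lat c) - cj r (lat c'))" using v_of_int by simp
  also have "\<dots> \<le> v (cj r (lat c)) + v (cj r (lat c'))"
    by (intro v_diff cj_M r OM_M lat_OM)
  finally have "\<bar>real_of_int (c 0)\<bar> \<le> v (cj r (lat c)) + real B / 2" using 1 by linarith
  moreover have "c 0 \<in> {int B..int (2 * B)}" 
    using PiE_mem[OF c[unfolded box_def], of 0] n_pos by simp
  then have "real B \<le> \<bar>real_of_int (c 0)\<bar>" by auto
  ultimately show "real B / 2 \<le> v (cj r (lat c))" by linarith
qed

section \<open>Points congruent to 1 modulo D\<close>

definition shifted :: "nat \<Rightarrow> (nat \<Rightarrow> int) \<Rightarrow> 'a" where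
  "shifted D c = 1 + of_nat D * lat c"

lemma shifted_OM: "shifted D c \<in> OM"
  unfolding shifted_def using OM_of_int[of 1] by (auto intro!: OM_add OM_mult OM_of_nat lat_OM)

lemma cj_shifted: "r \<in> R \<Longrightarrow> cj r (shifted D c) = 1 + of_nat D * cj r (lat c)"
  using lat_OM[of c] by (simp add: shifted_def cj_add cj_mult cj_1 cj_of_nat OM_M simple_ext_mult)

lemma shifted_diff: "shifted D c - shifted D d = of_nat D * lat (\<lambda>i. c i - d i)"
  by (simp add: shifted_def lat_diff algebra_simps)

text \<open>Each conjugate of D \<open>lat c\<close> has size between D B / 2 and 2 D C B. As D B
  \<ge> 4, adding 1 costs at most D B / 4 below and at most D C B above.\<close>

lemma nrm_shifted_bounds:
  assumes c: "c \<in> box B" and D: "D \<ge> 1" and B: "B \<ge> 4"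
  shows "(real D * real B / 4) ^ n \<le> \<bar>real_of_int (nrm (shifted D c))\<bar>"
    and "\<bar>real_of_int (nrm (shifted D c))\<bar> \<le> real ((3 * D * C * B) ^ n)"
proof -
  have D': "real D \<ge> 1" and B': "real B \<ge> 4" and C': "real C \<ge> 1" using D B C_pos by simp_all
  have DB: "real D * real B \<ge> 4" using mult_mono[of 1 "real D" 4 "real B"] D' B' by simp
  have DCB: "real D * real C * real B \<ge> 1"
    using mult_mono[of 1 "real C" 4 "real D * real B"] C' DB by (simp add: mult_ac)
  have M: "cj r (lat c) \<in> M" "of_nat D * cj r (lat c) \<in> M" if "r \<in> R" for r
    using that cj_M OM_M[OF lat_OM] by (auto intro: simple_ext_mult)
  have vD: "v (of_nat D * cj r (lat c)) = real D * v (cj r (lat c))" if "r \<in> R" for r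
    using v_mult[of "of_nat D" "cj r (lat c)"] M[OF that] v_of_int[of "int D"] by simp
  show "(real D * real B / 4) ^ n \<le> \<bar>real_of_int (nrm (shifted D c))\<bar>"
  proof (rule abs_nrm_ge[OF shifted_OM])
    fix r assume r: "r \<in> R"
    have "real D * (real B / 2) \<le> real D * v (cj r (lat c))"
      using v_cj_lat_box(1)[OF c r] by (rule mult_left_mono) simp
    also have "\<dots> = v (cj r (shifted D c) - 1)" by (simp add: cj_shifted[OF r] vD[OF r])
    also have "\<dots> \<le> v (cj r (shifted D c)) + v 1"
      by (rule v_diff[OF cj_M[OF r OM_M[OF shifted_OM]] simple_ext_1])
    also have "v 1 = 1" using v_of_int[of 1] by simp
    finally show "real D * real B / 4 \<le> v (cj r (shifted D c))" using DB by simp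
  qed simp
  have "\<bar>real_of_int (nrm (shifted D c))\<bar> \<le> (3 * real D * real C * real B) ^ n"
  proof (rule abs_nrm_le[OF shifted_OM])
    fix r assume r: "r \<in> R"
    have "v (cj r (shifted D c)) \<le> v 1 + v (of_nat D * cj r (lat c))"
      unfolding cj_shifted[OF r] using M[OF r] by (intro v_add) auto
    also have "v 1 = 1" using v_of_int[of 1] by simp
    also have "v (of_nat D * cj r (lat c)) \<le> real D * (real C * real (2 * B))"
      unfolding vD[OF r] using v_cj_lat_box(2)[OF c r] by (rule mult_left_mono) simp
    finally show "v (cj r (shifted D c)) \<le> 3 * real D * real C * real B" using DCB by simp
  qed
  then show "\<bar>real_of_int (nrm (shifted D c))\<bar> \<le> real ((3 * D * C * B) ^ n)" by simp
qed

text \<open>All conjugates of the point are congruent to 1 modulo \<open>\<PP> p\<close>.\<close>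

lemma not_dvd_nrm_shifted:
  assumes p: "prime p" "p dvd D"
  shows "\<not> int p dvd nrm (shifted D c)"
proof
  assume "int p dvd nrm (shifted D c)"
  then obtain r where r: "r \<in> R" "cj r (shifted D c) \<in> \<PP> p"
    using dvd_nrm_iff[OF p(1) shifted_OM] by blast
  have "(of_int (int D) :: 'a) \<in> \<PP> p" using p by (subst PP_of_int_iff) auto
  then have "of_nat D * cj r (lat c) \<in> \<PP> p"
    using r lat_OM by (intro PP_mult_right[OF p(1)]) (auto intro: OM_algebraic_int[OF OM_cj])
  then have "cj r (shifted D c) - of_nat D * cj r (lat c) \<in> \<PP> p" using r by (intro PP_diff[OF p(1)])
  moreover have "cj r (shifted D c) - of_nat D * cj r (lat c) = 1" by (simp add: cj_shifted[OF r(1)])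
  moreover have "(1 :: 'a) \<notin> \<PP> p" by (rule PP_one[OF p(1)])
  ultimately show False by metis
qed

text \<open>The least s with q \<le> (C s)^n. Two points of a cell of side s then differ by an
  element of norm below q, and s is large enough for the cells to be few.\<close>

lemma ex_cell_side:
  assumes q: "q > 0"
  obtains s where "s \<ge> 1" "(C * (s - 1)) ^ n < q" "q \<le> (C * s) ^ n"
proof -
  define s where "s = (LEAST s. q \<le> (C * s) ^ n)"
  have "q ^ 1 \<le> q ^ n" using q n_pos by (intro power_increasing) auto
  also have "\<dots> \<le> (C * q) ^ n" using C_pos by (intro power_mono) auto
  finally have "q \<le> (C * q) ^ n" by simp
  then have le: "q \<le> (C * s) ^ n" unfolding s_def by (rule LeastI)
  have s: "s \<ge> 1"
  proof (rule ccontr)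
    assume "\<not> s \<ge> 1"
    then have "s = 0" by simp
    then show False using le q n_pos by (simp add: zero_power)
  qed
  have "\<not> q \<le> (C * (s - 1)) ^ n"
    using s unfolding s_def by (intro not_less_Least) simp
  then show ?thesis using that le s by simp
qed

text \<open>Two points of the class differ by D times a lattice point, whose norm is divisible by
  p^2 because p does not divide D. Hence cells of volume at least p^2 / C^n contain at most one
  point each; the summand 1 comes from the incomplete cells at the border.\<close>

lemma card_square_class_le:
  assumes p: "prime p" "\<not> p dvd E" "\<not> p dvd D" and rs: "r \<in> R" "s \<in> R"
  shows "real (card {c\<in>box B. shifted D c \<in> square_class p r s}) \<le>
    2 ^ n * (real (2 * C * B) ^ n / (real p)\<^sup>2 + 1)"
proof -
  let ?X = "{c\<in>box B. shifted D c \<in> square_class p r s}"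
  have p0: "p ^ 2 > 0" using prime_gt_0_nat[OF p(1)] by simp
  obtain t where t: "t \<ge> 1" "(C * (t - 1)) ^ n < p ^ 2" "p ^ 2 \<le> (C * t) ^ n"
    using ex_cell_side[OF p0] by blast
  have "card ?X \<le> (2 * B div t + 1) ^ n"
  proof (rule packing[OF _ t(1)])
    show "?X \<subseteq> {..<n} \<rightarrow>\<^sub>E {0..int (2 * B)}" using box_subset by blast
    fix c d assume c: "c \<in> ?X" and d: "d \<in> ?X" and "c \<noteq> d"
    let ?l = "lat (\<lambda>i. c i - d i)"
    have "?l \<noteq> 0"
    proof
      assume "?l = 0"
      then have "c i = d i" if "i < n" for i using lat_eq_0[OF _ that] by fastforce
      moreover have "c \<in> box B" "d \<in> box B" using c d by auto
      ultimately have "c = d" unfolding box_def by (intro PiE_ext) auto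
      then show False using \<open>c \<noteq> d\<close> by simp
    qed
    then have nz: "nrm ?l \<noteq> 0" using nrm_eq_0_iff[OF lat_OM] by blast
    have "of_nat D * ?l \<in> square_class p r s"
      unfolding shifted_diff[symmetric] using c d by (intro square_class_diff[OF p(1) rs]) auto
    then have "int p ^ 2 dvd nrm (of_nat D * ?l)" by (rule square_dvd_nrm_if_square_class[OF p(1,2) rs])
    then have "int p ^ 2 dvd int D ^ n * nrm ?l" by (simp add: nrm_of_nat_mult lat_OM)
    moreover have "coprime (int p ^ 2) (int D ^ n)"
      using prime_imp_coprime[OF p(1,3)] by simp
    ultimately have "int p ^ 2 dvd nrm ?l" by (simp add: coprime_dvd_mult_right_iff)
    then have "int (p ^ 2) \<le> \<bar>nrm ?l\<bar>"
      using nz by (metis dvd_abs_iff of_nat_power zdvd_imp_le zero_less_abs_iff)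
    moreover have "int ((C * (t - 1)) ^ n) < int (p ^ 2)" using t(2) by (simp only: of_nat_less_iff)
    ultimately have "real_of_int (int ((C * (t - 1)) ^ n)) < real_of_int \<bar>nrm ?l\<bar>"
      by (simp only: of_int_less_iff)
    then show "real (C * (t - 1)) ^ n < \<bar>real_of_int (nrm ?l)\<bar>" by simp
  qed
  then have "real (card ?X) \<le> real (2 * B div t + 1) ^ n" by (simp only: of_nat_power[symmetric] of_nat_le_iff)
  also have "\<dots> \<le> (real (2 * B) / real t + 1) ^ n"
    by (intro power_mono) (use real_div_le[of "2 * B" t] in auto)
  also have "\<dots> \<le> 2 ^ n * ((real (2 * B) / real t) ^ n + 1 ^ n)" by (intro power_add_le) auto
  also have "(real (2 * B) / real t) ^ n \<le> real (2 * C * B) ^ n / (real p)\<^sup>2"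
  proof -
    have t0: "real t > 0" using t(1) by simp
    have "(real p)\<^sup>2 \<le> (real C * real t) ^ n" 
      using t(3) by (simp only: of_nat_mult[symmetric] of_nat_power[symmetric] of_nat_le_iff)
    then have "real (2 * B) ^ n * (real p)\<^sup>2 \<le> real (2 * B) ^ n * (real C * real t) ^ n"
      by (intro mult_left_mono) auto
    also have "\<dots> = real (2 * C * B) ^ n * real t ^ n" by (simp add: power_mult_distrib)
    finally show ?thesis
      using t0 prime_gt_0_nat[OF p(1)] by (simp add: power_divide divide_le_eq mult_ac pos_le_divide_eq)
  qed
  finally show ?thesis by simp
qed

lemma card_square_dvd_le:
  assumes p: "prime p" "\<not> p dvd E" "\<not> p dvd D"
  shows "real (card {c\<in>box B. int p ^ 2 dvd nrm (shifted D c)}) \<le>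
    (real n)\<^sup>2 * (2 ^ n * (real (2 * C * B) ^ n / (real p)\<^sup>2 + 1))"
proof -
  let ?X = "\<lambda>rs. {c\<in>box B. shifted D c \<in> square_class p (fst rs) (snd rs)}"
  have "{c\<in>box B. int p ^ 2 dvd nrm (shifted D c)} \<subseteq> (\<Union>rs\<in>R \<times> R. ?X rs)"
  proof
    fix c assume c: "c \<in> {c\<in>box B. int p ^ 2 dvd nrm (shifted D c)}"
    then obtain r s where "r \<in> R" "s \<in> R" "shifted D c \<in> square_class p r s"
      using square_class_covers[OF p(1) shifted_OM] by blast
    then show "c \<in> (\<Union>rs\<in>R \<times> R. ?X rs)" using c by (intro UN_I[of "(r, s)"]) auto
  qed
  then have "card {c\<in>box B. int p ^ 2 dvd nrm (shifted D c)} \<le> card (\<Union>rs\<in>R \<times> R. ?X rs)"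
    using finite_box by (intro card_mono) auto
  also have "\<dots> \<le> (\<Sum>rs\<in>R \<times> R. card (?X rs))" by (intro card_UN_le) auto
  finally have "real (card {c\<in>box B. int p ^ 2 dvd nrm (shifted D c)}) \<le> (\<Sum>rs\<in>R \<times> R. real (card (?X rs)))"
    by (simp only: of_nat_sum[symmetric] of_nat_le_iff)
  also have "\<dots> \<le> (\<Sum>rs\<in>R \<times> R. 2 ^ n * (real (2 * C * B) ^ n / (real p)\<^sup>2 + 1))"
    by (intro sum_mono card_square_class_le[OF p]) auto
  finally show ?thesis by (simp add: card_cartesian_product card_R power2_eq_square)
qed

section \<open>Points with squarefree norm\<close>

definition squarefree_points :: "nat \<Rightarrow> nat \<Rightarrow> (nat \<Rightarrow> int) set" where
  "squarefree_points D B = {c\<in>box B. \<forall>p. prime p \<longrightarrow> \<not> int p ^ 2 dvd nrm (shifted D c)}"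

text \<open>Primes up to Y do not divide the norm, since D = Y!, and p^2 > Z is too large to divide
  it. For the remaining p, the terms with 1/p^2 add up to a share of order 1/Y of the box, and the
  terms 1 to at most the square root of Z, of order B^(n/2) for fixed D. The hypotheses on Y and B
  make each sum at most a quarter of the lower bound b for the box.\<close>

lemma card_squarefree_points:
  assumes Y: "Y \<ge> E" "Y \<ge> 4 * n\<^sup>2 * (8 * C\<^sup>2) ^ n" and D: "D = fact Y"
    and B: "B \<ge> 4" "B \<ge> (4 * n\<^sup>2 * (4 * C) ^ n)\<^sup>2 * (3 * D * C) ^ n"
  shows "(real B / real (2 * C)) ^ n / 2 \<le> real (card (squarefree_points D B))"
proof -
  define b where "b = (real B / real (2 * C)) ^ n"
  define Z where "Z = (3 * D * C * B) ^ n"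
  define P where "P = {p. prime p \<and> Y < p \<and> p\<^sup>2 \<le> Z}"
  define q where "q = nth_root_nat 2 Z"
  have D1: "D \<ge> 1" unfolding D by (rule fact_ge_1)
  have C1: "C \<ge> 1" by (rule C_pos)
  have Y1: "Y \<ge> 1" using Y(1) E_pos by linarith
  have q: "q\<^sup>2 \<le> Z" unfolding q_def by (rule nth_root_nat_power_le) simp
  have Pq: "P \<subseteq> {Y<..q}" unfolding P_def q_def using nth_root_nat_ge[of 2] by auto
  have finP: "finite P" using finite_subset[OF Pq] by simp
  let ?bad = "\<lambda>p. {c\<in>box B. int p ^ 2 dvd nrm (shifted D c)}"
  have "box B - squarefree_points D B \<subseteq> (\<Union>p\<in>P. ?bad p)"
  proof
    fix c assume "c \<in> box B - squarefree_points D B"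
    then obtain p where c: "c \<in> box B" and p: "prime p" "int p ^ 2 dvd nrm (shifted D c)"
      by (auto simp: squarefree_points_def)
    have "int p dvd nrm (shifted D c)" using p(2) by (auto simp: power2_eq_square intro: dvd_mult_left)
    then have "\<not> p dvd D" using not_dvd_nrm_shifted[OF p(1)] by blast
    then have "Y < p" unfolding D using dvd_fact[of p Y] prime_ge_1_nat[OF p(1)] by (meson not_le)
    have bounds: "(real D * real B / 4) ^ n \<le> \<bar>real_of_int (nrm (shifted D c))\<bar>"
      "\<bar>real_of_int (nrm (shifted D c))\<bar> \<le> real Z"
      using nrm_shifted_bounds[OF c D1 B(1)] by (simp_all add: Z_def)
    have "(real D * real B / 4) ^ n > 0" using D1 B(1) by simp
    then have "nrm (shifted D c) \<noteq> 0" using bounds(1) by auto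
    then have "int p ^ 2 \<le> \<bar>nrm (shifted D c)\<bar>"
      using p(2) by (metis dvd_abs_iff zdvd_imp_le zero_less_abs_iff)
    then have "real_of_int (int p ^ 2) \<le> real_of_int \<bar>nrm (shifted D c)\<bar>" by (simp only: of_int_le_iff)
    then have "(real p)\<^sup>2 \<le> real Z" by (intro order_trans[OF _ bounds(2)]) simp
    then have "p\<^sup>2 \<le> Z" by (simp only: of_nat_power[symmetric] of_nat_le_iff)
    then show "c \<in> (\<Union>p\<in>P. ?bad p)" using c p \<open>Y < p\<close> by (auto simp: P_def)
  qed
  then have "card (box B - squarefree_points D B) \<le> card (\<Union>p\<in>P. ?bad p)"
    using finP finite_box by (intro card_mono) auto
  also have "\<dots> \<le> (\<Sum>p\<in>P. card (?bad p))" by (rule card_UN_le[OF finP])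
  finally have "real (card (box B - squarefree_points D B)) \<le> (\<Sum>p\<in>P. real (card (?bad p)))"
    by (simp only: of_nat_sum[symmetric] of_nat_le_iff)
  also have "\<dots> \<le> (\<Sum>p\<in>P. (real n)\<^sup>2 * (2 ^ n * (real (2 * C * B) ^ n / (real p)\<^sup>2 + 1)))"
  proof (rule sum_mono)
    fix p assume p: "p \<in> P"
    then have "\<not> p dvd D" unfolding D by (subst prime_dvd_fact_iff) (auto simp: P_def)
    moreover have "\<not> p dvd E" using p Y(1) E_pos by (auto simp: P_def dest: dvd_imp_le)
    ultimately show "real (card (?bad p)) \<le> (real n)\<^sup>2 * (2 ^ n * (real (2 * C * B) ^ n / (real p)\<^sup>2 + 1))"
      using p by (intro card_square_dvd_le) (auto simp: P_def)
  qed
  also have "\<dots> = (real n)\<^sup>2 * 2 ^ n * (real (2 * C * B) ^ n * (\<Sum>p\<in>P. 1 / (real p)\<^sup>2) + real (card P))"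
    by (simp add: sum.distrib sum_distrib_left algebra_simps)
  also have "\<dots> \<le> (real n)\<^sup>2 * 2 ^ n * (real (2 * C * B) ^ n * (1 / real Y) + real q)"
  proof (intro mult_left_mono add_mono)
    have "(\<Sum>p\<in>P. 1 / (real p)\<^sup>2) \<le> (\<Sum>p\<in>{Y<..q}. 1 / (real p)\<^sup>2)"
      using Pq by (intro sum_mono2) auto
    also have "\<dots> \<le> 1 / real Y" by (rule sum_inverse_squares_le[OF Y1])
    finally show "(\<Sum>p\<in>P. 1 / (real p)\<^sup>2) \<le> 1 / real Y" .
    have "card P \<le> card {Y<..q}" by (rule card_mono[OF _ Pq]) simp
    then show "real (card P) \<le> real q" by simp
  qed auto
  also have "\<dots> = (real n)\<^sup>2 * 2 ^ n * real (2 * C * B) ^ n / real Y + (real n)\<^sup>2 * 2 ^ n * real q"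
    by (simp add: algebra_simps)
  also have "\<dots> \<le> b / 4 + b / 4"
  proof (rule add_mono)
    have C0: "real C > 0" using C1 by simp
    have "4 * (real n)\<^sup>2 * (8 * (real C)\<^sup>2) ^ n \<le> real Y"
      using of_nat_mono[OF Y(2), where ?'a = real] by simp
    then have "4 * (real n)\<^sup>2 * (8 * (real C)\<^sup>2) ^ n * b \<le> real Y * b"
      by (rule mult_right_mono) (simp add: b_def)
    moreover have "(8 * (real C)\<^sup>2) ^ n * b = 2 ^ n * real (2 * C * B) ^ n"
      unfolding b_def power_mult_distrib[symmetric] using C0 by (simp add: field_simps power2_eq_square)
    ultimately have "4 * (real n)\<^sup>2 * (2 ^ n * real (2 * C * B) ^ n) \<le> real Y * b"
      by (metis mult.assoc)
    then show "(real n)\<^sup>2 * 2 ^ n * real (2 * C * B) ^ n / real Y \<le> b / 4"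
      using Y1 by (simp add: divide_le_eq mult_ac)
    \<comment> \<open>The comparison is made after squaring because q is the root of Z; one factor B
      absorbs all constants, and B \<le> B^n.\<close>
    have "(4 * n\<^sup>2 * (4 * C) ^ n * q)\<^sup>2 \<le> (4 * n\<^sup>2 * (4 * C) ^ n)\<^sup>2 * Z"
      unfolding power_mult_distrib[of _ q] using q by (rule mult_le_mono2)
    also have "\<dots> = ((4 * n\<^sup>2 * (4 * C) ^ n)\<^sup>2 * (3 * D * C) ^ n) * B ^ n"
      by (simp add: Z_def power_mult_distrib)
    also have "\<dots> \<le> B * B ^ n" using B(2) by (rule mult_le_mono1)
    also have "\<dots> \<le> B ^ n * B ^ n"
      using power_increasing[of 1 n B] B(1) n_pos by (intro mult_le_mono1) simp
    also have "\<dots> = (B ^ n)\<^sup>2" by (simp add: power2_eq_square)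
    finally have "4 * n\<^sup>2 * (4 * C) ^ n * q \<le> B ^ n" by (rule power2_le_imp_le) simp
    then have "real (4 * n\<^sup>2 * (4 * C) ^ n * q) \<le> real (B ^ n)" by (rule of_nat_mono)
    moreover have "real (B ^ n) = (2 * real C) ^ n * b"
      unfolding b_def power_divide using C0 by simp
    moreover have "real (4 * n\<^sup>2 * (4 * C) ^ n * q) = (2 * real C) ^ n * (4 * (real n)\<^sup>2 * 2 ^ n * real q)"
    proof -
      have "(4 * real C) ^ n = (2 * real C * 2) ^ n" by (rule arg_cong[where f = "\<lambda>y. y ^ n"]) simp
      also have "\<dots> = (2 * real C) ^ n * 2 ^ n" by (rule power_mult_distrib)
      finally show ?thesis
        by (simp only: of_nat_mult of_nat_power of_nat_numeral mult_ac)
    qed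
    ultimately have "(2 * real C) ^ n * (4 * (real n)\<^sup>2 * 2 ^ n * real q) \<le> (2 * real C) ^ n * b"
      by (simp only:)
    then have "4 * (real n)\<^sup>2 * 2 ^ n * real q \<le> b" using C0 by (simp add: mult_le_cancel_left_pos)
    then show "(real n)\<^sup>2 * 2 ^ n * real q \<le> b / 4" by simp
  qed
  finally have bad: "real (card (box B - squarefree_points D B)) \<le> b / 2" by simp
  have "squarefree_points D B \<subseteq> box B" by (auto simp: squarefree_points_def)
  then have "card (box B - squarefree_points D B) = card (box B) - card (squarefree_points D B)"
    "card (squarefree_points D B) \<le> card (box B)"
    using finite_box by (auto intro: card_Diff_subset finite_subset card_mono)
  then have "real (card (box B)) = real (card (box B - squarefree_points D B)) + real (card (squarefree_points D B))"
    by simp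
  then show ?thesis using bad card_box[of B] by (simp add: b_def)
qed

section \<open>Encoding squarefree points by sets of split primes\<close>

definition split_primes :: "nat \<Rightarrow> nat set" where
  "split_primes Y = {p. prime p \<and> Y < p \<and> split p}"

definition prime_divisors :: "'a \<Rightarrow> (nat \<times> 'a) set" where
  "prime_divisors x = {(p, r). prime p \<and> r \<in> R \<and> cj r x \<in> \<PP> p}"

text \<open>A prime factor of the norm that does not split, or that has two labels, would divide it
  twice. So each prime factor occurs in T with exactly one label, and the weight is the product of
  the prime factors.\<close>

lemma prime_divisors_squarefree:
  assumes Y: "Y \<ge> E" and D: "D = fact Y" and B: "B \<ge> 4" and c: "c \<in> squarefree_points D B"
  defines "T \<equiv> prime_divisors (shifted D c)"
  shows "finite T" "T \<subseteq> split_primes Y \<times> R" "int (weight T) = \<bar>nrm (shifted D c)\<bar>"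
proof -
  let ?x = "shifted D c"
  define N where "N = nat \<bar>nrm ?x\<bar>"
  have D1: "D \<ge> 1" unfolding D by (rule fact_ge_1)
  have "c \<in> box B" using c by (simp add: squarefree_points_def)
  then have "(real D * real B / 4) ^ n \<le> \<bar>real_of_int (nrm ?x)\<bar>"
    using nrm_shifted_bounds D1 B by blast
  moreover have "(real D * real B / 4) ^ n > 0" using D1 B by simp
  ultimately have "nrm ?x \<noteq> 0" by auto
  then have N: "N > 0" "int N = \<bar>nrm ?x\<bar>" by (auto simp: N_def)
  have dvd_N: "k dvd N \<longleftrightarrow> int k dvd nrm ?x" for k
    by (metis N(2) dvd_abs_iff of_nat_dvd_iff)
  have sq: "\<not> p ^ 2 dvd N" if "prime p" for p
    using c that unfolding dvd_N by (simp add: squarefree_points_def)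
  have T_iff: "(\<exists>r. (p, r) \<in> T) \<longleftrightarrow> p \<in> prime_factors N" for p
    using dvd_nrm_iff[OF _ shifted_OM, of p D c] N(1)
    by (auto simp: T_def prime_divisors_def in_prime_factors_iff dvd_N)
  have p_props: "prime p \<and> Y < p \<and> \<not> p dvd E" if "p \<in> prime_factors N" for p
  proof -
    have p: "prime p" "int p dvd nrm ?x" using that by (auto simp: in_prime_factors_iff dvd_N)
    then have "\<not> p dvd D" using not_dvd_nrm_shifted by blast
    then have "Y < p" unfolding D using dvd_fact[of p Y] prime_ge_1_nat[OF p(1)] by (meson not_le)
    moreover have "\<not> p dvd E" using \<open>Y < p\<close> Y E_pos by (auto dest: dvd_imp_le)
    ultimately show ?thesis using p by simp
  qed
  have splitp: "split p" if "p \<in> prime_factors N" for p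
  proof (rule ccontr)
    assume "\<not> split p"
    then have "int p ^ 2 dvd nrm ?x"
      using nonsplit_square_dvd_nrm[of p ?x] p_props[OF that] that shifted_OM
      by (auto simp: in_prime_factors_iff dvd_N)
    then show False using sq p_props[OF that] by (simp add: dvd_N)
  qed
  have fst_T: "fst ` T = prime_factors N" using T_iff by force
  have inj: "inj_on fst T"
  proof (rule inj_onI)
    fix t u assume tu: "t \<in> T" "u \<in> T" "fst t = fst u"
    obtain p r s where pr: "t = (p, r)" "u = (p, s)" using tu(3) by (metis prod.collapse)
    have p: "p \<in> prime_factors N" using tu pr T_iff by blast
    have "r = s"
    proof (rule ccontr)
      assume "r \<noteq> s"
      have "int p ^ card {r, s} dvd nrm ?x"
        using tu p_props[OF p] by (intro prime_power_dvd_nrm shifted_OM) (auto simp: pr T_def prime_divisors_def)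
      moreover have "card {r, s} = 2" using \<open>r \<noteq> s\<close> by simp
      ultimately have "int (p ^ 2) dvd nrm ?x" by (simp only: of_nat_power)
      then show False using sq p_props[OF p] dvd_N by blast
    qed
    then show "t = u" by (simp add: pr)
  qed
  show "finite T" using fst_T inj by (metis finite_imageD finite_set_mset)
  show "T \<subseteq> split_primes Y \<times> R"
  proof
    fix t assume t: "t \<in> T"
    then have "fst t \<in> prime_factors N" using fst_T by blast
    then show "t \<in> split_primes Y \<times> R"
      using t p_props splitp by (cases t) (auto simp: T_def prime_divisors_def split_primes_def)
  qed
  have "weight T = (\<Prod>p\<in>prime_factors N. p)"
    unfolding weight_def fst_T[symmetric] by (simp add: prod.reindex[OF inj])
  also have "\<dots> = N" by (rule prod_prime_factors_squarefree[OF N(1) sq])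
  finally show "int (weight T) = \<bar>nrm ?x\<bar>" using N by simp
qed

text \<open>Points with the same prime divisors differ by elements of large norm, so only boundedly many of
  them fit in the box.\<close>

lemma card_prime_divisors_fibre:
  assumes Y: "Y \<ge> E" and D: "D = fact Y" and B: "B \<ge> 4"
  shows "card {c\<in>squarefree_points D B. prime_divisors (shifted D c) = T} \<le> (16 * C + 1) ^ n"
proof -
  let ?X = "{c\<in>squarefree_points D B. prime_divisors (shifted D c) = T}"
  \<comment> \<open>With this side C (s - 1) \<le> B / 8, safely below the B / 4 that the common
    weight forces, while 2 B div s is at most 16 C.\<close>
  define s where "s = B div (8 * C) + 1"
  have C1: "C \<ge> 1" by (rule C_pos)
  have D1: "D \<ge> 1" unfolding D by (rule fact_ge_1)
  have "card ?X \<le> (2 * B div s + 1) ^ n"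
  proof (rule packing)
    show "?X \<subseteq> {..<n} \<rightarrow>\<^sub>E {0..int (2 * B)}"
      using box_subset by (auto simp: squarefree_points_def)
    show "s \<ge> 1" by (simp add: s_def)
    fix c d assume c: "c \<in> ?X" and d: "d \<in> ?X" and "c \<noteq> d"
    let ?l = "lat (\<lambda>i. c i - d i)"
    have box: "c \<in> box B" "d \<in> box B" using c d by (auto simp: squarefree_points_def)
    have "?l \<noteq> 0"
    proof
      assume "?l = 0"
      then have "c i = d i" if "i < n" for i using lat_eq_0[OF _ that] by fastforce
      then have "c = d" using box unfolding box_def by (intro PiE_ext) auto
      then show False using \<open>c \<noteq> d\<close> by simp
    qed
    then have nz: "nrm ?l \<noteq> 0" using nrm_eq_0_iff[OF lat_OM] by blast
    have Tc: "finite T" "T \<subseteq> split_primes Y \<times> R" "int (weight T) = \<bar>nrm (shifted D c)\<bar>"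
      using prime_divisors_squarefree[OF Y D B, of c] c by auto
    have "int (weight T) dvd nrm (shifted D c - shifted D d)"
    proof (rule weight_dvd_nrm[OF Tc(1,2)])
      show "prime p \<and> \<not> p dvd E" if "p \<in> split_primes Y" for p
        using that Y E_pos by (auto simp: split_primes_def dest: dvd_imp_le)
      show "shifted D c - shifted D d \<in> OM" by (intro OM_diff shifted_OM)
      fix p r assume pr: "(p, r) \<in> T"
      then have "prime p" "r \<in> R" "cj r (shifted D c) \<in> \<PP> p" "cj r (shifted D d) \<in> \<PP> p"
        using c d by (auto simp: prime_divisors_def)
      then show "cj r (shifted D c - shifted D d) \<in> \<PP> p"
        by (simp add: cj_diff OM_M shifted_OM PP_diff)
    qed
    then have "int (weight T) dvd int D ^ n * nrm ?l"
      by (simp add: shifted_diff nrm_of_nat_mult lat_OM)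
    then have "int (weight T) \<le> \<bar>int D ^ n * nrm ?l\<bar>"
      using nz D1 by (metis dvd_abs_iff mult_eq_0_iff not_one_le_zero of_nat_0_eq_iff power_not_zero zdvd_imp_le zero_less_abs_iff)
    then have "real_of_int (int (weight T)) \<le> real_of_int \<bar>int D ^ n * nrm ?l\<bar>" by (simp only: of_int_le_iff)
    moreover have "(real D * real B / 4) ^ n \<le> real_of_int (int (weight T))"
      unfolding Tc(3) using nrm_shifted_bounds(1)[OF box(1) D1 B] by simp
    \<comment> \<open>D^n appears on both sides and cancels, so the fibre bound does not depend on
      D.\<close>
    ultimately have "real D ^ n * (real B / 4) ^ n \<le> real D ^ n * \<bar>real_of_int (nrm ?l)\<bar>"
      by (simp add: abs_mult power_mult_distrib[symmetric])
    then have "(real B / 4) ^ n \<le> \<bar>real_of_int (nrm ?l)\<bar>" using D1 by simp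
    moreover have "real (C * (s - 1)) ^ n < (real B / 4) ^ n"
    proof (rule power_strict_mono)
      have "real (C * (s - 1)) \<le> real C * (real B / real (8 * C))"
        unfolding of_nat_mult s_def by (intro mult_left_mono) (use real_div_le[of B "8 * C"] in auto)
      also have "\<dots> = real B / 8" using C1 by simp
      also have "\<dots> < real B / 4" using B by simp
      finally show "real (C * (s - 1)) < real B / 4" .
    qed (use n_pos in auto)
    ultimately show "real (C * (s - 1)) ^ n < \<bar>real_of_int (nrm ?l)\<bar>" by linarith
  qed
  also have "\<dots> \<le> (16 * C + 1) ^ n"
  proof -
    have "B < 8 * C * s"
      unfolding s_def using dividend_less_times_div[of "8 * C" B] C1 by (simp add: algebra_simps)
    then have "2 * B < (16 * C + 1) * s" by (simp add: algebra_simps)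
    then have "2 * B div s < 16 * C + 1" by (simp add: less_mult_imp_div_less)
    then show ?thesis by (intro power_mono) auto
  qed
  finally show ?thesis .
qed

text \<open>For given x, B is chosen so that the norms, at most (3 D C B)^n, stay below x while B^n
  remains comparable to x; then the number of squarefree points is divided by the size of the
  fibres. Every Y \<ge> \<open>Y\<^sub>0\<close> is allowed because Y must later exceed the
  denominator of the compositum too.\<close>

lemma card_weighted_sets_lower:
  obtains Y\<^sub>0 where "\<And>Y. Y \<ge> Y\<^sub>0 \<Longrightarrow>
    \<exists>a>0. \<exists>x\<^sub>0. \<forall>x\<ge>x\<^sub>0. a * x \<le> real (card (weighted_sets (split_primes Y) R x))"
proof -
  define Y\<^sub>0 where "Y\<^sub>0 = E + 4 * n\<^sup>2 * (8 * C\<^sup>2) ^ n"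
  have "\<exists>a>0. \<exists>x\<^sub>0. \<forall>x\<ge>x\<^sub>0. a * x \<le> real (card (weighted_sets (split_primes Y) R x))"
    if "Y \<ge> Y\<^sub>0" for Y
  proof -
    have Y: "Y \<ge> E" "Y \<ge> 4 * n\<^sup>2 * (8 * C\<^sup>2) ^ n" using that by (auto simp: Y\<^sub>0_def)
    define D :: nat where "D = fact Y"
    define B\<^sub>1 where "B\<^sub>1 = 4 + (4 * n\<^sup>2 * (4 * C) ^ n)\<^sup>2 * (3 * D * C) ^ n"
    define k where "k = 3 * D * C"
    have D1: "D \<ge> 1" unfolding D_def by (rule fact_ge_1)
    have C1: "C \<ge> 1" by (rule C_pos)
    have k1: "k \<ge> 1" using D1 C1 by (simp add: k_def)
    define F where "F = (16 * C + 1) ^ n"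
    \<comment> \<open>Rounding loses at most a factor 2 in B, so x \<le> (2 k B)^n; the factor 2 F
      accounts for the points whose norm is not squarefree and for the fibres.\<close>
    define a where "a = 1 / (2 * real F * real (2 * C * (2 * k)) ^ n)"
    have F0: "F > 0" by (simp add: F_def)
    have "a > 0" using F0 C1 k1 by (simp add: a_def)
    moreover have "a * x \<le> real (card (weighted_sets (split_primes Y) R x))"
      if x: "x \<ge> real ((k * B\<^sub>1) ^ n)" for x
    proof -
      define m where "m = nat \<lfloor>x\<rfloor>"
      define B where "B = nth_root_nat n m div k"
      have x0: "x \<ge> 0" using x by (meson of_nat_0_le_iff order_trans)
      have m: "real m \<le> x" "x < real m + 1" using x0 unfolding m_def by linarith+
      have "real ((k * B\<^sub>1) ^ n) < real (m + 1)" using x m by linarith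
      then have "(k * B\<^sub>1) ^ n \<le> m" by linarith
      then have "k * B\<^sub>1 \<le> nth_root_nat n m" by (intro nth_root_nat_ge n_pos)
      then have B: "B\<^sub>1 \<le> B" unfolding B_def using k1 by (simp add: less_eq_div_iff_mult_less_eq mult.commute)
      have "k * B \<le> nth_root_nat n m" unfolding B_def by simp
      then have "(k * B) ^ n \<le> nth_root_nat n m ^ n" by (rule power_mono) simp
      also have "\<dots> \<le> m" by (rule nth_root_nat_power_le[OF n_pos])
      finally have kB: "real ((k * B) ^ n) \<le> x" using m(1) by (meson of_nat_mono order_trans)
      have "nth_root_nat n m < k * (B + 1)"
        unfolding B_def using k1 by (simp add: dividend_less_times_div)
      then have "nth_root_nat n m + 1 \<le> k * (B + 1)" by simp
      also have "\<dots> \<le> k * (2 * B)" using B by (intro mult_le_mono2) (simp add: B\<^sub>1_def)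
      finally have "(nth_root_nat n m + 1) ^ n \<le> (k * (2 * B)) ^ n" by (rule power_mono) simp
      then have "m < (k * (2 * B)) ^ n" using less_Suc_nth_root_nat_power[OF n_pos, of m] by linarith
      then have "real (m + 1) \<le> real ((k * (2 * B)) ^ n)" by (intro of_nat_mono) simp
      then have xB: "x \<le> real (k * (2 * B)) ^ n" using m(2) by simp
      have B4: "B \<ge> 4" and B': "B \<ge> (4 * n\<^sup>2 * (4 * C) ^ n)\<^sup>2 * (3 * D * C) ^ n"
        using B by (auto simp: B\<^sub>1_def)
      define f where "f c = prime_divisors (shifted D c)" for c
      have "f ` squarefree_points D B \<subseteq> weighted_sets (split_primes Y) R x"
      proof (rule image_subsetI)
        fix c assume c: "c \<in> squarefree_points D B"
        note T = prime_divisors_squarefree[OF Y(1) D_def B4 c]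
        have "real (weight (f c)) = real_of_int (int (weight (f c)))" by simp
        also have "\<dots> = \<bar>real_of_int (nrm (shifted D c))\<bar>" unfolding f_def T(3) by simp
        also have "\<dots> \<le> real ((3 * D * C * B) ^ n)"
          using c by (intro nrm_shifted_bounds[OF _ D1 B4]) (simp add: squarefree_points_def)
        also have "\<dots> \<le> x" using kB by (simp add: k_def)
        finally show "f c \<in> weighted_sets (split_primes Y) R x"
          using T by (simp add: weighted_sets_def f_def)
      qed
      moreover have "finite (weighted_sets (split_primes Y) R x)"
        by (rule finite_weighted_sets) (auto simp: split_primes_def prime_gt_0_nat)
      ultimately have image: "card (f ` squarefree_points D B) \<le> card (weighted_sets (split_primes Y) R x)"
        by (rule card_mono[rotated])
      have "squarefree_points D B \<subseteq> box B" by (auto simp: squarefree_points_def)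
      then have "card (squarefree_points D B) \<le> card (f ` squarefree_points D B) * F"
        unfolding F_def f_def using finite_subset[OF _ finite_box]
        by (intro card_le_image_times_fibre card_prime_divisors_fibre[OF Y(1) D_def B4]) blast+
      also have "\<dots> \<le> card (weighted_sets (split_primes Y) R x) * F" using image by (rule mult_le_mono1)
      finally have "real (card (squarefree_points D B)) \<le> real (card (weighted_sets (split_primes Y) R x)) * real F"
        by (simp only: of_nat_mult[symmetric] of_nat_le_iff)
      then have "(real B / real (2 * C)) ^ n / 2 \<le> real (card (weighted_sets (split_primes Y) R x)) * real F"
        using card_squarefree_points[OF Y D_def B4 B'] by linarith
      then have 1: "(real B / real (2 * C)) ^ n / (2 * real F) \<le> real (card (weighted_sets (split_primes Y) R x))"
        using F0 by (simp add: divide_le_eq mult_ac)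
      have "a * x \<le> a * real (k * (2 * B)) ^ n" using xB \<open>a > 0\<close> by (intro mult_left_mono) auto
      also have "\<dots> = (real (k * (2 * B)) / real (2 * C * (2 * k))) ^ n / (2 * real F)"
        unfolding a_def power_divide by (simp only: times_divide_eq_left times_divide_eq_right mult_1_left mult_1_right
            divide_divide_eq_left mult.commute)
      also have "real (k * (2 * B)) / real (2 * C * (2 * k)) = real B / real (2 * C)"
        using k1 C1 by (simp add: field_simps)
      finally show ?thesis using 1 by linarith
    qed
    ultimately show ?thesis by blast
  qed
  then show ?thesis using that by blast
qed

end

section \<open>Comparing the two bounds\<close>

definition relabel :: "('b \<Rightarrow> 'c) \<Rightarrow> (nat \<times> 'b) set \<Rightarrow> (nat \<times> 'c) set" where
  "relabel i T = (\<lambda>t. (fst t, i (snd t))) ` T"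

lemma relabel_inverse:
  assumes "inj_on i I" "T \<subseteq> S \<times> I"
  shows "T = {t. snd t \<in> I \<and> (fst t, i (snd t)) \<in> relabel i T}"
proof (intro equalityI subsetI)
  fix t assume "t \<in> {t. snd t \<in> I \<and> (fst t, i (snd t)) \<in> relabel i T}"
  then obtain u where u: "snd t \<in> I" "u \<in> T" "fst t = fst u" "i (snd t) = i (snd u)"
    by (auto simp: relabel_def)
  then have "snd t = snd u" using assms(2) by (intro inj_onD[OF assms(1)]) auto
  then show "t \<in> T" using u by (metis prod_eqI)
qed (use assms(2) in \<open>auto simp: relabel_def\<close>)

lemma relabel_subset: "T \<subseteq> S \<times> I \<Longrightarrow> relabel i T \<subseteq> S \<times> i ` I"
  by (auto simp: relabel_def)

lemma finite_relabel: "finite T \<Longrightarrow> finite (relabel i T)"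
  by (simp add: relabel_def)

lemma weight_relabel:
  assumes "inj_on i I" "T \<subseteq> S \<times> I"
  shows "weight (relabel i T) = weight T"
proof -
  have "inj_on (\<lambda>t. (fst t, i (snd t))) T"
  proof (rule inj_onI)
    fix t u assume tu: "t \<in> T" "u \<in> T" "(fst t, i (snd t)) = (fst u, i (snd u))"
    then have "snd t = snd u" using assms(2) by (intro inj_onD[OF assms(1)]) auto
    then show "t = u" using tu(3) by (auto intro: prod_eqI)
  qed
  then show ?thesis by (simp add: weight_def relabel_def prod.reindex)
qed

lemma weight_Un_disjoint: "finite T \<Longrightarrow> finite U \<Longrightarrow> T \<inter> U = {} \<Longrightarrow> weight (T \<union> U) = weight T * weight U"
  unfolding weight_def by (rule prod.union_disjoint)

text \<open>J contains two disjoint copies of I. A pair (T, U) is sent to the union of its copies,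
  from which both can be read off, and the weights multiply. For Dirichlet series this is the square
  of the series for I.\<close>

lemma sum_card_weighted_sets_le:
  fixes I :: "'b set" and J :: "'c set"
  assumes S: "\<And>p. p \<in> S \<Longrightarrow> p > 0" and fin: "finite I" "finite J" and IJ: "2 * card I \<le> card J"
  shows "(\<Sum>T\<in>weighted_sets S I y. card (weighted_sets S I (x / real (weight T)))) \<le> card (weighted_sets S J x)"
proof -
  have "card (I \<times> (UNIV :: bool set)) \<le> card J" using IJ by (simp add: card_cartesian_product mult.commute)
  then obtain h where h: "inj_on h (I \<times> (UNIV :: bool set))" "h ` (I \<times> UNIV) \<subseteq> J"
    using inj_on_iff_card_le[of "I \<times> (UNIV :: bool set)" J] fin by auto
  define i where "i r = h (r, False)" for r
  define j where "j r = h (r, True)" for r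
  have inj: "inj_on i I" "inj_on j I" using h(1) by (auto simp: inj_on_def i_def j_def)
  have IJ: "i ` I \<subseteq> J" "j ` I \<subseteq> J" using h(2) by (auto simp: i_def j_def)
  have disj: "i ` I \<inter> j ` I = {}" using h(1) by (auto simp: inj_on_def i_def j_def)
  define W where "W = Sigma (weighted_sets S I y) (\<lambda>T. weighted_sets S I (x / real (weight T)))"
  define f where "f = (\<lambda>(T, U). relabel i T \<union> relabel j U)"
  have W: "finite T \<and> T \<subseteq> S \<times> I \<and> finite U \<and> U \<subseteq> S \<times> I \<and> real (weight U) \<le> x / real (weight T)"
    if "(T, U) \<in> W" for T U using that by (auto simp: W_def weighted_sets_def)
  have recover: "T = {t. snd t \<in> I \<and> (fst t, i (snd t)) \<in> f (T, U)} \<and>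
      U = {t. snd t \<in> I \<and> (fst t, j (snd t)) \<in> f (T, U)}" if "(T, U) \<in> W" for T U
  proof
    have TU: "T \<subseteq> S \<times> I" "U \<subseteq> S \<times> I" using W[OF that] by auto
    have "(fst t, i (snd t)) \<notin> relabel j U" "(fst t, j (snd t)) \<notin> relabel i T" if "snd t \<in> I" for t
      using that relabel_subset[OF TU(1), of i] relabel_subset[OF TU(2), of j] disj by blast+
    then have "{t. snd t \<in> I \<and> (fst t, i (snd t)) \<in> f (T, U)} = {t. snd t \<in> I \<and> (fst t, i (snd t)) \<in> relabel i T}"
      "{t. snd t \<in> I \<and> (fst t, j (snd t)) \<in> f (T, U)} = {t. snd t \<in> I \<and> (fst t, j (snd t)) \<in> relabel j U}"
      by (auto simp: f_def)
    then show "T = {t. snd t \<in> I \<and> (fst t, i (snd t)) \<in> f (T, U)}" "U = {t. snd t \<in> I \<and> (fst t, j (snd t)) \<in> f (T, U)}"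
      using relabel_inverse[OF inj(1) TU(1)] relabel_inverse[OF inj(2) TU(2)] by simp_all
  qed
  have "inj_on f W"
  proof (rule inj_onI)
    fix a b assume ab: "a \<in> W" "b \<in> W" "f a = f b"
    then have "fst a = fst b" "snd a = snd b"
      using recover[of "fst a" "snd a"] recover[of "fst b" "snd b"] by simp_all
    then show "a = b" by (rule prod_eqI)
  qed
  moreover have "f ` W \<subseteq> weighted_sets S J x"
  proof (rule image_subsetI)
    fix a assume "a \<in> W"
    obtain T U where a: "a = (T, U)" by fastforce
    have TU: "finite T" "T \<subseteq> S \<times> I" "finite U" "U \<subseteq> S \<times> I" "real (weight U) \<le> x / real (weight T)"
      using W[of T U] \<open>a \<in> W\<close> a by auto
    have sub: "relabel i T \<subseteq> S \<times> i ` I" "relabel j U \<subseteq> S \<times> j ` I" using TU relabel_subset by blast+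
    have "weight (f a) = weight T * weight U"
      unfolding a f_def using sub disj TU
      by (simp add: weight_Un_disjoint finite_relabel weight_relabel[OF inj(1) TU(2)] weight_relabel[OF inj(2) TU(4)])
         (subst weight_Un_disjoint; auto simp: finite_relabel weight_relabel[OF inj(1) TU(2)] weight_relabel[OF inj(2) TU(4)])
    moreover have "weight T > 0" using weight_pos[OF TU(1,2) S] .
    ultimately have "real (weight (f a)) \<le> x" using TU(5) by (simp add: pos_le_divide_eq mult.commute)
    then show "f a \<in> weighted_sets S J x"
      using sub IJ TU by (auto simp: weighted_sets_def a f_def finite_relabel)
  qed
  ultimately have "card W \<le> card (weighted_sets S J x)"
    using finite_weighted_sets[OF fin(2) S] by (metis card_image card_mono)
  moreover have "card W = (\<Sum>T\<in>weighted_sets S I y. card (weighted_sets S I (x / real (weight T))))"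
    unfolding W_def using finite_weighted_sets[OF fin(1) S] by (intro card_SigmaI) auto
  ultimately show ?thesis by simp
qed

text \<open>If the sets with labels in \<open>I\<close> have positive lower density, their reciprocal weights have an infinite sum;
  splitting \<open>J\<close> into two copies of \<open>I\<close> then produces more than linearly many sets with labels in \<open>J\<close>.\<close>

lemma weighted_sets_growth_contradiction:
  fixes I :: "'b set" and J :: "'c set"
  assumes S: "\<And>p. p \<in> S \<Longrightarrow> p > 0" and fin: "finite I" "finite J" and IJ: "2 * card I \<le> card J"
    and a: "a > 0" and lower: "\<And>x. x \<ge> x\<^sub>0 \<Longrightarrow> a * x \<le> real (card (weighted_sets S I x))"
    and upper: "\<And>x. x \<ge> 1 \<Longrightarrow> real (card (weighted_sets S J x)) \<le> K * x"
  shows False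
proof -
  define W where "W = (\<lambda>x. weighted_sets S I x)"
  define X where "X = max 1 x\<^sub>0"
  define h where "h y = (\<Sum>T\<in>W y. 1 / real (weight T))" for y
  have X: "X \<ge> 1" "X \<ge> x\<^sub>0" by (auto simp: X_def)
  have finW: "finite (W x)" for x unfolding W_def by (rule finite_weighted_sets[OF fin(1) S])
  have w_pos: "weight T > 0" if "T \<in> W x" for T x
    using that by (intro weight_pos[where S = S and I = I]) (auto simp: W_def weighted_sets_def S)
  \<comment> \<open>The pairs with empty first component already bound the count for I by the count
    for J.\<close>
  have upper_I: "real (card (W x)) \<le> K * x" if x: "x \<ge> 1" for x
  proof -
    have empty: "{} \<in> W 1" by (simp add: W_def weighted_sets_def weight_def)
    have "card (W x) = (\<Sum>T\<in>{{} :: (nat \<times> 'b) set}. card (W (x / real (weight T))))" by (simp add: weight_def)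
    also have "\<dots> \<le> (\<Sum>T\<in>W 1. card (W (x / real (weight T))))"
      using finW empty by (intro sum_mono2) auto
    also have "\<dots> \<le> card (weighted_sets S J x)"
      unfolding W_def by (rule sum_card_weighted_sets_le[OF S fin IJ])
    finally show ?thesis using upper[OF x] by linarith
  qed
  have h_bound: "h y \<le> K / a" if y: "y \<ge> 1" for y
  proof -
    \<comment> \<open>For this x, every T of weight at most y has x / weight(T) \<ge> X, where the
      lower bound applies.\<close>
    define x where "x = y * X"
    have x1: "x \<ge> 1" using mult_mono[of 1 y 1 X] X y by (simp add: x_def)
    have "a * x * h y = (\<Sum>T\<in>W y. a * (x / real (weight T)))"
      by (simp add: h_def sum_distrib_left)
    also have "\<dots> \<le> (\<Sum>T\<in>W y. real (card (W (x / real (weight T)))))"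
    proof (rule sum_mono)
      fix T assume T: "T \<in> W y"
      then have "real (weight T) \<le> y" by (simp add: W_def weighted_sets_def)
      then have "X * real (weight T) \<le> x" using X y by (simp add: x_def mult.commute mult_right_mono)
      then have "X \<le> x / real (weight T)" using w_pos[OF T] by (simp add: pos_le_divide_eq)
      then show "a * (x / real (weight T)) \<le> real (card (W (x / real (weight T))))"
        unfolding W_def using X(2) by (intro lower) linarith
    qed
    also have "\<dots> = real (\<Sum>T\<in>W y. card (W (x / real (weight T))))" by simp
    also have "\<dots> \<le> real (card (weighted_sets S J x))"
      unfolding W_def by (intro of_nat_mono sum_card_weighted_sets_le[OF S fin IJ])
    also have "\<dots> \<le> K * x" by (rule upper[OF x1])
    finally have "a * h y * x \<le> K * x" by (simp add: mult_ac)
    then have "a * h y \<le> K" using x1 by simp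
    then show ?thesis using a by (simp add: pos_le_divide_eq mult.commute)
  qed
  have "a * X \<le> K * X" using lower[OF X(2)] upper_I[OF X(1)] by (simp add: W_def)
  then have K: "K \<ge> a" using X by simp
  \<comment> \<open>Passing from x to q x adds at least a q x - K x = a q x / 2 sets, each of
    reciprocal weight at least 1 / (q x), so h grows by a / 2.\<close>
  define q where "q = 2 * K / a"
  have q: "q \<ge> 2" using K a by (simp add: q_def pos_le_divide_eq)
  have step: "h (q * x) \<ge> h x + a / 2" if x: "x \<ge> X" for x
  proof -
    have x_pos: "x > 0" "x \<ge> 1" using x X by linarith+
    have qx: "q * x \<ge> x" using mult_right_mono[of 1 q x] q x_pos by simp
    have sub: "W x \<subseteq> W (q * x)" using qx by (auto simp: W_def weighted_sets_def)
    have "a * (q * x) \<le> real (card (W (q * x)))"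
      unfolding W_def using X(2) x qx by (intro lower) linarith
    moreover have "real (card (W x)) \<le> K * x" using upper_I x_pos by simp
    moreover have "real (card (W (q * x) - W x)) = real (card (W (q * x))) - real (card (W x))"
      using sub finW by (simp add: card_Diff_subset card_mono of_nat_diff)
    ultimately have "a * (q * x) - K * x \<le> real (card (W (q * x) - W x))" by linarith
    moreover have "a * (q * x) - K * x = a / 2 * (q * x)" using a by (simp add: q_def)
    ultimately have "a / 2 * (q * x) \<le> real (card (W (q * x) - W x))" by simp
    then have "a / 2 \<le> real (card (W (q * x) - W x)) / (q * x)"
      using q x_pos by (subst pos_le_divide_eq) auto
    also have "\<dots> = (\<Sum>T\<in>W (q * x) - W x. 1 / (q * x))" by simp
    also have "\<dots> \<le> (\<Sum>T\<in>W (q * x) - W x. 1 / real (weight T))"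
    proof (rule sum_mono)
      fix T assume T: "T \<in> W (q * x) - W x"
      then have "real (weight T) \<le> q * x" by (simp add: W_def weighted_sets_def)
      then show "1 / (q * x) \<le> 1 / real (weight T)"
        using w_pos[of T "q * x"] T by (intro divide_left_mono) auto
    qed
    also have "\<dots> = h (q * x) - h x"
      unfolding h_def using sum_diff[OF finW sub, of "\<lambda>T. 1 / real (weight T)"] .
    finally show ?thesis by simp
  qed
  have grow: "h (q ^ j * X) \<ge> real j * (a / 2)" for j
  proof (induction j)
    case 0
    show ?case by (simp add: h_def sum_nonneg)
  next
    case (Suc j)
    have "q ^ j \<ge> 1" using q by (intro one_le_power) simp
    then have "q ^ j * X \<ge> X" using mult_right_mono[of 1 "q ^ j" X] X by simp
    then show ?case using step[of "q ^ j * X"] Suc.IH by (simp add: algebra_simps)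
  qed
  obtain j :: nat where "real j * (a / 2) > K / a" 
    using reals_Archimedean3[of "a / 2"] a by (meson half_gt_zero)
  moreover have "q ^ j * X \<ge> 1"
  proof -
    have "1 * 1 \<le> q ^ j * X" using q X by (intro mult_mono) auto
    then show ?thesis by simp
  qed
  ultimately show False using h_bound[of "q ^ j * X"] grow[of j] by linarith
qed

section \<open>Integer-valued polynomials and splitting\<close>

text \<open>Sending \<theta> to a complex root of h embeds Q(\<theta>) into the complex numbers; v
  is the modulus there.\<close>

lemma ex_absolute_value:
  assumes h: "is_minpoly h \<theta>"
  obtains v :: "'a::field_char_0 \<Rightarrow> real" where
    "\<And>x y. x \<in> simple_ext \<theta> \<Longrightarrow> y \<in> simple_ext \<theta> \<Longrightarrow> v (x * y) = v x * v y"
    "\<And>x y. x \<in> simple_ext \<theta> \<Longrightarrow> y \<in> simple_ext \<theta> \<Longrightarrow> v (x + y) \<le> v x + v y"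
    "\<And>k. v (of_int k) = \<bar>real_of_int k\<bar>"
proof -
  have irred: "irreducible h" and root: "rpoly h \<theta> = 0" using h by (auto simp: is_minpoly_def)
  have "degree (of_rat_poly h :: complex poly) = degree h" by (rule degree_map_poly) simp
  then obtain z :: complex where "poly (of_rat_poly h) z = 0"
    using alg_closed_imp_poly_has_root[of "of_rat_poly h :: complex poly"] irreducible_rat_degree_pos[OF irred]
    by auto
  then have z: "rpoly h z = 0" by (simp add: rpoly_def)
  define v where "v x = cmod (rpoly (SOME b. x = rpoly b \<theta>) z)" for x
  have v: "v (rpoly b \<theta>) = cmod (rpoly b z)" for b
  proof -
    have "rpoly b \<theta> = rpoly (SOME c. rpoly b \<theta> = rpoly c \<theta>) \<theta>"
      by (rule someI[of "\<lambda>c. rpoly b \<theta> = rpoly c \<theta>" b]) simp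
    then have "rpoly b z = rpoly (SOME c. rpoly b \<theta> = rpoly c \<theta>) z"
      by (rule rpoly_eq_transfer[OF irred root z])
    then show ?thesis by (simp add: v_def)
  qed
  show ?thesis
  proof (rule that[of v])
    fix x y assume "x \<in> simple_ext \<theta>" "y \<in> simple_ext \<theta>"
    then obtain b c where bc: "x = rpoly b \<theta>" "y = rpoly c \<theta>" by (auto elim!: simple_extE)
    show "v (x * y) = v x * v y"
      unfolding bc rpoly_mult[symmetric] v by (simp add: norm_mult)
    show "v (x + y) \<le> v x + v y"
      unfolding bc rpoly_add[symmetric] v by (simp add: norm_triangle_ineq)
  next
    fix k :: int
    have "of_int k = rpoly [:of_int k:] \<theta>" by simp
    then have "v (of_int k) = cmod (rpoly [:of_int k:] z)" using v by metis
    then show "v (of_int k) = \<bar>real_of_int k\<bar>" by (simp add: norm_of_int)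
  qed
qed

lemma roots_subset_if_normal:
  fixes K :: "'a::field_char_0 set"
  assumes "normal_over_rat K" "x \<in> K" "is_minpoly g x"
  shows "roots g \<subseteq> K"
proof
  fix r :: 'a assume "r \<in> roots g"
  have "irreducible g" "lead_coeff g = 1" "\<exists>x\<in>K. poly (of_rat_poly g) x = 0"
    using assms by (auto simp: is_minpoly_def rpoly_def)
  then obtain A where A: "set_mset A \<subseteq> K" "of_rat_poly g = (\<Prod>x\<in>#A. [:- x, 1:])"
    using assms(1) by (auto simp: normal_over_rat_def splits_over_def)
  have "poly (of_rat_poly g) r = 0" using \<open>r \<in> roots g\<close> by (simp add: roots_def rpoly_def)
  then have "r \<in># A" unfolding A(2) by (auto simp: poly_prod_mset prod_mset_zero_iff)
  then show "r \<in> K" using A by blast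
qed

text \<open>The embedding sending \<theta> to r maps \<kappa> and \<alpha> to roots of g and g',
  which lie in Q(\<theta>), and r is the same combination of these images as \<theta> is of \<kappa>
  and \<alpha>.\<close>

lemma roots_subset_compositum:
  assumes g: "is_minpoly g \<kappa>" "roots g \<subseteq> simple_ext \<theta>" and g': "is_minpoly g' \<alpha>" "roots g' \<subseteq> simple_ext \<theta>"
    and \<theta>: "\<theta> = \<kappa> + of_nat c * \<alpha>" "\<kappa> \<in> simple_ext \<theta>" "\<alpha> \<in> simple_ext \<theta>" and h: "is_minpoly h \<theta>"
  shows "roots h \<subseteq> simple_ext (\<theta> :: 'a::field_char_0)"
proof
  fix r :: 'a assume "r \<in> roots h"
  then have irred: "irreducible h" "rpoly h \<theta> = 0" "rpoly h r = 0"
    using h by (auto simp: roots_def is_minpoly_def)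
  note transfer = root_transfer[OF irred]
  obtain b where b: "\<kappa> = rpoly b \<theta>" using \<theta>(2) by (rule simple_extE)
  obtain b' where b': "\<alpha> = rpoly b' \<theta>" using \<theta>(3) by (rule simple_extE)
  have "rpoly (pcompose g b) r = 0" using transfer[of "pcompose g b"] g(1) by (simp add: b[symmetric] is_minpoly_def)
  then have "rpoly b r \<in> simple_ext \<theta>" using g(2) by (auto simp: roots_def)
  have "rpoly (pcompose g' b') r = 0" using transfer[of "pcompose g' b'"] g'(1) by (simp add: b'[symmetric] is_minpoly_def)
  then have "rpoly b' r \<in> simple_ext \<theta>" using g'(2) by (auto simp: roots_def)
  have "rpoly (b + Polynomial.smult (of_nat c) b' - [:0, 1:]) r = 0"
  proof (rule transfer)
    have "rpoly (b + Polynomial.smult (of_nat c) b' - [:0, 1:]) \<theta> = rpoly b \<theta> + of_nat c * rpoly b' \<theta> - \<theta>"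
      by simp
    then show "rpoly (b + Polynomial.smult (of_nat c) b' - [:0, 1:]) \<theta> = 0"
      unfolding b[symmetric] b'[symmetric] \<theta>(1)[symmetric] by simp
  qed
  then have "r = rpoly b r + of_nat c * rpoly b' r" by simp
  then show "r \<in> simple_ext \<theta>"
    using \<open>rpoly b r \<in> simple_ext \<theta>\<close> \<open>rpoly b' r \<in> simple_ext \<theta>\<close>
    by (metis simple_ext_add simple_ext_mult simple_ext_of_nat)
qed

text \<open>Elements fixed modulo p by the p-th power map are closed under integer combinations.
  This carries splitting over from the two generators to a generator of the compositum.\<close>

lemma algebraic_int_frobenius_sum:
  fixes x y :: "'a::field_char_0"
  assumes p: "prime p" and x: "algebraic_int x" "algebraic_int ((x ^ p - x) / of_nat p)"
    and y: "algebraic_int y" "algebraic_int ((y ^ p - y) / of_nat p)"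
  shows "algebraic_int (((x + of_nat c * y) ^ p - (x + of_nat c * y)) / of_nat p)"
proof -
  let ?c = "of_nat c :: 'a"
  have "((x + ?c * y) ^ p - (x + ?c * y)) / of_nat p =
    ((x + ?c * y) ^ p - (x ^ p + (?c * y) ^ p)) / of_nat p + (x ^ p - x) / of_nat p +
    ?c ^ p * ((y ^ p - y) / of_nat p) + y * ((of_int (int c) ^ p - of_int (int c)) / of_nat p)"
    by (simp add: add_divide_distrib diff_divide_distrib algebra_simps power_mult_distrib)
  also have "algebraic_int \<dots>"
    by (intro algebraic_int_add algebraic_int_mult algebraic_int_power algebraic_int_of_nat x y
        algebraic_int_freshmans_dream[OF p] algebraic_int_fermat[OF p])
  finally show ?thesis .
qed

lemma Int_rat_iff: "f \<in> Int_rat S \<longleftrightarrow> (\<forall>x\<in>S. rpoly f x \<in> S)"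
  by (auto simp: Int_rat_def rpoly_def)

text \<open>f(x) lies in K because f has rational coefficients, and its integrality does not depend
  on the field.\<close>

lemma Int_rat_mono_if_ring_of_integers_subset:
  assumes "is_subfield K" "\<O> K \<subseteq> \<O> K'"
  shows "Int_rat (\<O> K') \<subseteq> Int_rat (\<O> K)"
proof
  fix f assume f: "f \<in> Int_rat (\<O> K')"
  have "rpoly f x \<in> \<O> K" if x: "x \<in> \<O> K" for x
  proof -
    have "rpoly f x \<in> \<O> K'" using f x assms(2) by (auto simp: Int_rat_iff)
    moreover have "rpoly f x \<in> K"
      using simple_ext_subset_subfield[OF assms(1), of x] x simple_extI[OF refl, of f x]
      by (auto simp: ring_of_integers_def)
    ultimately show ?thesis by (simp add: ring_of_integers_def)
  qed
  then show "f \<in> Int_rat (\<O> K)" by (simp add: Int_rat_iff)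
qed

lemma ring_of_integers_subset_if_Int_rat_subset:
  fixes K K' :: "'a::{field_char_0, alg_closed_field} set"
  assumes alg: "\<forall>x::'a. algebraic x"
    and K: "number_field K" "normal_over_rat K" and K': "number_field K'" "normal_over_rat K'"
    and sub: "Int_rat (\<O> K') \<subseteq> Int_rat (\<O> K)"
  shows "\<O> K \<subseteq> \<O> K'"
proof (rule ccontr)
  assume "\<not> \<O> K \<subseteq> \<O> K'"
  \<comment> \<open>Integrality does not depend on the field, so an element of one ring outside the
    other lies outside the field K'.\<close>
  then obtain x where x: "x \<in> K" "x \<notin> K'" by (auto simp: ring_of_integers_def)
  obtain \<kappa> where \<kappa>: "algebraic_int \<kappa>" "K = simple_ext \<kappa>"
    using number_field_primitive_element[OF alg K(1)] by blast
  obtain \<alpha> where \<alpha>: "algebraic_int \<alpha>" "K' = simple_ext \<alpha>"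
    using number_field_primitive_element[OF alg K'(1)] by blast
  obtain c :: nat where c: "\<kappa> \<in> simple_ext (\<kappa> + of_nat c * \<alpha>)" "\<alpha> \<in> simple_ext (\<kappa> + of_nat c * \<alpha>)"
    using exists_primitive_sum[OF \<kappa>(1) \<alpha>(1)] by blast
  define \<theta> where "\<theta> = \<kappa> + of_nat c * \<alpha>"
  have \<theta>: "\<kappa> \<in> simple_ext \<theta>" "\<alpha> \<in> simple_ext \<theta>" "algebraic_int \<theta>"
    using c \<kappa> \<alpha> by (auto simp: \<theta>_def)
  note ext = simple_ext_mono[OF \<theta>(1)] simple_ext_mono[OF \<theta>(2)]
  obtain g where g: "is_minpoly g \<kappa>" using ex_minpoly alg by blast
  obtain g' where g': "is_minpoly g' \<alpha>" using ex_minpoly alg by blast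
  obtain h where h: "is_minpoly h \<theta>" using ex_minpoly alg by blast
  have roots: "roots g \<subseteq> simple_ext \<kappa>" "roots g' \<subseteq> simple_ext \<alpha>"
    using roots_subset_if_normal[OF K(2) _ g] roots_subset_if_normal[OF K'(2) _ g'] \<kappa> \<alpha> by auto
  have roots_h: "roots h \<subseteq> simple_ext \<theta>"
    using roots ext by (intro roots_subset_compositum[OF g _ g' _ \<theta>_def \<theta>(1,2) h]) auto
  obtain v :: "'a \<Rightarrow> real" where v:
    "\<And>x y. x \<in> simple_ext \<theta> \<Longrightarrow> y \<in> simple_ext \<theta> \<Longrightarrow> v (x * y) = v x * v y"
    "\<And>x y. x \<in> simple_ext \<theta> \<Longrightarrow> y \<in> simple_ext \<theta> \<Longrightarrow> v (x + y) \<le> v x + v y"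
    "\<And>k. v (of_int k) = \<bar>real_of_int k\<bar>" using ex_absolute_value[OF h] by blast
  interpret L: galois_abs \<theta> h v
    by unfold_locales (use h \<theta> roots_h v in auto)
  \<comment> \<open>The absolute value of the compositum, restricted to K'.\<close>
  interpret A: galois_abs \<alpha> g' v
    by unfold_locales (use g' \<alpha>(1) roots(2) v(3) in \<open>simp_all add: v(1,2) subsetD[OF ext(2)]\<close>)
  have degree: "2 * degree g' \<le> degree h"
    using degree_double_if_proper_extension[OF g' h \<theta>(2), of x] x \<kappa> \<alpha> ext by auto
  obtain Y\<^sub>0 where Y\<^sub>0: "\<And>Y. Y \<ge> Y\<^sub>0 \<Longrightarrow>
    \<exists>a>0. \<exists>x\<^sub>0. \<forall>x\<ge>x\<^sub>0. a * x \<le> real (card (weighted_sets (A.split_primes Y) (roots g' :: 'a set) x))"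
    using A.card_weighted_sets_lower by blast
  define Y where "Y = max Y\<^sub>0 (max A.E L.E)"
  define S where "S = A.split_primes Y"
  obtain a x\<^sub>0 where a: "a > 0" "\<And>x. x \<ge> x\<^sub>0 \<Longrightarrow> a * x \<le> real (card (weighted_sets S (roots g' :: 'a set) x))"
    using Y\<^sub>0[of Y] by (auto simp: Y_def S_def)
  have S: "prime p \<and> \<not> p dvd L.E \<and> L.split p" if "p \<in> S" for p
  proof -
    have p: "prime p" "Y < p" "A.split p" using that by (auto simp: S_def A.split_primes_def)
    have "\<not> p dvd L.E" "\<not> p dvd A.E"
      using p(2) A.E_pos L.E_pos by (auto simp: Y_def dest: dvd_imp_le)
    define f :: "rat poly" where "f = Polynomial.smult (1 / of_nat p) (monom 1 p - monom 1 1)"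
    have f: "rpoly f y = (y ^ p - y) / of_nat p" for y :: 'a
      by (simp add: f_def of_rat_divide)
    have "rpoly f y \<in> \<O> K'" if y: "y \<in> \<O> K'" for y
    proof -
      have "algebraic_int (rpoly f y)"
        unfolding f using y \<alpha>(2) p \<open>\<not> p dvd A.E\<close> by (intro A.split_imp_frobenius_trivial) auto
      moreover have "rpoly f y \<in> K'"
        using y A.rpoly_M[of y f] by (auto simp: \<alpha>(2) ring_of_integers_def)
      ultimately show ?thesis by (simp add: ring_of_integers_def)
    qed
    then have "f \<in> Int_rat (\<O> K')" by (simp add: Int_rat_iff)
    then have "f \<in> Int_rat (\<O> K)" using sub by blast
    moreover have "\<kappa> \<in> \<O> K" using \<kappa> by (simp add: ring_of_integers_def)
    ultimately have "algebraic_int ((\<kappa> ^ p - \<kappa>) / of_nat p)"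
      by (auto simp: Int_rat_iff f ring_of_integers_def)
    \<comment> \<open>The congruence holds for \<alpha> since p splits in K', and for \<kappa> by
      the inclusion of polynomial rings; \<theta> is an integer combination of the two.\<close>
    then have "L.split p"
      unfolding L.split_def unfolding \<theta>_def
      using p(3) by (intro algebraic_int_frobenius_sum[OF p(1)] \<kappa>(1) \<alpha>(1)) (simp_all only: A.split_def)
    then show ?thesis using p \<open>\<not> p dvd L.E\<close> by blast
  qed
  obtain B where B: "\<And>x. x \<ge> 1 \<Longrightarrow> real (card (weighted_sets S (roots h :: 'a set) x)) \<le> B * x"
    using L.card_weighted_sets_upper[OF S] by blast
  show False
  proof (rule weighted_sets_growth_contradiction[OF _ A.finite_R L.finite_R _ a B])
    show "p > 0" if "p \<in> S" for p using S[OF that] prime_gt_0_nat by blast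
    show "2 * card (roots g' :: 'a set) \<le> card (roots h :: 'a set)"
      using degree by (simp add: A.card_R L.card_R)
  qed
qed

theorem mainTheorem4:
  fixes K K' :: "'a::{field_char_0, alg_closed_field} set"
  assumes algebraic_closure: "\<forall>x::'a. algebraic x"
    and K: "finite_galois_over_rat K"
    and K': "finite_galois_over_rat K'"
  shows "\<O> K \<subseteq> \<O> K' \<longleftrightarrow> Int_rat (\<O> K') \<subseteq> Int_rat (\<O> K)"
proof
  assume "\<O> K \<subseteq> \<O> K'"
  then show "Int_rat (\<O> K') \<subseteq> Int_rat (\<O> K)"
    using K by (intro Int_rat_mono_if_ring_of_integers_subset)
      (simp_all add: finite_galois_over_rat_def number_field_def)
next
  assume "Int_rat (\<O> K') \<subseteq> Int_rat (\<O> K)"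
  then show "\<O> K \<subseteq> \<O> K'"
    using algebraic_closure K K' by (intro ring_of_integers_subset_if_Int_rat_subset)
      (simp_all add: finite_galois_over_rat_def)
qed

end
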